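(* Consider an optimal trajectory $(x,u)$ of the affine optimal control problem (P) together with its lift $p$ given by Pontryagin's Maximum Principle. Suppose the problem has intrinsic order $q$, and let $t_c$ be a junction of a singular arc and a nonsingular arc of this trajectory which is an analytic junction of order $q$, where the control on the singular arc satisfies $|u_i(t)|<K(t)$ for $i=1,\dots,m$. If $u^{(r)}$, $r\ge 0$, is the lowest order time derivative of the control $u$ which is discontinuous at $t_c$ (with $u^{(0)}=u$), then $q+r$ is odd.
   Context: Problem (P): minimize $\int_0^{T_f(u)} \big(f_0(x)+\sum_{i=1}^m g_{0i}(x)u_i\big)\,dt$ subject to $\dot x=f(x)+\sum_{i=1}^m g_i(x)u_i$, $x(0)=\mathcal A$, $x(T_f(u))=\mathcal B$ (given points of $\mathbb R^n$), where $u=(u_1,\dots,u_m):[0,T_f(u)]\to\mathbb R^m$ is measurable with $|u_i(t)|\le K(t)$ for all $t$ and $i$. The final time is free; $f,g_i$ are analytic vector fields on $\mathbb R^n$; $f_0,g_{0i}:\mathbb R^n\to\mathbb R$ are analytic; $K$ is analytic and strictly positive. Maximum Principle lift. Put $H_\lambda(x,p,u)=\langle p,f(x)+\sum_i g_i(x)u_i\rangle-\lambda\big(f_0(x)+\sum_i g_{0i}(x)u_i\big)$, $\lambda\in\{0,1\}$. Every optimal trajectory $(x,u)$ is considered with a lift $p(t)$ and $\lambda\in\{0,1\}$ such that $(\lambda,p(t))\ne0$ and, for almost all $t$, $\dot x=\partial H_\lambda/\partial p$, $\dot p=-\partial H_\lambda/\partial x$, $H_\lambda(x(t),p(t),u(t))=\max\{H_\lambda(x(t),p(t),w):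 |w_i|\le K(t)\}$, and $H_\lambda(x(t),p(t),u(t))=0$. Augmented notation. Add the coordinate $x_0$ with $\dot x_0=f_0(x)+\sum_i g_{0i}(x)u_i$, and from now on write $f,g_i,x,p$ for the augmented objects $(f_0,f)$, $(g_{0i},g_i)$, $(x_0,x)$, $(-\lambda,p)$ in dimension $n+1$, so that $H_\lambda=\langle p,f\rangle+\sum_i\langle p,g_i\rangle u_i$. Let $\phi_i=\langle p,g_i(x)\rangle$ and $\phi=(\phi_1,\dots,\phi_m)$, viewed along extremals. A singular interval (the trajectory restricted to it is a singular arc) is an interval on which all $\phi_i$ vanish. A nonsingular interval (nonsingular arc) is an interval on which all $\phi_i$ are nonzero almost everywhere; there the maximum condition gives $u_i(t)=\operatorname{sign}(\phi_i(t))K(t)$. A junction is a time $t_c$ which is the common endpoint of a singular interval and a nonsingular interval. Order. Differentiating $\phi$ repeatedly along extremals, let $k$ be the smallest integer such that $B_k:=\frac{\partial}{\partial u}\frac{d^k\phi}{dt^k}$ (an $m\times m$ matrix) is not identically zero as a function of $(x,p)$; then $\frac{d^k\phi}{dt^k}=A_k(x,p)+B_k(x,p)u$. The intrinsic order of the problem is $q=k/2$, assumed to be an integer; write $A=A_{2q}$, $B=B_{2q}$. The Generalized Legendre–Clebsch Condition (a result of Robbins, recalled by the paper as known) is in force: $(-1)^qB$ is negative semidefinite along singular arcs of optimal trajectories. A function is piecewise analytic on $(a,b)$ if for each $t_c\in(a,b)$ there are $t_1\in(a,t_c)$, $t_2\in(t_c,b)$ such that it is analytic on $(t_1,t_c)$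 and on $(t_c,t_2)$ (componentwise for vector-valued maps). A junction is analytic if the optimal control is piecewise analytic in a neighborhood of it. It is analytic of order $q$ if it is analytic, the problem has order $q$, and $B$ (evaluated along the trajectory) is nonsingular in a neighborhood of the junction. *)

theory Defs
  imports "HOL-Analysis.Analysis"
begin

section \<open>Analyticity and absolute continuity\<close>

text \<open>Real analyticity at a point: on a neighbourhood, the function is the sum of a multi-index
  power series. A multi-index is a map \<open>\<alpha>\<close> from the (finite) orthonormal basis to the naturals.\<close>

definition real_analytic_at :: "('a::euclidean_space \<Rightarrow> 'b::euclidean_space) \<Rightarrow> 'a \<Rightarrow> bool" where
  "real_analytic_at h x \<longleftrightarrow>
    (\<exists>c :: ('a \<Rightarrow> nat) \<Rightarrow> 'b. \<forall>\<^sub>F y in nhds x.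
      ((\<lambda>\<alpha>. (\<Prod>b\<in>Basis. ((y - x) \<bullet> b) ^ \<alpha> b) *\<^sub>R c \<alpha>) has_sum h y) (Basis \<rightarrow>\<^sub>E UNIV))"

definition real_analytic_on ::
    "('a::euclidean_space \<Rightarrow> 'b::euclidean_space) \<Rightarrow> 'a set \<Rightarrow> bool" where
  "real_analytic_on h S \<longleftrightarrow> (\<forall>x\<in>S. real_analytic_at h x)"

definition piecewise_real_analytic_on ::
    "(real \<Rightarrow> 'b::euclidean_space) \<Rightarrow> real \<Rightarrow> real \<Rightarrow> bool" where
  "piecewise_real_analytic_on h a b \<longleftrightarrow>
    (\<forall>t\<in>{a<..<b}. \<exists>t1\<in>{a<..<t}. \<exists>t2\<in>{t<..<b}.
      real_analytic_on h {t1<..<t} \<and> real_analytic_on h {t<..<t2})"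

text \<open>The usual \<open>\<epsilon>\<close>-\<open>\<delta>\<close> definition; a finite family of non-overlapping compact intervals
  is expressed as a division of its union.\<close>

definition absolutely_continuous_on_real ::
    "real set \<Rightarrow> (real \<Rightarrow> 'a::real_normed_vector) \<Rightarrow> bool" where
  "absolutely_continuous_on_real S h \<longleftrightarrow>
    (\<forall>\<epsilon>>0. \<exists>\<delta>>0. \<forall>D. D division_of \<Union>D \<and> \<Union>D \<subseteq> S \<and> (\<Sum>k\<in>D. Sup k - Inf k) < \<delta> \<longrightarrow>
      (\<Sum>k\<in>D. norm (h (Sup k) - h (Inf k))) < \<epsilon>)"

definition gradient :: "('a::real_inner \<Rightarrow> real) \<Rightarrow> 'a \<Rightarrow> 'a" where
  "gradient h x = (THE D. GDERIV h x :> D)"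

definition negative_semidefinite :: "real^'m^'m \<Rightarrow> bool" where
  "negative_semidefinite M \<longleftrightarrow> (\<forall>v. v \<bullet> (M *v v) \<le> 0)"

section \<open>The affine optimal control problem\<close>

record ('n, 'm) affine_problem =
  cost_drift :: "real^'n::finite \<Rightarrow> real"                 (* f_0 *)
  cost_field :: "'m::finite \<Rightarrow> real^'n \<Rightarrow> real"          (* g_0i *)
  drift :: "real^'n \<Rightarrow> real^'n"                           (* f *)
  control_field :: "'m \<Rightarrow> real^'n \<Rightarrow> real^'n"             (* g_i *)
  bound :: "real \<Rightarrow> real"                                 (* K *)
  source :: "real^'n"
  target :: "real^'n"

text \<open>The bound only matters at times \<open>t \<ge> 0\<close>; analyticity at 0 amounts to an analytic extension
  past 0.\<close>

definition analytic_problem :: "('n::finite, 'm::finite) affine_problem \<Rightarrow> bool" where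
  "analytic_problem P \<longleftrightarrow>
    real_analytic_on (cost_drift P) UNIV \<and> (\<forall>i. real_analytic_on (cost_field P i) UNIV) \<and>
    real_analytic_on (drift P) UNIV \<and> (\<forall>i. real_analytic_on (control_field P i) UNIV) \<and>
    real_analytic_on (bound P) {0..} \<and> (\<forall>t\<ge>0. bound P t > 0)"

definition dynamics ::
    "('n::finite, 'm::finite) affine_problem \<Rightarrow> real^'n \<Rightarrow> real^'m \<Rightarrow> real^'n" where
  "dynamics P x u = drift P x + (\<Sum>i\<in>UNIV. u $ i *\<^sub>R control_field P i x)"

definition running_cost ::
    "('n::finite, 'm::finite) affine_problem \<Rightarrow> real^'n \<Rightarrow> real^'m \<Rightarrow> real" where
  "running_cost P x u = cost_drift P x + (\<Sum>i\<in>UNIV. cost_field P i x * u $ i)"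

definition control_set :: "('n::finite, 'm::finite) affine_problem \<Rightarrow> real \<Rightarrow> (real^'m) set" where
  "control_set P t = {w. \<forall>i. \<bar>w $ i\<bar> \<le> bound P t}"

definition admissible :: "('n::finite, 'm::finite) affine_problem \<Rightarrow>
    real \<Rightarrow> (real \<Rightarrow> real^'n) \<Rightarrow> (real \<Rightarrow> real^'m) \<Rightarrow> bool" where
  "admissible P T x u \<longleftrightarrow>
    0 < T \<and>
    u \<in> borel_measurable (lebesgue_on {0..T}) \<and> (\<forall>t\<in>{0..T}. u t \<in> control_set P t) \<and>
    absolutely_continuous_on_real {0..T} x \<and>
    (AE t in lebesgue_on {0..T}.
      (x has_vector_derivative dynamics P (x t) (u t)) (at t within {0..T})) \<and>
    x 0 = source P \<and> x T = target P"

definition cost :: "('n::finite, 'm::finite) affine_problem \<Rightarrow>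
    real \<Rightarrow> (real \<Rightarrow> real^'n) \<Rightarrow> (real \<Rightarrow> real^'m) \<Rightarrow> real" where
  "cost P T x u = integral\<^sup>L (lebesgue_on {0..T}) (\<lambda>t. running_cost P (x t) (u t))"

definition optimal :: "('n::finite, 'm::finite) affine_problem \<Rightarrow>
    real \<Rightarrow> (real \<Rightarrow> real^'n) \<Rightarrow> (real \<Rightarrow> real^'m) \<Rightarrow> bool" where
  "optimal P T x u \<longleftrightarrow>
    admissible P T x u \<and>
    (\<forall>T' x' u'. admissible P T' x' u' \<longrightarrow> cost P T x u \<le> cost P T' x' u')"

section \<open>The Maximum Principle lift\<close>

definition hamiltonian :: "('n::finite, 'm::finite) affine_problem \<Rightarrow>
    real \<Rightarrow> real^'n \<Rightarrow> real^'n \<Rightarrow> real^'m \<Rightarrow> real" where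
  "hamiltonian P lam x p u = p \<bullet> dynamics P x u - lam * running_cost P x u"

definition pmp_lift :: "('n::finite, 'm::finite) affine_problem \<Rightarrow>
    real \<Rightarrow> (real \<Rightarrow> real^'n) \<Rightarrow> (real \<Rightarrow> real^'m) \<Rightarrow> real \<Rightarrow> (real \<Rightarrow> real^'n) \<Rightarrow> bool" where
  "pmp_lift P T x u lam p \<longleftrightarrow>
    lam \<in> {0, 1} \<and>
    (\<forall>t\<in>{0..T}. (lam, p t) \<noteq> 0) \<and>
    absolutely_continuous_on_real {0..T} p \<and>
    (AE t in lebesgue_on {0..T}.
      (x has_vector_derivative gradient (\<lambda>p'. hamiltonian P lam (x t) p' (u t)) (p t))
        (at t within {0..T}) \<and>
      (p has_vector_derivative - gradient (\<lambda>x'. hamiltonian P lam x' (p t) (u t)) (x t))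
        (at t within {0..T}) \<and>
      (\<forall>w\<in>control_set P t. hamiltonian P lam (x t) (p t) w \<le> hamiltonian P lam (x t) (p t) (u t)) \<and>
      hamiltonian P lam (x t) (p t) (u t) = 0)"

section \<open>Augmented system, switching functions and intrinsic order\<close>

text \<open>Augmented states and covectors live in \<open>real \<times> (real^'n)\<close>; a pair \<open>z\<close> of these is
  \<open>(X, Q) = ((x\<^sub>0, x), (-\<lambda>, p))\<close>.\<close>

type_synonym 'n aug = "real \<times> (real^'n)"

definition aug_drift ::
    "('n::finite, 'm::finite) affine_problem \<Rightarrow> 'n aug \<Rightarrow> 'n aug" where
  "aug_drift P X = (cost_drift P (snd X), drift P (snd X))"

definition aug_field ::
    "('n::finite, 'm::finite) affine_problem \<Rightarrow> 'm \<Rightarrow> 'n aug \<Rightarrow> 'n aug" where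
  "aug_field P i X = (cost_field P i (snd X), control_field P i (snd X))"

definition aug_hamiltonian :: "('n::finite, 'm::finite) affine_problem \<Rightarrow>
    'n aug \<Rightarrow> 'n aug \<Rightarrow> real^'m \<Rightarrow> real" where
  "aug_hamiltonian P X Q u = Q \<bullet> aug_drift P X + (\<Sum>i\<in>UNIV. (Q \<bullet> aug_field P i X) * u $ i)"

lemma aug_hamiltonian_eq:
  "aug_hamiltonian P (x0, x) (- lam, p) u = hamiltonian P lam x p u"
  by (simp add: aug_hamiltonian_def hamiltonian_def aug_drift_def aug_field_def dynamics_def
      running_cost_def inner_add_right inner_sum_right algebra_simps sum.distrib sum_distrib_left
      sum_subtractf)

definition hamiltonian_field :: "('n::finite, 'm::finite) affine_problem \<Rightarrow>
    'n aug \<times> 'n aug \<Rightarrow> real^'m \<Rightarrow> 'n aug \<times> 'n aug" where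
  "hamiltonian_field P z u =
    (gradient (\<lambda>Q. aug_hamiltonian P (fst z) Q u) (snd z),
     - gradient (\<lambda>X. aug_hamiltonian P X (snd z) u) (fst z))"

definition switching :: "('n::finite, 'm::finite) affine_problem \<Rightarrow>
    'n aug \<times> 'n aug \<Rightarrow> real^'m" where
  "switching P z = (\<chi> i. snd z \<bullet> aug_field P i (fst z))"

text \<open>\<open>switching_deriv P j z u\<close> is \<open>d\<^sup>j\<phi>/dt\<^sup>j\<close> along extremals, as a function of \<open>z = (X, Q)\<close>
  and \<open>u\<close>. As long as the \<open>j\<close>-th derivative does not involve \<open>u\<close> (i.e. for \<open>j < k\<close>), its value at
  \<open>u = 0\<close> is its common value for all \<open>u\<close>, so the recursion is plain differentiation along the
  Hamiltonian flow up to and including \<open>j = k\<close>; later indices are never used.\<close>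

primrec switching_deriv :: "('n::finite, 'm::finite) affine_problem \<Rightarrow> nat \<Rightarrow>
    'n aug \<times> 'n aug \<Rightarrow> real^'m \<Rightarrow> real^'m" where
  "switching_deriv P 0 = (\<lambda>z u. switching P z)"
| "switching_deriv P (Suc j) = (\<lambda>z u.
     frechet_derivative (\<lambda>z'. switching_deriv P j z' 0) (at z) (hamiltonian_field P z u))"

text \<open>The matrix \<open>B\<^sub>j\<close>; the derivative in \<open>u\<close> is taken at 0, but \<open>switching_deriv\<close> is affine
  in \<open>u\<close>.\<close>

definition control_matrix :: "('n::finite, 'm::finite) affine_problem \<Rightarrow> nat \<Rightarrow>
    'n aug \<times> 'n aug \<Rightarrow> real^'m^'m" where
  "control_matrix P j z = jacobian (switching_deriv P j z) (at 0)"

definition intrinsic_order :: "('n::finite, 'm::finite) affine_problem \<Rightarrow> nat \<Rightarrow> bool" where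
  "intrinsic_order P q \<longleftrightarrow>
    (\<exists>z. control_matrix P (2 * q) z \<noteq> 0) \<and> (\<forall>j<2 * q. \<forall>z. control_matrix P j z = 0)"

definition extremal_curve :: "('n::finite, 'm::finite) affine_problem \<Rightarrow>
    (real \<Rightarrow> real^'n) \<Rightarrow> (real \<Rightarrow> real^'m) \<Rightarrow> real \<Rightarrow> (real \<Rightarrow> real^'n) \<Rightarrow>
    real \<Rightarrow> 'n aug \<times> 'n aug" where
  "extremal_curve P x u lam p t = ((cost P t x u, x t), (- lam, p t))"

section \<open>Arcs and junctions\<close>

text \<open>In this section \<open>z\<close> is the augmented extremal curve on \<open>[0, T]\<close>.\<close>

definition singular_arc :: "('n::finite, 'm::finite) affine_problem \<Rightarrow> real \<Rightarrow>
    (real \<Rightarrow> 'n aug \<times> 'n aug) \<Rightarrow> real \<Rightarrow> real \<Rightarrow> bool" where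
  "singular_arc P T z a b \<longleftrightarrow>
    0 \<le> a \<and> a < b \<and> b \<le> T \<and> (\<forall>t\<in>{a<..<b}. \<forall>i. switching P (z t) $ i = 0)"

definition nonsingular_arc :: "('n::finite, 'm::finite) affine_problem \<Rightarrow> real \<Rightarrow>
    (real \<Rightarrow> 'n aug \<times> 'n aug) \<Rightarrow> real \<Rightarrow> real \<Rightarrow> bool" where
  "nonsingular_arc P T z a b \<longleftrightarrow>
    0 \<le> a \<and> a < b \<and> b \<le> T \<and>
    (AE t in lebesgue_on {a<..<b}. \<forall>i. switching P (z t) $ i \<noteq> 0)"

definition junction :: "('n::finite, 'm::finite) affine_problem \<Rightarrow> real \<Rightarrow>
    (real \<Rightarrow> 'n aug \<times> 'n aug) \<Rightarrow>
    real \<Rightarrow> real \<Rightarrow> real \<Rightarrow> real \<Rightarrow> real \<Rightarrow> bool" where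
  "junction P T z a b c d tc \<longleftrightarrow>
    singular_arc P T z a b \<and> nonsingular_arc P T z c d \<and> tc \<in> {a, b} \<and> tc \<in> {c, d}"

definition legendre_clebsch :: "('n::finite, 'm::finite) affine_problem \<Rightarrow> nat \<Rightarrow> real \<Rightarrow>
    (real \<Rightarrow> 'n aug \<times> 'n aug) \<Rightarrow> bool" where
  "legendre_clebsch P q T z \<longleftrightarrow>
    (\<forall>a b. singular_arc P T z a b \<longrightarrow>
      (\<forall>t\<in>{a<..<b}. negative_semidefinite ((- 1) ^ q *\<^sub>R control_matrix P (2 * q) (z t))))"

definition analytic_junction :: "real \<Rightarrow> (real \<Rightarrow> real^'m) \<Rightarrow> real \<Rightarrow> bool" where
  "analytic_junction T u tc \<longleftrightarrow>
    (\<exists>a b. 0 \<le> a \<and> a < tc \<and> tc < b \<and> b \<le> T \<and> piecewise_real_analytic_on u a b)"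

definition analytic_junction_of_order :: "('n::finite, 'm::finite) affine_problem \<Rightarrow> nat \<Rightarrow>
    real \<Rightarrow> (real \<Rightarrow> 'n aug \<times> 'n aug) \<Rightarrow> (real \<Rightarrow> real^'m) \<Rightarrow> real \<Rightarrow> bool" where
  "analytic_junction_of_order P q T z u tc \<longleftrightarrow>
    analytic_junction T u tc \<and> intrinsic_order P q \<and>
    (\<forall>\<^sub>F t in nhds tc. invertible (control_matrix P (2 * q) (z t)))"

definition nth_vector_derivative ::
    "nat \<Rightarrow> (real \<Rightarrow> 'a::real_normed_vector) \<Rightarrow> real \<Rightarrow> 'a" where
  "nth_vector_derivative s h = ((\<lambda>h' t. vector_derivative h' (at t)) ^^ s) h"

text \<open>An optimal control is determined only up to null sets, and piecewise analyticity around \<open>tc\<close>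
  leaves its value at \<open>tc\<close> free. Continuity at \<open>tc\<close> is therefore understood up to the value
  at \<open>tc\<close>, as existence of a two-sided limit; otherwise changing \<open>u tc\<close> alone would make \<open>r = 0\<close>.\<close>

definition continuous_across :: "(real \<Rightarrow> 'a::real_normed_vector) \<Rightarrow> real \<Rightarrow> bool" where
  "continuous_across h tc \<longleftrightarrow> (\<exists>l. (h \<longlongrightarrow> l) (at tc))"

definition lowest_discontinuous_derivative ::
    "(real \<Rightarrow> 'a::real_normed_vector) \<Rightarrow> real \<Rightarrow> nat \<Rightarrow> bool" where
  "lowest_discontinuous_derivative u tc r \<longleftrightarrow>
    \<not> continuous_across (nth_vector_derivative r u) tc \<and>
    (\<forall>s<r. continuous_across (nth_vector_derivative s u) tc)"

end

theory Submission
  imports Defs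
begin

text \<open>Let \<open>\<sigma>\<^sub>i = \<plusminus>1\<close> be the sign of \<open>u\<^sub>i\<close> on the nonsingular side, so that \<open>u = V := \<sigma> K\<close> there. Since
  \<open>d\<^sup>2\<^sup>q\<phi>/dt\<^sup>2\<^sup>q = A + B u\<close> vanishes on the singular arc and \<open>B\<close> is invertible, \<open>u = W := -B\<^sup>-\<^sup>1 A\<close> along
  the extremal there. Bootstrapping the Hamiltonian system, the extremal and hence \<open>W\<close> are \<open>C\<^sup>r\<close>
  across the junction, so \<open>G = V - W\<close> behaves on both sides like \<open>\<Delta> (t - t\<^sub>c)\<^sup>r / r!\<close> with \<open>\<Delta> \<noteq> 0\<close> the
  jump of the \<open>r\<close>-th derivative of \<open>u\<close>. On the singular side \<open>\<sigma>\<^sub>i G\<^sub>i = K - \<sigma>\<^sub>i u\<^sub>i \<ge> 0\<close>; on the nonsingular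
  side \<open>d\<^sup>2\<^sup>q\<phi>/dt\<^sup>2\<^sup>q = B G\<close>, so \<open>\<phi>\<^sub>i\<close> behaves like a positive multiple of
  \<open>(B \<Delta>)\<^sub>i (t - t\<^sub>c)\<^sup>2\<^sup>q\<^sup>+\<^sup>r\<close>, and \<open>\<sigma>\<^sub>i \<phi>\<^sub>i \<ge> 0\<close>. The two sides have opposite signs of \<open>t - t\<^sub>c\<close>, whence
  \<open>(-1)\<^sup>r \<Delta>\<^sub>i (B \<Delta>)\<^sub>i \<ge> 0\<close> for every \<open>i\<close>. By the Jacobi identity \<open>B\<close> is symmetric, so the
  Legendre--Clebsch condition makes \<open>(-1)\<^sup>q B\<close> negative definite, and \<open>q + r\<close> cannot be even.\<close>

section \<open>Continuously differentiable functions\<close>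

text \<open>With several controls everything hinges on the symmetry of \<open>B\<close>. The sign
  relations are obtained component by component, but only their sum can be compared with the
  Legendre-Clebsch condition, and an invertible semidefinite matrix that is not symmetric, such as a
  quarter turn of the plane, can have a form vanishing on nonzero vectors. Symmetry holds because
  each entry of \<open>B\<close> is a Poisson bracket of a switching function with one to which
  \<open>2 * q - 1\<close> brackets with the drift Hamiltonian have been applied; moving these to
  the other argument and swapping the arguments costs \<open>2 * q\<close> signs. The second
  obstacle is regularity. The state and adjoint equations hold only almost everywhere and the value
  of the control at the junction is meaningless, so derivatives must be recovered from integrals.
  The bootstrap gains one order per round as long as the control is still continuous across the
  junction to that order; it ends at order r, exactly the order at which the leading coefficients
  are read off by l'Hopital's rule. Analyticity enters through C^k smoothness.\<close>

primrec Ck_on :: "nat \<Rightarrow> ('a::euclidean_space \<Rightarrow> 'b::real_normed_vector) \<Rightarrow> 'a set \<Rightarrow> bool" where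
  "Ck_on 0 f U \<longleftrightarrow> continuous_on U f"
| "Ck_on (Suc k) f U \<longleftrightarrow> (\<forall>x\<in>U. f differentiable (at x)) \<and>
     (\<forall>b\<in>Basis. Ck_on k (\<lambda>x. frechet_derivative f (at x) b) U)"

lemma Ck_on_Suc_imp_continuous_on: "Ck_on (Suc k) f U \<Longrightarrow> continuous_on U f"
  by (auto intro!: continuous_at_imp_continuous_on differentiable_imp_continuous_within)

lemma Ck_on_imp_continuous_on: "Ck_on k f U \<Longrightarrow> continuous_on U f"
  by (cases k) (auto intro!: continuous_at_imp_continuous_on differentiable_imp_continuous_within)

lemma Ck_on_SucD: "Ck_on (Suc k) f U \<Longrightarrow> Ck_on k f U"
proof (induction k arbitrary: f)
  case 0
  then show ?case using Ck_on_Suc_imp_continuous_on by (metis Ck_on.simps(1))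
next
  case (Suc k)
  then show ?case by (metis Ck_on.simps(2))
qed

lemma Ck_on_mono: "Ck_on k f U \<Longrightarrow> j \<le> k \<Longrightarrow> Ck_on j f U"
  by (induction k) (auto simp del: Ck_on.simps simp: le_Suc_eq dest: Ck_on_SucD)

lemma Ck_on_subset: "Ck_on k f U \<Longrightarrow> V \<subseteq> U \<Longrightarrow> Ck_on k f V"
  by (induction k arbitrary: f) (auto intro: continuous_on_subset)

lemma frechet_derivative_cong_open:
  assumes "open U" "x \<in> U" "\<And>y. y \<in> U \<Longrightarrow> f y = g y"
  shows "frechet_derivative f (at x) = frechet_derivative g (at x)"
proof -
  have "(f has_derivative D) (at x) \<longleftrightarrow> (g has_derivative D) (at x)" for D
    using assms has_derivative_transform_within_open[of f D x UNIV U g]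
      has_derivative_transform_within_open[of g D x UNIV U f] by auto
  then show ?thesis by (simp add: frechet_derivative_def)
qed

lemma differentiable_cong_open:
  assumes "open U" "x \<in> U" "\<And>y. y \<in> U \<Longrightarrow> f y = g y"
  shows "f differentiable (at x) \<longleftrightarrow> g differentiable (at x)"
proof -
  have "(f has_derivative D) (at x) \<longleftrightarrow> (g has_derivative D) (at x)" for D
    using assms has_derivative_transform_within_open[of f D x UNIV U g]
      has_derivative_transform_within_open[of g D x UNIV U f] by auto
  then show ?thesis by (simp add: differentiable_def)
qed

lemma Ck_on_cong:
  assumes "open U" "\<And>x. x \<in> U \<Longrightarrow> f x = g x"
  shows "Ck_on k f U \<longleftrightarrow> Ck_on k g U"
  using assms(2)
proof (induction k arbitrary: f g)
  case 0
  then show ?case by (simp cong: continuous_on_cong)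
next
  case (Suc k)
  show ?case unfolding Ck_on.simps
    using Suc.prems differentiable_cong_open[OF assms(1), of _ f g]
      Suc.IH[of "\<lambda>x. frechet_derivative f (at x) _" "\<lambda>x. frechet_derivative g (at x) _"]
      frechet_derivative_cong_open[OF assms(1), of _ f g] by (metis (lifting))
qed

lemma Ck_on_SucI:
  assumes "open U" "\<And>x. x \<in> U \<Longrightarrow> (f has_derivative f' x) (at x)"
    "\<And>b. b \<in> Basis \<Longrightarrow> Ck_on k (\<lambda>x. f' x b) U"
  shows "Ck_on (Suc k) f U"
proof -
  have eq: "frechet_derivative f (at x) = f' x" if "x \<in> U" for x
    using assms(2)[OF that] frechet_derivative_at by force
  have "Ck_on k (\<lambda>x. frechet_derivative f (at x) b) U" if "b \<in> Basis" for b
    using Ck_on_cong[OF assms(1), of "\<lambda>x. frechet_derivative f (at x) b" "\<lambda>x. f' x b" k]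
      eq assms(3)[OF that] by auto
  then show ?thesis using assms(2) by (auto simp: differentiable_def)
qed

lemma Ck_on_SucE:
  assumes "Ck_on (Suc k) f U"
  obtains f' where "\<And>x. x \<in> U \<Longrightarrow> (f has_derivative f' x) (at x)"
    "\<And>b. b \<in> Basis \<Longrightarrow> Ck_on k (\<lambda>x. f' x b) U"
  using assms that[of "\<lambda>x. frechet_derivative f (at x)"]
  by (auto simp: frechet_derivative_works)

text \<open>\<open>S\<close> need not be open. This matters for the bound on \<open>{0..}\<close>,
  where analyticity at 0 supplies a neighbourhood reaching past 0 and hence two-sided derivatives
  there.\<close>

lemma Ck_on_local:
  assumes "\<And>x. x \<in> S \<Longrightarrow> \<exists>U. open U \<and> x \<in> U \<and> Ck_on k f U"
  shows "Ck_on k f S"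
  using assms
proof (induction k arbitrary: f)
  case 0
  then have "continuous (at x) f" if "x \<in> S" for x
    using that by (metis Ck_on.simps(1) continuous_on_eq_continuous_at)
  then show ?case by (simp add: continuous_at_imp_continuous_on)
next
  case (Suc k)
  have "f differentiable (at x)" if "x \<in> S" for x
    using Suc.prems[OF that] by auto
  moreover have "Ck_on k (\<lambda>x. frechet_derivative f (at x) b) S" if "b \<in> Basis" for b
  proof (rule Suc.IH)
    fix x assume "x \<in> S"
    from Suc.prems[OF this] show "\<exists>U. open U \<and> x \<in> U \<and> Ck_on k (\<lambda>x. frechet_derivative f (at x) b) U"
      using that by auto
  qed
  ultimately show ?case by simp
qed

lemma Ck_on_const: "Ck_on k (\<lambda>x. c) U"
  by (induction k arbitrary: c) auto

lemma Ck_on_bounded_linear_compose: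
  assumes "bounded_linear L" "open U" "Ck_on k f U"
  shows "Ck_on k (\<lambda>x. L (f x)) U"
  using assms(3)
proof (induction k arbitrary: f)
  case 0
  then show ?case by (simp add: bounded_linear.continuous_on[OF assms(1)])
next
  case (Suc k)
  obtain f' where f': "\<And>x. x \<in> U \<Longrightarrow> (f has_derivative f' x) (at x)"
    "\<And>b. b \<in> Basis \<Longrightarrow> Ck_on k (\<lambda>x. f' x b) U" using Suc.prems by (rule Ck_on_SucE) blast
  show ?case
    by (rule Ck_on_SucI[OF assms(2), where f' = "\<lambda>x h. L (f' x h)"])
       (auto intro: bounded_linear.has_derivative[OF assms(1)] f' Suc.IH)
qed

lemma Ck_on_id: "open U \<Longrightarrow> Ck_on k (\<lambda>x. x) U"
proof (cases k)
  case (Suc j)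
  assume "open U"
  then show ?thesis unfolding Suc
    by (rule Ck_on_SucI[where f' = "\<lambda>x h. h"]) (auto intro: Ck_on_const)
qed auto

lemmas Ck_on_bounded_linear = Ck_on_bounded_linear_compose[OF _ _ Ck_on_id]

lemma Ck_on_add:
  assumes "open U" "Ck_on k f U" "Ck_on k g U"
  shows "Ck_on k (\<lambda>x. f x + g x) U"
  using assms(2,3)
proof (induction k arbitrary: f g)
  case 0
  then show ?case by (auto intro: continuous_intros)
next
  case (Suc k)
  obtain f' where f': "\<And>x. x \<in> U \<Longrightarrow> (f has_derivative f' x) (at x)"
    "\<And>b. b \<in> Basis \<Longrightarrow> Ck_on k (\<lambda>x. f' x b) U" using Suc.prems(1) by (rule Ck_on_SucE) blast
  obtain g' where g': "\<And>x. x \<in> U \<Longrightarrow> (g has_derivative g' x) (at x)"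
    "\<And>b. b \<in> Basis \<Longrightarrow> Ck_on k (\<lambda>x. g' x b) U" using Suc.prems(2) by (rule Ck_on_SucE) blast
  show ?case
    by (rule Ck_on_SucI[OF assms(1), where f' = "\<lambda>x h. f' x h + g' x h"])
       (auto intro!: has_derivative_add f' g' Suc.IH)
qed

lemma Ck_on_sum:
  assumes "open U" "\<And>i. i \<in> I \<Longrightarrow> Ck_on k (f i) U"
  shows "Ck_on k (\<lambda>x. \<Sum>i\<in>I. f i x) U"
  using assms(2) by (induction I rule: infinite_finite_induct) (auto intro: Ck_on_add assms(1) Ck_on_const)

text \<open>Both halves of the product rule are again bilinear in functions of class C^k, so the
  induction closes. Scaling, inner product and multiplication become instances.\<close>

lemma Ck_on_bilinear:
  assumes "bounded_bilinear pr" "open U" "Ck_on k f U" "Ck_on k g U"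
  shows "Ck_on k (\<lambda>x. pr (f x) (g x)) U"
  using assms(3,4)
proof (induction k arbitrary: f g)
  case 0
  then show ?case by (simp add: bounded_bilinear.continuous_on[OF assms(1)])
next
  case (Suc k)
  obtain f' where f': "\<And>x. x \<in> U \<Longrightarrow> (f has_derivative f' x) (at x)"
    "\<And>b. b \<in> Basis \<Longrightarrow> Ck_on k (\<lambda>x. f' x b) U" using Suc.prems(1) by (rule Ck_on_SucE) blast
  obtain g' where g': "\<And>x. x \<in> U \<Longrightarrow> (g has_derivative g' x) (at x)"
    "\<And>b. b \<in> Basis \<Longrightarrow> Ck_on k (\<lambda>x. g' x b) U" using Suc.prems(2) by (rule Ck_on_SucE) blast
  show ?case
    by (rule Ck_on_SucI[OF assms(2), where f' = "\<lambda>x h. pr (f x) (g' x h) + pr (f' x h) (g x)"])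
       (auto intro!: bounded_bilinear.FDERIV[OF assms(1)] f' g' Suc.IH Ck_on_add assms(2)
         Ck_on_SucD[OF Suc.prems(1)] Ck_on_SucD[OF Suc.prems(2)])
qed

lemmas Ck_on_scaleR = Ck_on_bilinear[OF bounded_bilinear_scaleR]
lemmas Ck_on_inner = Ck_on_bilinear[OF bounded_bilinear_inner]
lemmas Ck_on_mult = Ck_on_bilinear[OF bounded_bilinear_mult]

lemma Ck_on_minus: "open U \<Longrightarrow> Ck_on k f U \<Longrightarrow> Ck_on k (\<lambda>x. - f x) U"
  by (rule Ck_on_bounded_linear_compose) (auto intro: bounded_linear_minus bounded_linear_ident)

lemma Ck_on_diff:
  "open U \<Longrightarrow> Ck_on k f U \<Longrightarrow> Ck_on k g U \<Longrightarrow> Ck_on k (\<lambda>x. f x - g x) U"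
  using Ck_on_add[of U k f "\<lambda>x. - g x"] Ck_on_minus[of U k g] by simp

lemma Ck_on_prod:
  fixes f :: "'i \<Rightarrow> 'a::euclidean_space \<Rightarrow> real"
  assumes "open U" "\<And>i. i \<in> I \<Longrightarrow> Ck_on k (f i) U"
  shows "Ck_on k (\<lambda>x. \<Prod>i\<in>I. f i x) U"
  using assms(2) by (induction I rule: infinite_finite_induct) (auto intro: Ck_on_mult assms(1) Ck_on_const)

lemma Ck_on_componentwise:
  fixes f :: "'a::euclidean_space \<Rightarrow> 'b::euclidean_space"
  assumes "open U" "\<And>i. i \<in> Basis \<Longrightarrow> Ck_on k (\<lambda>x. f x \<bullet> i) U"
  shows "Ck_on k f U"
proof -
  have "Ck_on k (\<lambda>x. \<Sum>i\<in>Basis. (f x \<bullet> i) *\<^sub>R i) U"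
    by (intro Ck_on_sum Ck_on_scaleR Ck_on_const assms)
  then show ?thesis by (simp add: euclidean_representation)
qed

lemma Ck_on_vec:
  fixes f :: "'a::euclidean_space \<Rightarrow> real^'n::finite"
  assumes "open U" "\<And>i. Ck_on k (\<lambda>x. f x $ i) U"
  shows "Ck_on k f U"
proof (rule Ck_on_componentwise[OF assms(1)])
  fix i :: "real^'n" assume "i \<in> Basis"
  then obtain j where "i = axis j 1" by (auto simp: Basis_vec_def)
  then show "Ck_on k (\<lambda>x. f x \<bullet> i) U" using assms(2)[of j] by (simp add: inner_axis)
qed

lemma Ck_on_vec_nth:
  fixes f :: "'a::euclidean_space \<Rightarrow> real^'n::finite"
  assumes "open U" "Ck_on k f U" shows "Ck_on k (\<lambda>x. f x $ i) U"
  by (rule Ck_on_bounded_linear_compose[OF bounded_linear_vec_nth assms])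

lemma Ck_on_Pair:
  fixes f :: "'a::euclidean_space \<Rightarrow> 'b::euclidean_space" and g :: "'a \<Rightarrow> 'c::euclidean_space"
  assumes "open U" "Ck_on k f U" "Ck_on k g U"
  shows "Ck_on k (\<lambda>x. (f x, g x)) U"
proof -
  have "Ck_on k (\<lambda>x. (f x, 0)) U"
    by (rule Ck_on_bounded_linear_compose[OF
          bounded_linear_Pair[OF bounded_linear_ident bounded_linear_zero] assms(1,2)])
  moreover have "Ck_on k (\<lambda>x. (0, g x)) U"
    by (rule Ck_on_bounded_linear_compose[OF
          bounded_linear_Pair[OF bounded_linear_zero bounded_linear_ident] assms(1,3)])
  ultimately show ?thesis
    using Ck_on_add[OF assms(1), of k "\<lambda>x. (f x, 0)" "\<lambda>x. (0, g x)"] by simp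
qed

lemma Ck_on_inverse:
  fixes f :: "'a::euclidean_space \<Rightarrow> real"
  assumes "open U" "Ck_on k f U" "\<And>x. x \<in> U \<Longrightarrow> f x \<noteq> 0"
  shows "Ck_on k (\<lambda>x. inverse (f x)) U"
  using assms(2)
proof (induction k)
  case 0
  then show ?case using assms(3) by (auto intro!: continuous_intros)
next
  case (Suc k)
  obtain f' where f': "\<And>x. x \<in> U \<Longrightarrow> (f has_derivative f' x) (at x)"
    "\<And>b. b \<in> Basis \<Longrightarrow> Ck_on k (\<lambda>x. f' x b) U" using Suc.prems by (rule Ck_on_SucE) blast
  show ?case
  proof (rule Ck_on_SucI[OF assms(1), where f' = "\<lambda>x h. - (inverse (f x) * f' x h * inverse (f x))"])
    show "((\<lambda>x. inverse (f x)) has_derivative (\<lambda>h. - (inverse (f x) * f' x h * inverse (f x)))) (at x)"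
      if "x \<in> U" for x
      using Deriv.has_derivative_inverse[OF assms(3)[OF that] f'(1)[OF that]] .
  qed (intro f' assms(1) Suc.IH Ck_on_minus Ck_on_mult Ck_on_SucD[OF Suc.prems])
qed

lemma Ck_on_divide:
  fixes f :: "'a::euclidean_space \<Rightarrow> real"
  assumes "open U" "Ck_on k f U" "Ck_on k g U" "\<And>x. x \<in> U \<Longrightarrow> g x \<noteq> 0"
  shows "Ck_on k (\<lambda>x. f x / g x) U"
  using Ck_on_mult[OF assms(1,2) Ck_on_inverse[OF assms(1,3,4)]] by (simp add: divide_inverse)

lemma Ck_on_compose:
  fixes f :: "'b::euclidean_space \<Rightarrow> 'c::real_normed_vector" and g :: "'a::euclidean_space \<Rightarrow> 'b"
  assumes "open U" "open V" "g ` U \<subseteq> V" "Ck_on k f V" "Ck_on k g U"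
  shows "Ck_on k (\<lambda>x. f (g x)) U"
  using assms(4,5)
proof (induction k arbitrary: f)
  case 0
  then show ?case using assms(3) by (auto intro: continuous_on_compose2)
next
  case (Suc k)
  obtain f' where f': "\<And>x. x \<in> V \<Longrightarrow> (f has_derivative f' x) (at x)"
    "\<And>b. b \<in> Basis \<Longrightarrow> Ck_on k (\<lambda>x. f' x b) V" using Suc.prems(1) by (rule Ck_on_SucE) blast
  obtain g' where g': "\<And>x. x \<in> U \<Longrightarrow> (g has_derivative g' x) (at x)"
    "\<And>b. b \<in> Basis \<Longrightarrow> Ck_on k (\<lambda>x. g' x b) U" using Suc.prems(2) by (rule Ck_on_SucE) blast
  show ?case
  \<comment> \<open>In \<open>f' (g x) (g' x h)\<close> the direction varies with x, while the
    induction hypothesis speaks of fixed basis directions. Expanding the direction over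
    \<open>Basis\<close> leaves a finite sum of products of C^k functions.\<close>
  proof (rule Ck_on_SucI[OF assms(1), where f' = "\<lambda>x h. \<Sum>b\<in>Basis. (g' x h \<bullet> b) *\<^sub>R f' (g x) b"])
    fix x assume x: "x \<in> U"
    then have gx: "g x \<in> V" using assms(3) by auto
    have lin: "linear (f' (g x))" using f'(1)[OF gx] by (simp add: has_derivative_linear)
    have "f' (g x) (g' x h) = (\<Sum>b\<in>Basis. (g' x h \<bullet> b) *\<^sub>R f' (g x) b)" for h
      by (subst euclidean_representation[of "g' x h", symmetric])
         (simp only: linear_sum[OF lin] linear_cmul[OF lin])
    then show "((\<lambda>x. f (g x)) has_derivative (\<lambda>h. \<Sum>b\<in>Basis. (g' x h \<bullet> b) *\<^sub>R f' (g x) b)) (at x)"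
      using has_derivative_compose[OF g'(1)[OF x] f'(1)[OF gx]] by simp
  next
    fix b' :: 'a assume "b' \<in> Basis"
    then show "Ck_on k (\<lambda>x. \<Sum>b\<in>Basis. (g' x b' \<bullet> b) *\<^sub>R f' (g x) b) U"
      by (intro Ck_on_sum Ck_on_scaleR Ck_on_inner Ck_on_const g' Suc.IH f' assms(1)
          Ck_on_SucD[OF Suc.prems(2)])
  qed
qed

text \<open>The direction \<open>v x\<close> may move with the point, which is what differentiation
  along a vector field needs; expansion over \<open>Basis\<close> reduces it to the fixed directions
  in the definition.\<close>

lemma Ck_on_frechet_derivative:
  fixes f :: "'a::euclidean_space \<Rightarrow> 'b::real_normed_vector"
  assumes "open U" "Ck_on (Suc k) f U" "Ck_on k v U"
  shows "Ck_on k (\<lambda>x. frechet_derivative f (at x) (v x)) U"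
proof -
  have "frechet_derivative f (at x) (v x) =
      (\<Sum>b\<in>Basis. (v x \<bullet> b) *\<^sub>R frechet_derivative f (at x) b)" if "x \<in> U" for x
  proof -
    have lin: "linear (frechet_derivative f (at x))"
      using assms(2) that by (auto intro: linear_frechet_derivative)
    show ?thesis
      by (subst euclidean_representation[of "v x", symmetric])
         (simp only: linear_sum[OF lin] linear_cmul[OF lin])
  qed
  moreover have "Ck_on k (\<lambda>x. \<Sum>b\<in>Basis. (v x \<bullet> b) *\<^sub>R frechet_derivative f (at x) b) U"
    using assms by (auto intro!: Ck_on_sum Ck_on_scaleR Ck_on_inner Ck_on_const)
  ultimately show ?thesis using Ck_on_cong[OF assms(1)] by (metis (mono_tags, lifting))
qed

lemma Ck_on_det:
  fixes M :: "'a::euclidean_space \<Rightarrow> real^'m^'m"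
  assumes "open U" "\<And>i j. Ck_on k (\<lambda>x. M x $ i $ j) U"
  shows "Ck_on k (\<lambda>x. det (M x)) U"
  unfolding det_def by (intro Ck_on_sum Ck_on_mult Ck_on_prod Ck_on_const assms)

text \<open>By Cramer's rule the solution is a quotient of determinants, which are polynomials in
  the entries, and the denominator does not vanish on \<open>U\<close>.\<close>

lemma Ck_on_linear_solve:
  fixes M :: "'a::euclidean_space \<Rightarrow> real^'m^'m"
  assumes "open U" "\<And>i j. Ck_on k (\<lambda>x. M x $ i $ j) U" "\<And>i. Ck_on k (\<lambda>x. y x $ i) U"
    "\<And>x. x \<in> U \<Longrightarrow> invertible (M x)"
  obtains w where "Ck_on k w U" "\<And>x v. x \<in> U \<Longrightarrow> M x *v v = y x \<longleftrightarrow> v = w x"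
proof
  let ?w = "\<lambda>x. \<chi> l. det (\<chi> i j. if j = l then y x $ i else M x $ i $ j) / det (M x)"
  show "M x *v v = y x \<longleftrightarrow> v = ?w x" if "x \<in> U" for x v
    using cramer[of "M x" v "y x"] assms(4)[OF that] by (simp add: invertible_det_nz)
  have *: "Ck_on k (\<lambda>x. (\<chi> i j. if j = l then y x $ i else M x $ i $ j) $ i $ j) U" for i j l :: 'm
    using assms(2,3) by (cases "j = l") simp_all
  show "Ck_on k ?w U"
    using assms(4) * by (intro Ck_on_vec)
      (auto intro!: Ck_on_divide Ck_on_det assms simp: invertible_det_nz)
qed

section \<open>Analytic functions are smooth\<close>

text \<open>The monomials of the family need not be distinct; this makes the class of sums closed under
  termwise differentiation without reindexing.\<close>

definition monomial_series :: "real \<Rightarrow> 'a::euclidean_space \<Rightarrow> ('a \<Rightarrow> real) \<Rightarrow> bool" where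
  "monomial_series R x g \<longleftrightarrow> (\<exists>a e.
    (\<forall>\<rho>. 0 < \<rho> \<longrightarrow> \<rho> < R \<longrightarrow> summable (\<lambda>n::nat. \<bar>a n\<bar> * \<rho> ^ (\<Sum>b\<in>Basis. e n b))) \<and>
    (\<forall>y\<in>ball x R. (\<lambda>n. a n * (\<Prod>b\<in>Basis. ((y - x) \<bullet> b) ^ e n b)) sums g y))"

text \<open>For \<rho> < s < R the sequence k (\<rho>/s)^k is bounded, so the factor
  \<open>N n\<close> produced by differentiation is absorbed by passing from radius \<rho> to the
  slightly larger s.\<close>

lemma summable_deriv_majorant:
  fixes a :: "nat \<Rightarrow> real" and N :: "nat \<Rightarrow> nat"
  assumes sm: "\<And>\<rho>. 0 < \<rho> \<Longrightarrow> \<rho> < R \<Longrightarrow> summable (\<lambda>n. \<bar>a n\<bar> * \<rho> ^ N n)"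
    and \<rho>: "0 < \<rho>" "\<rho> < R"
  shows "summable (\<lambda>n. \<bar>a n\<bar> * (of_nat (N n) * \<rho> ^ (N n - 1)))"
proof -
  obtain s where s: "\<rho> < s" "s < R" using dense[OF \<rho>(2)] by auto
  have "(\<lambda>k. of_nat k * (\<rho> / s) ^ k) \<longlonglongrightarrow> 0"
    using s \<rho> by (intro powser_times_n_limit_0) auto
  then obtain C where C: "\<And>k. norm (of_nat k * (\<rho> / s) ^ k) \<le> C"
    using convergent_imp_Bseq[of "\<lambda>k. of_nat k * (\<rho> / s) ^ k"]
    by (auto simp: convergent_def Bseq_def)
  show ?thesis
  proof (rule summable_comparison_test', rule summable_mult[OF sm[of s], of "C / \<rho>"])
    fix n :: nat
    show "norm (\<bar>a n\<bar> * (of_nat (N n) * \<rho> ^ (N n - 1))) \<le> C / \<rho> * (\<bar>a n\<bar> * s ^ N n)"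
    proof (cases "N n = 0")
      case True
      have "0 \<le> C" using C[of 0] by simp
      then show ?thesis using True \<rho> s by simp
    next
      case False
      have "of_nat (N n) * \<rho> ^ (N n - 1) = (of_nat (N n) * \<rho> ^ N n) / \<rho>"
        using False \<rho> by (simp add: power_diff_conv_inverse field_simps power_eq_if)
      also have "\<dots> = (of_nat (N n) * (\<rho> / s) ^ N n) * s ^ N n / \<rho>"
        using s \<rho> by (simp add: power_divide)
      also have "\<dots> \<le> C * s ^ N n / \<rho>"
        using C[of "N n"] s \<rho> by (intro divide_right_mono mult_right_mono) auto
      finally have "of_nat (N n) * \<rho> ^ (N n - 1) \<le> C * s ^ N n / \<rho>" .
      from mult_left_mono[OF this, of "\<bar>a n\<bar>"] show ?thesis
        using \<rho> by (simp add: abs_mult mult_ac)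
    qed
  qed (use s \<rho> in auto)
qed

text \<open>Each partial derivative is written as a number times another monomial, so that the class
  of series is kept. The truncated subtraction in \<open>e b - 1\<close> does no harm, because the
  factor \<open>e b\<close> is 0 in that case.\<close>

lemma has_derivative_monomial:
  fixes x y :: "'a::euclidean_space" and e :: "'a \<Rightarrow> nat"
  shows "((\<lambda>y. \<Prod>b\<in>Basis. ((y - x) \<bullet> b) ^ e b) has_derivative
    (\<lambda>h. \<Sum>b\<in>Basis. (h \<bullet> b) * (of_nat (e b) *
       (\<Prod>b'\<in>Basis. ((y - x) \<bullet> b') ^ (e(b := e b - 1)) b')))) (at y)"
proof -
  have *: "(\<Prod>b'\<in>Basis. ((y - x) \<bullet> b') ^ (e(b := e b - 1)) b') =
     ((y - x) \<bullet> b) ^ (e b - 1) * (\<Prod>b'\<in>Basis - {b}. ((y - x) \<bullet> b') ^ e b')"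
    if "b \<in> Basis" for b
    using that by (subst prod.remove[of _ b]) (auto intro!: prod.cong)
  have "((\<lambda>y. \<Prod>b\<in>Basis. ((y - x) \<bullet> b) ^ e b) has_derivative
    (\<lambda>h. \<Sum>b\<in>Basis. (of_nat (e b) * (h \<bullet> b) * ((y - x) \<bullet> b) ^ (e b - 1)) *
       (\<Prod>b'\<in>Basis - {b}. ((y - x) \<bullet> b') ^ e b'))) (at y)"
    by (rule has_derivative_prod) (auto intro!: derivative_eq_intros)
  then show ?thesis by (rule has_derivative_eq_rhs) (auto intro!: sum.cong ext simp: *[unfolded One_nat_def] simp del: fun_upd_apply)
qed

text \<open>Termwise differentiation. On a ball of radius \<rho> < R all partial derivatives of the
  n-th term are dominated by the summable \<open>M \<rho> n\<close>, so the differentiated series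
  converge uniformly by the M-test.\<close>

lemma monomial_series_has_derivative:
  fixes x :: "'a::euclidean_space"
  assumes "monomial_series R x g"
  obtains g' where "\<And>y. y \<in> ball x R \<Longrightarrow> (g has_derivative g' y) (at y)"
    "\<And>b. b \<in> Basis \<Longrightarrow> monomial_series R x (\<lambda>y. g' y b)"
proof -
  obtain a e where sm: "\<And>\<rho>. 0 < \<rho> \<Longrightarrow> \<rho> < R \<Longrightarrow> summable (\<lambda>n::nat. \<bar>a n\<bar> * \<rho> ^ (\<Sum>b\<in>Basis. e n b))"
    and g: "\<And>y. y \<in> ball x R \<Longrightarrow> (\<lambda>n. a n * (\<Prod>b\<in>Basis. ((y - x) \<bullet> b) ^ e n b)) sums g y"
    using assms unfolding monomial_series_def by blast
  define N where "N n = (\<Sum>b\<in>Basis. e n b)" for n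
  define e' where "e' b n = (e n)(b := e n b - 1)" for b n
  define d where "d b n y = (a n * of_nat (e n b)) * (\<Prod>b'\<in>Basis. ((y - x) \<bullet> b') ^ e' b n b')" for b n y
  define G where "G b y = (\<Sum>n. d b n y)" for b y
  define M where "M \<rho> n = \<bar>a n\<bar> * (of_nat (N n) * \<rho> ^ (N n - 1))" for \<rho> n
  have sM: "summable (M \<rho>)" if "0 < \<rho>" "\<rho> < R" for \<rho>
    unfolding M_def by (rule summable_deriv_majorant[OF _ that]) (simp add: N_def sm)
  \<comment> \<open>Lowering one exponent lowers the total degree \<open>N n\<close> by exactly one
    only if that exponent is nonzero. In the other case the differentiated term has coefficient
    0.\<close>
  have pow: "(\<Prod>b'\<in>Basis. \<rho> ^ e' b n b') = \<rho> ^ (N n - 1) \<and> e n b \<le> N n"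
    if "b \<in> Basis" "e n b \<noteq> 0" for b n and \<rho> :: real
  proof -
    have "N n = e n b + (\<Sum>b'\<in>Basis - {b}. e n b')"
      unfolding N_def using that by (subst sum.remove[of _ b]) auto
    moreover have "(\<Sum>b'\<in>Basis. e' b n b') = (e n b - 1) + (\<Sum>b'\<in>Basis - {b}. e n b')"
      unfolding e'_def using that by (subst sum.remove[of _ b]) (auto intro!: sum.cong)
    ultimately have "(\<Sum>b'\<in>Basis. e' b n b') = N n - 1" "e n b \<le> N n" using that by auto
    then show ?thesis by (metis power_sum)
  qed
  have dM: "norm (d b n y) \<le> M \<rho> n" if "b \<in> Basis" "y \<in> ball x \<rho>" for b n y \<rho>
  proof (cases "e n b = 0")
    case False
    have "0 < \<rho>" using that by (auto intro: le_less_trans[OF zero_le_dist])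
    have "\<bar>\<Prod>b'\<in>Basis. ((y - x) \<bullet> b') ^ e' b n b'\<bar> \<le> (\<Prod>b'\<in>Basis. \<rho> ^ e' b n b')"
      unfolding abs_prod
    proof (rule prod_mono, rule conjI)
      fix b' :: 'a assume b': "b' \<in> Basis"
      have "\<bar>(y - x) \<bullet> b'\<bar> \<le> norm (y - x)" using Basis_le_norm[OF b'] .
      then have "\<bar>(y - x) \<bullet> b'\<bar> \<le> \<rho>" using that(2) by (auto simp: dist_norm norm_minus_commute)
      then show "\<bar>((y - x) \<bullet> b') ^ e' b n b'\<bar> \<le> \<rho> ^ e' b n b'" by (simp add: power_abs power_mono)
    qed simp
    also have "\<dots> = \<rho> ^ (N n - 1)" using pow[OF that(1) False] by simp
    finally have "\<bar>a n\<bar> * (of_nat (e n b) * \<bar>\<Prod>b'\<in>Basis. ((y - x) \<bullet> b') ^ e' b n b'\<bar>) \<le>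
        \<bar>a n\<bar> * (of_nat (N n) * \<rho> ^ (N n - 1))"
      using pow[OF that(1) False] by (intro mult_left_mono mult_mono) auto
    then show ?thesis by (simp add: d_def M_def abs_mult mult_ac)
  next
    case True
    have "0 < \<rho>" using that by (auto intro: le_less_trans[OF zero_le_dist])
    then show ?thesis using True by (simp add: d_def M_def)
  qed
  have between: "\<exists>\<rho>. 0 < \<rho> \<and> \<rho> < R \<and> y \<in> ball x \<rho>" if "y \<in> ball x R" for y
    using dense[of "dist x y" R] that by (auto intro: le_less_trans[OF zero_le_dist])
  have Gs: "(\<lambda>n. d b n y) sums G b y" if b: "b \<in> Basis" and y: "y \<in> ball x R" for b y
  proof -
    obtain \<rho> where \<rho>: "0 < \<rho>" "\<rho> < R" "y \<in> ball x \<rho>" using between[OF y] by auto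
    have "summable (\<lambda>n. d b n y)"
      by (rule summable_comparison_test'[OF sM[OF \<rho>(1,2)]]) (use dM[OF b \<rho>(3)] in auto)
    then show ?thesis by (simp add: G_def summable_sums)
  qed
  show thesis
  proof (rule that[of "\<lambda>y h. \<Sum>b\<in>Basis. (h \<bullet> b) * G b y"])
    fix b :: 'a assume b: "b \<in> Basis"
    have "(\<Sum>b'\<in>Basis. (b \<bullet> b') * G b' y) = G b y" for y
      using b by (simp add: inner_Basis if_distrib[of "\<lambda>x. x * _"] sum.delta cong: if_cong)
    moreover have "monomial_series R x (G b)"
      unfolding monomial_series_def
    proof (intro exI conjI allI impI ballI)
      show "(\<lambda>n. (a n * of_nat (e n b)) * (\<Prod>b'\<in>Basis. ((y - x) \<bullet> b') ^ e' b n b')) sums G b y"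
        if "y \<in> ball x R" for y
        using Gs[OF b that] by (simp add: d_def)
      fix \<rho> :: real assume \<rho>: "0 < \<rho>" "\<rho> < R"
      show "summable (\<lambda>n. \<bar>a n * of_nat (e n b)\<bar> * \<rho> ^ (\<Sum>b'\<in>Basis. e' b n b'))"
      proof (rule summable_comparison_test'[OF sM[OF \<rho>]])
        fix n :: nat
        show "norm (\<bar>a n * of_nat (e n b)\<bar> * \<rho> ^ (\<Sum>b'\<in>Basis. e' b n b')) \<le> M \<rho> n"
        proof (cases "e n b = 0")
          case True then show ?thesis using \<rho> by (simp add: M_def)
        next
          case False
          have "of_nat (e n b) * \<rho> ^ (N n - 1) \<le> of_nat (N n) * \<rho> ^ (N n - 1)"
            using pow[OF b False] \<rho> by (intro mult_right_mono) auto
          from mult_left_mono[OF this, of "\<bar>a n\<bar>"] show ?thesis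
            using pow[OF b False, of \<rho>] \<rho> by (simp add: M_def power_sum abs_mult mult_ac)
        qed
      qed
    qed
    ultimately show "monomial_series R x (\<lambda>y. \<Sum>b'\<in>Basis. (b \<bullet> b') * G b' y)" by simp
  next
    fix y assume "y \<in> ball x R"
    then obtain \<rho> where \<rho>: "0 < \<rho>" "\<rho> < R" "y \<in> ball x \<rho>" using between by auto
    let ?f = "\<lambda>n y. a n * (\<Prod>b\<in>Basis. ((y - x) \<bullet> b) ^ e n b)"
    let ?f' = "\<lambda>n y h. \<Sum>b\<in>Basis. (h \<bullet> b) * d b n y"
    have "\<exists>g2. \<forall>z\<in>ball x \<rho>. (\<lambda>n. ?f n z) sums (g2 z) \<and>
        (g2 has_derivative (\<lambda>h. \<Sum>b\<in>Basis. (h \<bullet> b) * G b z)) (at z within ball x \<rho>)"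
    proof (rule has_derivative_series[where f' = ?f'])
      fix n z
      have "((\<lambda>y. ?f n y) has_derivative (\<lambda>h. a n * (\<Sum>b\<in>Basis. (h \<bullet> b) * (of_nat (e n b) *
         (\<Prod>b'\<in>Basis. ((z - x) \<bullet> b') ^ ((e n)(b := e n b - 1)) b'))))) (at z)"
        by (intro has_derivative_mult_right has_derivative_monomial)
      then show "((\<lambda>y. ?f n y) has_derivative ?f' n z) (at z within ball x \<rho>)"
        unfolding d_def e'_def sum_distrib_left
        by (rule has_derivative_at_withinI[OF has_derivative_eq_rhs]) (simp only: mult_ac)
    next
      fix \<epsilon> :: real assume "\<epsilon> > 0"
      \<comment> \<open>The error of the derivative in direction h is a sum over
        \<open>Basis\<close> of terms at most \<open>norm h * \<delta>\<close>, hence the division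
        by the dimension.\<close>
      define \<delta> where "\<delta> = \<epsilon> / DIM('a)"
      have "\<delta> > 0" using \<open>\<epsilon> > 0\<close> by (simp add: \<delta>_def)
      have ul: "uniform_limit (ball x \<rho>) (\<lambda>n z. \<Sum>i<n. d b i z) (\<lambda>z. G b z) sequentially" if "b \<in> Basis" for b
        unfolding G_def by (rule Weierstrass_m_test[OF _ sM[OF \<rho>(1,2)]]) (rule dM[OF that])
      have "\<forall>\<^sub>F n in sequentially. \<forall>b\<in>Basis. \<forall>z\<in>ball x \<rho>. dist (\<Sum>i<n. d b i z) (G b z) < \<delta>"
        using uniform_limitD[OF ul \<open>\<delta> > 0\<close>] by (intro eventually_ball_finite) auto
      then show "\<forall>\<^sub>F n in sequentially. \<forall>z\<in>ball x \<rho>. \<forall>h.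
        norm ((\<Sum>i<n. ?f' i z h) - (\<Sum>b\<in>Basis. (h \<bullet> b) * G b z)) \<le> \<epsilon> * norm h"
      proof (rule eventually_mono, intro ballI allI)
        fix n z h assume *: "\<forall>b\<in>Basis. \<forall>z\<in>ball x \<rho>. dist (\<Sum>i<n. d b i z) (G b z) < \<delta>" and z: "z \<in> ball x \<rho>"
        have "(\<Sum>i<n. ?f' i z h) - (\<Sum>b\<in>Basis. (h \<bullet> b) * G b z) =
          (\<Sum>b\<in>Basis. (h \<bullet> b) * ((\<Sum>i<n. d b i z) - G b z))"
          by (subst sum.swap) (simp add: right_diff_distrib sum_subtractf sum_distrib_left)
        also have "norm \<dots> \<le> (\<Sum>b\<in>(Basis::'a set). norm h * \<delta>)"
        proof (rule sum_norm_le)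
          fix b :: 'a assume b: "b \<in> Basis"
          have "\<bar>(\<Sum>i<n. d b i z) - G b z\<bar> \<le> \<delta>"
            using * b z by (auto simp: dist_real_def intro: less_imp_le)
          then show "norm ((h \<bullet> b) * ((\<Sum>i<n. d b i z) - G b z)) \<le> norm h * \<delta>"
            using Basis_le_norm[OF b, of h] by (auto simp: abs_mult intro!: mult_mono)
        qed
        finally show "norm ((\<Sum>i<n. ?f' i z h) - (\<Sum>b\<in>Basis. (h \<bullet> b) * G b z)) \<le> \<epsilon> * norm h"
          by (simp add: \<delta>_def mult.commute)
      qed
    next
      show "(\<lambda>n. ?f n y) sums g y" using g[OF \<open>y \<in> ball x R\<close>] .
    qed (use \<rho> in auto)
    then obtain g2 where g2: "\<And>z. z \<in> ball x \<rho> \<Longrightarrow> (\<lambda>n. ?f n z) sums (g2 z) \<and>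
        (g2 has_derivative (\<lambda>h. \<Sum>b\<in>Basis. (h \<bullet> b) * G b z)) (at z within ball x \<rho>)" by blast
    have "(g2 has_derivative (\<lambda>h. \<Sum>b\<in>Basis. (h \<bullet> b) * G b y)) (at y)"
      using g2[OF \<rho>(3)] \<rho>(3) by (metis at_within_open open_ball)
    moreover have "g2 z = g z" if "z \<in> ball x \<rho>" for z
      using g2[OF that] g[of z] \<rho> that sums_unique2 by fastforce
    ultimately show "(g has_derivative (\<lambda>h. \<Sum>b\<in>Basis. (h \<bullet> b) * G b y)) (at y)"
      using has_derivative_transform_within_open[OF _ open_ball \<rho>(3)] by blast
  qed
qed

lemma monomial_series_Ck_on: "monomial_series R x g \<Longrightarrow> Ck_on k g (ball x R)"
proof (induction k arbitrary: g)
  case 0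
  obtain g' where "\<And>y. y \<in> ball x R \<Longrightarrow> (g has_derivative g' y) (at y)"
    using 0 by (rule monomial_series_has_derivative) blast
  then show ?case by (auto intro!: continuous_at_imp_continuous_on has_derivative_continuous)
next
  case (Suc k)
  obtain g' where g': "\<And>y. y \<in> ball x R \<Longrightarrow> (g has_derivative g' y) (at y)"
    "\<And>b. b \<in> Basis \<Longrightarrow> monomial_series R x (\<lambda>y. g' y b)"
    using Suc.prems by (rule monomial_series_has_derivative) blast
  show ?case by (rule Ck_on_SucI[OF open_ball g'(1) Suc.IH[OF g'(2)]])
qed

text \<open>The countably many multi-indices are enumerated by naturals. Convergence at a single
  diagonal point bounds all monomials of the same degree at once, at the cost of shrinking the
  radius by the dimension.\<close>

lemma real_analytic_at_imp_monomial_series: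
  fixes h :: "'a::euclidean_space \<Rightarrow> real"
  assumes "real_analytic_at h x"
  obtains R where "R > 0" "monomial_series R x h"
proof -
  obtain c where "\<forall>\<^sub>F y in nhds x.
      ((\<lambda>\<alpha>. (\<Prod>b\<in>Basis. ((y - x) \<bullet> b) ^ \<alpha> b) *\<^sub>R c \<alpha>) has_sum h y) (Basis \<rightarrow>\<^sub>E UNIV)"
    using assms unfolding real_analytic_at_def by blast
  then obtain R0 where R0: "R0 > 0" and hs: "\<And>y. dist y x < R0 \<Longrightarrow>
      ((\<lambda>\<alpha>. (\<Prod>b\<in>Basis. ((y - x) \<bullet> b) ^ \<alpha> b) *\<^sub>R c \<alpha>) has_sum h y) (Basis \<rightarrow>\<^sub>E UNIV)"
    unfolding eventually_nhds_metric by blast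
  define A where "A = ((Basis :: 'a set) \<rightarrow>\<^sub>E (UNIV :: nat set))"
  \<comment> \<open>The constant multi-indices already show that there are infinitely many, which
    the bijective enumeration requires.\<close>
  have "inj (\<lambda>k::nat. restrict (\<lambda>_. k) (Basis :: 'a set))"
    by (rule injI) (metis SOME_Basis restrict_apply')
  then have "infinite (range (\<lambda>k::nat. restrict (\<lambda>_. k) (Basis :: 'a set)))"
    by (rule range_inj_infinite)
  moreover have "range (\<lambda>k::nat. restrict (\<lambda>_. k) (Basis :: 'a set)) \<subseteq> A" by (auto simp: A_def)
  ultimately have "infinite A" using infinite_super by blast
  moreover have "countable A" unfolding A_def by (rule countable_PiE) auto
  ultimately have bij: "bij_betw (from_nat_into A) UNIV A" by (intro bij_betw_from_nat_into)
  define e where "e n = from_nat_into A n" for n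
  define R where "R = R0 / DIM('a)"
  have R: "R > 0" "R \<le> R0" using R0 by (auto simp: R_def field_simps)
  have "summable (\<lambda>n. \<bar>c (e n)\<bar> * \<rho> ^ (\<Sum>b\<in>Basis. e n b))" if \<rho>: "0 < \<rho>" "\<rho> < R" for \<rho>
  proof -
    \<comment> \<open>At this point every coordinate of \<open>y - x\<close> is \<rho>, so each
      monomial equals \<rho> to its degree; its distance from x is at most \<rho> times the
      dimension, below \<open>R0\<close>. Unconditional summability of reals is absolute.\<close>
    define y where "y = x + \<rho> *\<^sub>R (\<Sum>b\<in>Basis. b)"
    have "norm (\<Sum>b\<in>(Basis::'a set). b) \<le> (\<Sum>b\<in>(Basis::'a set). 1)"
      by (rule sum_norm_le) simp
    then have "norm (y - x) \<le> \<rho> * (\<Sum>b\<in>(Basis::'a set). 1)"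
      using \<rho> unfolding y_def by (auto intro!: mult_left_mono)
    then have "dist y x < R0" using \<rho> by (auto simp: R_def dist_norm field_simps)
    from hs[OF this] have "(\<lambda>\<alpha>. (\<Prod>b\<in>Basis. ((y - x) \<bullet> b) ^ \<alpha> b) *\<^sub>R c \<alpha>) summable_on A"
      unfolding A_def by (rule has_sum_imp_summable)
    moreover have "(y - x) \<bullet> b = \<rho>" if "b \<in> Basis" for b
      using that by (simp add: y_def inner_sum_left_Basis)
    ultimately have "(\<lambda>\<alpha>. \<rho> ^ (\<Sum>b\<in>Basis. \<alpha> b) * c \<alpha>) summable_on A"
      by (simp add: power_sum)
    then have "(\<lambda>\<alpha>. norm (\<rho> ^ (\<Sum>b\<in>Basis. \<alpha> b) * c \<alpha>)) summable_on A"
      by (rule iffD1[OF summable_on_iff_abs_summable_on_real])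
    then have "(\<lambda>n. norm (\<rho> ^ (\<Sum>b\<in>Basis. e n b) * c (e n))) summable_on UNIV"
      unfolding e_def by (rule iffD2[OF summable_on_reindex_bij_betw[OF bij,
            where f = "\<lambda>\<alpha>. norm (\<rho> ^ (\<Sum>b\<in>Basis. \<alpha> b) * c \<alpha>)"]])
    then have "summable (\<lambda>n. norm (\<rho> ^ (\<Sum>b\<in>Basis. e n b) * c (e n)))"
      by (rule summable_on_imp_summable)
    then show ?thesis using \<rho> by (simp add: abs_mult mult_ac)
  qed
  moreover have "(\<lambda>n. c (e n) * (\<Prod>b\<in>Basis. ((y - x) \<bullet> b) ^ e n b)) sums h y" if "y \<in> ball x R" for y
  proof -
    have "((\<lambda>\<alpha>. (\<Prod>b\<in>Basis. ((y - x) \<bullet> b) ^ \<alpha> b) *\<^sub>R c \<alpha>) has_sum h y) A"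
      using hs[of y] that R unfolding A_def by (auto simp: dist_commute)
    then have "((\<lambda>n. (\<Prod>b\<in>Basis. ((y - x) \<bullet> b) ^ e n b) *\<^sub>R c (e n)) has_sum h y) UNIV"
      unfolding e_def by (rule iffD2[OF has_sum_reindex_bij_betw[OF bij,
            where f = "\<lambda>\<alpha>. (\<Prod>b\<in>Basis. ((y - x) \<bullet> b) ^ \<alpha> b) *\<^sub>R c \<alpha>"]])
    from has_sum_imp_sums[OF this] show ?thesis by (simp add: mult_ac)
  qed
  ultimately have "monomial_series R x h" unfolding monomial_series_def
    by (intro exI[of _ "\<lambda>n. c (e n)"] exI[of _ e]) auto
  then show thesis using that R by blast
qed

lemma real_analytic_at_imp_Ck_on:
  fixes h :: "'a::euclidean_space \<Rightarrow> 'b::euclidean_space"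
  assumes "real_analytic_at h x"
  obtains U where "open U" "x \<in> U" "\<And>k. Ck_on k h U"
proof -
  have "\<exists>R>0. monomial_series R x (\<lambda>y. h y \<bullet> i)" if "i \<in> Basis" for i
  proof -
    obtain c where c: "\<forall>\<^sub>F y in nhds x.
      ((\<lambda>\<alpha>. (\<Prod>b\<in>Basis. ((y - x) \<bullet> b) ^ \<alpha> b) *\<^sub>R c \<alpha>) has_sum h y) (Basis \<rightarrow>\<^sub>E UNIV)"
      using assms unfolding real_analytic_at_def by blast
    have "\<forall>\<^sub>F y in nhds x.
      ((\<lambda>\<alpha>. (\<Prod>b\<in>Basis. ((y - x) \<bullet> b) ^ \<alpha> b) *\<^sub>R (c \<alpha> \<bullet> i)) has_sum (h y \<bullet> i)) (Basis \<rightarrow>\<^sub>E UNIV)"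
      using c by (rule eventually_mono)
        (use has_sum_bounded_linear[OF bounded_linear_inner_left] in \<open>fastforce simp: o_def\<close>)
    then have "real_analytic_at (\<lambda>y. h y \<bullet> i) x"
      unfolding real_analytic_at_def by (intro exI[of _ "\<lambda>\<alpha>. c \<alpha> \<bullet> i"])
    then show ?thesis using real_analytic_at_imp_monomial_series by blast
  qed
  then have "\<exists>R. \<forall>i\<in>Basis. R i > 0 \<and> monomial_series (R i) x (\<lambda>y. h y \<bullet> i)"
    by (intro bchoice) auto
  then obtain R where R: "\<And>i. i \<in> Basis \<Longrightarrow> R i > 0 \<and> monomial_series (R i) x (\<lambda>y. h y \<bullet> i)"
    by blast
  define U where "U = (\<Inter>i\<in>Basis. ball x (R i))"
  have U: "open U" "x \<in> U" unfolding U_def using R by (auto intro!: open_INT)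
  have "Ck_on k h U" for k
  proof (rule Ck_on_componentwise[OF U(1)])
    fix i :: 'b assume i: "i \<in> Basis"
    have "monomial_series (R i) x (\<lambda>y. h y \<bullet> i)" using R[OF i] by simp
    moreover have "U \<subseteq> ball x (R i)" using i by (auto simp: U_def)
    ultimately show "Ck_on k (\<lambda>x. h x \<bullet> i) U"
      by (intro Ck_on_subset[OF monomial_series_Ck_on])
  qed
  then show thesis using that U by blast
qed

lemma real_analytic_on_imp_Ck_on:
  assumes "real_analytic_on h S" shows "Ck_on k h S"
proof (rule Ck_on_local)
  fix x assume "x \<in> S"
  then have "real_analytic_at h x" using assms by (simp add: real_analytic_on_def)
  then obtain U where "open U" "x \<in> U" "\<And>k. Ck_on k h U"
    by (rule real_analytic_at_imp_Ck_on) blast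
  then show "\<exists>U. open U \<and> x \<in> U \<and> Ck_on k h U" by blast
qed

section \<open>Absolutely continuous functions\<close>

lemma AE_lebesgue_on_imp_negligible:
  assumes "AE t in lebesgue_on S. P t" "S \<in> sets lebesgue"
  shows "negligible {t\<in>S. \<not> P t}"
proof -
  have "AE t in lebesgue. t \<in> S \<longrightarrow> P t"
    using assms by (subst (asm) AE_restrict_space_iff) auto
  then show ?thesis
    by (simp add: completion.AE_iff_null_sets negligible_iff_null_sets conj_commute)
qed

lemma AE_lebesgue_on_open_dense:
  fixes S :: "'a::euclidean_space set"
  assumes "AE t in lebesgue_on S. P t" "S \<in> sets lebesgue" "open U" "U \<subseteq> S" "x \<in> U"
  obtains y where "y \<in> U" "P y"
proof -
  have "\<not> negligible U" using assms open_not_negligible by blast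
  then have "\<not> U \<subseteq> {t\<in>S. \<not> P t}"
    using AE_lebesgue_on_imp_negligible[OF assms(1,2)] negligible_subset by blast
  then show thesis using that assms(4) by blast
qed

text \<open>Promotes an almost everywhere identity to every point: a continuous function that is
  nonzero at one point is nonzero on an open set, which is not negligible.\<close>

lemma AE_lebesgue_on_open_imp_all_zero:
  fixes f :: "'a::euclidean_space \<Rightarrow> 'b::real_normed_vector"
  assumes "AE t in lebesgue_on S. P t" "S \<in> sets lebesgue" "open U" "U \<subseteq> S" "continuous_on U f"
    "\<And>t. t \<in> U \<Longrightarrow> P t \<Longrightarrow> f t = 0" and x: "x \<in> U"
  shows "f x = 0"
proof (rule ccontr)
  assume "f x \<noteq> 0"
  have "open (U \<inter> f -` (- {0}))"
    using assms(3,5) by (intro continuous_open_preimage) auto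
  then obtain y where "y \<in> U \<inter> f -` (- {0})" "P y"
    using AE_lebesgue_on_open_dense[OF assms(1,2), of "U \<inter> f -` (- {0})" x] assms(4) x \<open>f x \<noteq> 0\<close>
    by blast
  then show False using assms(6) by auto
qed

lemma absolutely_continuous_on_realE:
  assumes "absolutely_continuous_on_real S f" "\<epsilon> > 0"
  obtains \<delta> where "\<delta> > 0" "\<And>D. D division_of \<Union>D \<Longrightarrow> \<Union>D \<subseteq> S \<Longrightarrow>
      (\<Sum>k\<in>D. Sup k - Inf k) < \<delta> \<Longrightarrow> (\<Sum>k\<in>D. norm (f (Sup k) - f (Inf k))) < \<epsilon>"
proof -
  have "\<exists>\<delta>>0. \<forall>D. D division_of \<Union>D \<and> \<Union>D \<subseteq> S \<and> (\<Sum>k\<in>D. Sup k - Inf k) < \<delta> \<longrightarrow>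
      (\<Sum>k\<in>D. norm (f (Sup k) - f (Inf k))) < \<epsilon>"
    using assms unfolding absolutely_continuous_on_real_def by simp
  then obtain \<delta> where \<delta>: "\<delta> > 0" "\<forall>D. D division_of \<Union>D \<and> \<Union>D \<subseteq> S \<and>
      (\<Sum>k\<in>D. Sup k - Inf k) < \<delta> \<longrightarrow> (\<Sum>k\<in>D. norm (f (Sup k) - f (Inf k))) < \<epsilon>" by (elim exE conjE)
  show thesis using \<delta>(2) by (intro that[OF \<delta>(1)]) simp
qed

lemma absolutely_continuous_imp_continuous_on:
  assumes "absolutely_continuous_on_real {a..b} f" shows "continuous_on {a..b} f"
  unfolding continuous_on_iff
proof (intro ballI allI impI)
  fix x \<epsilon> :: real assume x: "x \<in> {a..b}" and "\<epsilon> > 0"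
  from this(2) obtain \<delta> where "\<delta> > 0" and \<delta>: "\<And>D. D division_of \<Union>D \<Longrightarrow> \<Union>D \<subseteq> {a..b} \<Longrightarrow>
      (\<Sum>k\<in>D. Sup k - Inf k) < \<delta> \<Longrightarrow> (\<Sum>k\<in>D. norm (f (Sup k) - f (Inf k))) < \<epsilon>"
    by (rule absolutely_continuous_on_realE[OF assms]) blast
  have *: "norm (f t - f s) < \<epsilon>" if "s \<le> t" "t - s < \<delta>" "a \<le> s" "t \<le> b" for s t
  proof -
    have "{{s..t}} division_of \<Union>{{s..t}}"
      using division_of_self[of s t] that by (simp add: box_real)
    from \<delta>[OF this] show ?thesis using that by simp
  qed
  show "\<exists>d>0. \<forall>x'\<in>{a..b}. dist x' x < d \<longrightarrow> dist (f x') (f x) < \<epsilon>"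
  proof (intro exI conjI ballI impI)
    fix y assume y: "y \<in> {a..b}" "dist y x < \<delta>"
    show "dist (f y) (f x) < \<epsilon>"
    proof (cases "y \<le> x")
      case True
      then have "norm (f x - f y) < \<epsilon>" using * x y by (auto simp: dist_real_def)
      then show ?thesis by (simp add: dist_norm norm_minus_commute)
    next
      case False
      then have "norm (f y - f x) < \<epsilon>" using * x y by (auto simp: dist_real_def)
      then show ?thesis by (simp add: dist_norm)
    qed
  qed (fact \<open>\<delta> > 0\<close>)
qed

text \<open>The cells of a division overlap only in boundaries, so integrating the constant 1 over
  them gives the measure of their union.\<close>

lemma sum_content_division_le_measure:
  assumes "D division_of \<Union>D" "\<Union>D \<subseteq> U" "U \<in> lmeasurable"
  shows "(\<Sum>K\<in>D. measure lborel K) \<le> measure lebesgue U"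
proof -
  have "((\<lambda>x. 1::real) has_integral measure lborel K) K" if "K \<in> D" for K
  proof -
    obtain u v where "K = cbox u v" using assms(1) \<open>K \<in> D\<close> by blast
    then show ?thesis using has_integral_const[of "1::real" u v] by simp
  qed
  then have hi: "((\<lambda>x. 1::real) has_integral (\<Sum>K\<in>D. measure lborel K)) (\<Union>D)"
    by (rule has_integral_combine_division[OF assms(1)])
  have "compact (\<Union>D)" using assms(1) by (intro compact_Union) (auto dest: division_ofD(4) intro: division_of_finite)
  then have "\<Union>D \<in> lmeasurable" by (rule lmeasurable_compact)
  then have "measure lebesgue (\<Union>D) = (\<Sum>K\<in>D. measure lborel K)"
    using hi by (simp add: lmeasure_integral integral_unique)
  then show ?thesis
    using measure_mono_fmeasurable[OF assms(2) _ assms(3)] \<open>\<Union>D \<in> lmeasurable\<close> by auto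
qed

text \<open>The straddle lemma of gauge integration: when x lies between u and v, the two one-sided
  errors at x add up to a multiple of the length \<open>v - u\<close>.\<close>

lemma has_vector_derivative_straddle:
  fixes f :: "real \<Rightarrow> 'a::real_normed_vector"
  assumes "(f has_vector_derivative f') (at x within S)" "e > 0"
  obtains d where "d > 0"
    "\<And>u v. u \<in> S \<Longrightarrow> v \<in> S \<Longrightarrow> u \<le> x \<Longrightarrow> x \<le> v \<Longrightarrow> x - u < d \<Longrightarrow> v - x < d \<Longrightarrow>
      norm ((v - u) *\<^sub>R f' - (f v - f u)) \<le> e * (v - u)"
proof -
  obtain d where "d > 0" and
    d: "\<And>y. y \<in> S \<Longrightarrow> norm (y - x) < d \<Longrightarrow> norm (f y - f x - (y - x) *\<^sub>R f') \<le> e * norm (y - x)"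
    using assms unfolding has_vector_derivative_def has_derivative_within_alt by blast
  have "norm ((v - u) *\<^sub>R f' - (f v - f u)) \<le> e * (v - u)"
    if "u \<in> S" "v \<in> S" "u \<le> x" "x \<le> v" "x - u < d" "v - x < d" for u v
  proof -
    have "norm ((v - u) *\<^sub>R f' - (f v - f u)) =
        norm (f u - f x - (u - x) *\<^sub>R f' - (f v - f x - (v - x) *\<^sub>R f'))"
      by (auto simp: algebra_simps)
    also have "\<dots> \<le> norm (f u - f x - (u - x) *\<^sub>R f') + norm (f v - f x - (v - x) *\<^sub>R f')"
      by (rule norm_triangle_ineq4)
    also have "\<dots> \<le> e * norm (u - x) + e * norm (v - x)"
      using that by (intro add_mono d) auto
    also have "\<dots> = e * (v - u)" using that by (simp add: algebra_simps)
    finally show ?thesis .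
  qed
  then show thesis using that \<open>d > 0\<close> by blast
qed

text \<open>Outer regularity encloses \<open>N\<close> in an open set of measure below the \<delta>
  of absolute continuity; cells inside it then have total length below \<delta>.\<close>

lemma absolutely_continuous_small_on_negligible:
  fixes f :: "real \<Rightarrow> 'a::real_normed_vector"
  assumes ac: "absolutely_continuous_on_real {a..b} f" and N: "negligible N" and "e > 0"
  obtains U where "open U" "N \<subseteq> U"
    "\<And>p. p tagged_partial_division_of {a..b} \<Longrightarrow> (\<And>x K. (x, K) \<in> p \<Longrightarrow> K \<subseteq> U) \<Longrightarrow>
      (\<Sum>(x, K)\<in>p. norm (f (Sup K) - f (Inf K))) < e"
proof -
  obtain \<delta> where "\<delta> > 0" and \<delta>: "\<And>D. D division_of \<Union>D \<Longrightarrow> \<Union>D \<subseteq> {a..b} \<Longrightarrow>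
      (\<Sum>k\<in>D. Sup k - Inf k) < \<delta> \<Longrightarrow> (\<Sum>k\<in>D. norm (f (Sup k) - f (Inf k))) < e"
    by (rule absolutely_continuous_on_realE[OF ac \<open>e > 0\<close>]) blast
  have "N \<in> sets lebesgue" using N by (simp add: negligible_imp_sets)
  then obtain U where U: "open U" "N \<subseteq> U" "U - N \<in> lmeasurable" "emeasure lebesgue (U - N) < ennreal \<delta>"
    using sets_lebesgue_outer_open[OF _ \<open>\<delta> > 0\<close>] by blast
  have UN: "U = (U - N) \<union> N" using U by blast
  have "U \<in> lmeasurable" using U(3) N UN by (metis fmeasurable.Un negligible_imp_measurable)
  moreover have "measure lebesgue U \<le> measure lebesgue (U - N) + measure lebesgue N"
    using measure_Un_le[of "U - N" lebesgue N] U(3) \<open>N \<in> sets lebesgue\<close> UN by (simp add: fmeasurableD)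
  then have "measure lebesgue U < \<delta>"
    using U(3,4) \<open>\<delta> > 0\<close> N
    by (simp add: emeasure_eq_measure2 ennreal_less_iff negligible_imp_measure0)
  ultimately have small: "(\<Sum>(x, K)\<in>p. norm (f (Sup K) - f (Inf K))) < e"
    if p: "p tagged_partial_division_of {a..b}" and pU: "\<And>x K. (x, K) \<in> p \<Longrightarrow> K \<subseteq> U" for p
  proof -
    have div: "snd ` p division_of \<Union>(snd ` p)" by (rule partial_division_of_tagged_division[OF p])
    have sub: "\<Union>(snd ` p) \<subseteq> {a..b}" using p unfolding tagged_partial_division_of_def by force
    have "(\<Sum>K\<in>snd ` p. Sup K - Inf K) = (\<Sum>K\<in>snd ` p. measure lborel K)"
    proof (rule sum.cong[OF refl])
      fix K assume "K \<in> snd ` p"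
      then obtain u v where "K = {u..v}" "K \<noteq> {}" using div by (metis box_real(2) division_ofD(3,4))
      then show "Sup K - Inf K = measure lborel K" by simp
    qed
    also have "\<dots> \<le> measure lebesgue U"
      using pU by (intro sum_content_division_le_measure[OF div _ \<open>U \<in> lmeasurable\<close>]) fastforce
    also have "\<dots> < \<delta>" by fact
    finally have "(\<Sum>K\<in>snd ` p. norm (f (Sup K) - f (Inf K))) < e" using \<delta>[OF div sub] by simp
    moreover have "(\<Sum>(x, K)\<in>p. norm (f (Sup K) - f (Inf K))) = (\<Sum>K\<in>snd ` p. norm (f (Sup K) - f (Inf K)))"
    proof -
      \<comment> \<open>A degenerate cell may carry several tags, so passing from tagged cells to
        cells needs a summand vanishing on all degenerate intervals. The empty one is set to 0
        explicitly because \<open>Sup {}\<close> and \<open>Inf {}\<close> are unspecified.\<close>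
      define d where "d K = (if K = {} then 0 else norm (f (Sup K) - f (Inf K)))" for K
      have ne: "K \<noteq> {}" if "(x, K) \<in> p" for x K
        using p that unfolding tagged_partial_division_of_def by blast
      have "(\<Sum>(x, K)\<in>p. d K) = (\<Sum>K\<in>snd ` p. d K)"
      proof (rule sum.over_tagged_division_lemma[OF tagged_partial_division_of_Union_self[OF p]])
        fix u v :: real assume "box u v = {}"
        then have "v \<le> u" by (simp add: box_real)
        then show "d (cbox u v) = 0" unfolding d_def by (cases "u = v") (auto simp: box_real)
      qed
      moreover have "(\<Sum>(x, K)\<in>p. d K) = (\<Sum>(x, K)\<in>p. norm (f (Sup K) - f (Inf K)))"
        using ne by (intro sum.cong) (auto simp: d_def)
      moreover have "(\<Sum>K\<in>snd ` p. d K) = (\<Sum>K\<in>snd ` p. norm (f (Sup K) - f (Inf K)))"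
        using ne by (intro sum.cong) (auto simp: d_def)
      ultimately show ?thesis by simp
    qed
    ultimately show ?thesis by simp
  qed
  show thesis by (rule that[OF U(1,2)]) (rule small)
qed

text \<open>The fundamental theorem for absolutely continuous functions, proved directly with
  gauges: tags in \<open>N\<close> are confined to a small open cover, all other tags obey the
  straddle estimate. Integrability of \<open>g\<close> is part of the conclusion.\<close>

lemma absolutely_continuous_has_integral:
  fixes f :: "real \<Rightarrow> 'a::banach"
  assumes ac: "absolutely_continuous_on_real {a..b} f" and N: "negligible N"
    and g: "\<And>t. t \<in> {s..t'} - N \<Longrightarrow> (f has_vector_derivative g t) (at t within {s..t'})"
    and st: "s \<le> t'" "{s..t'} \<subseteq> {a..b}"
  shows "(g has_integral f t' - f s) {s..t'}"
proof -
  \<comment> \<open>The values of \<open>g\<close> on \<open>N\<close> are uncontrolled. Setting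
    them to 0 leaves only increments of \<open>f\<close> for the tags in \<open>N\<close>, and
    changing back on a negligible set does not affect the integral.\<close>
  define g0 where "g0 t = (if t \<in> N then 0 else g t)" for t
  have "(g0 has_integral f t' - f s) {s..t'}"
    unfolding has_integral_real
  proof (intro allI impI)
    fix e :: real assume "e > 0"
    \<comment> \<open>Half of \<open>e\<close> pays for the tags outside \<open>N\<close>, half for
      those in \<open>N\<close>. The summand 1 covers the case of an interval of length 0.\<close>
    define e' where "e' = e / (2 * (t' - s + 1))"
    have "e' > 0" using \<open>e > 0\<close> st by (simp add: e'_def)
    obtain U where U: "open U" "N \<subseteq> U" and small: "\<And>p. p tagged_partial_division_of {a..b} \<Longrightarrow>
        (\<And>x K. (x, K) \<in> p \<Longrightarrow> K \<subseteq> U) \<Longrightarrow> (\<Sum>(x, K)\<in>p. norm (f (Sup K) - f (Inf K))) < e / 2"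
      using absolutely_continuous_small_on_negligible[OF ac N half_gt_zero[OF \<open>e > 0\<close>]] by blast
    have "\<exists>d>0. (x \<in> N \<longrightarrow> ball x d \<subseteq> U) \<and> (x \<in> {s..t'} - N \<longrightarrow>
        (\<forall>u\<in>{s..t'}. \<forall>v\<in>{s..t'}. u \<le> x \<longrightarrow> x \<le> v \<longrightarrow> x - u < d \<longrightarrow> v - x < d \<longrightarrow>
          norm ((v - u) *\<^sub>R g x - (f v - f u)) \<le> e' * (v - u)))" for x
    proof (cases "x \<in> N")
      case True
      then show ?thesis using U open_contains_ball by (metis DiffD2 subset_iff)
    next
      case False
      show ?thesis
      proof (cases "x \<in> {s..t'}")
        case True
        with False g have "(f has_vector_derivative g x) (at x within {s..t'})" by blast
        then show ?thesis
          by (rule has_vector_derivative_straddle[OF _ \<open>e' > 0\<close>]) (use False in blast)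
      qed (use False in \<open>auto intro: exI[of _ 1]\<close>)
    qed
    then obtain d where d: "\<And>x. d x > 0" "\<And>x. x \<in> N \<Longrightarrow> ball x (d x) \<subseteq> U"
      "\<And>x u v. x \<in> {s..t'} - N \<Longrightarrow> u \<in> {s..t'} \<Longrightarrow> v \<in> {s..t'} \<Longrightarrow> u \<le> x \<Longrightarrow> x \<le> v \<Longrightarrow>
          x - u < d x \<Longrightarrow> v - x < d x \<Longrightarrow> norm ((v - u) *\<^sub>R g x - (f v - f u)) \<le> e' * (v - u)"
      by metis
    show "\<exists>\<gamma>. gauge \<gamma> \<and> (\<forall>D. D tagged_division_of {s..t'} \<and> \<gamma> fine D \<longrightarrow>
        norm ((\<Sum>(x, k)\<in>D. measure lborel k *\<^sub>R g0 x) - (f t' - f s)) < e)"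
    proof (intro exI conjI allI impI; (elim conjE)?)
      show "gauge (\<lambda>x. ball x (d x))" using d(1) by (simp add: gauge_ball_dependent)
      fix p assume p: "p tagged_division_of {s..t'}" and fine: "(\<lambda>x. ball x (d x)) fine p"
      define q where "q = {(x, K) \<in> p. x \<in> N}"
      have "finite p" using p by blast
      have fs: "f t' - f s = (\<Sum>(x, K)\<in>p. f (Sup K) - f (Inf K))" "t' - s = (\<Sum>(x, K)\<in>p. Sup K - Inf K)"
        using additive_tagged_division_1[OF st(1) p, of f]
          additive_tagged_division_1[OF st(1) p, of "\<lambda>x. x"] by auto
      have int: "\<exists>u v. K = {u..v} \<and> u \<le> x \<and> x \<le> v \<and> u \<in> {s..t'} \<and> v \<in> {s..t'} \<and> K \<subseteq> ball x (d x)"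
        if "(x, K) \<in> p" for x K
      proof -
        obtain u v where "K = {u..v}" using tagged_division_ofD(4)[OF p \<open>(x, K) \<in> p\<close>] by (auto simp: box_real)
        moreover have "x \<in> K" "K \<subseteq> {s..t'}" using p that by (blast dest: tagged_division_ofD)+
        moreover have "K \<subseteq> ball x (d x)" using fine that by blast
        ultimately show ?thesis by auto
      qed
      have "q \<subseteq> p" by (auto simp: q_def)
      have "p tagged_partial_division_of {a..b}"
        using p st(2) unfolding tagged_division_of_def tagged_partial_division_of_def by blast
      then have "q tagged_partial_division_of {a..b}"
        using \<open>q \<subseteq> p\<close> by (rule tagged_partial_division_subset)
      moreover have "K \<subseteq> U" if "(x, K) \<in> q" for x K
        using int[of x K] d(2)[of x] that by (auto simp: q_def)
      ultimately have q_small: "(\<Sum>(x, K)\<in>q. norm (f (Sup K) - f (Inf K))) < e / 2"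
        by (rule small)
      have "(\<Sum>(x, K)\<in>p. measure lborel K *\<^sub>R g0 x) - (f t' - f s) =
          (\<Sum>(x, K)\<in>p. measure lborel K *\<^sub>R g0 x - (f (Sup K) - f (Inf K)))"
        by (simp add: fs sum_subtractf split_def)
      also have "\<dots> = (\<Sum>(x, K)\<in>p - q. measure lborel K *\<^sub>R g0 x - (f (Sup K) - f (Inf K))) +
          (\<Sum>(x, K)\<in>q. measure lborel K *\<^sub>R g0 x - (f (Sup K) - f (Inf K)))"
        by (rule sum.subset_diff[OF \<open>q \<subseteq> p\<close> \<open>finite p\<close>])
      also have "norm \<dots> \<le> norm (\<Sum>(x, K)\<in>p - q. measure lborel K *\<^sub>R g0 x - (f (Sup K) - f (Inf K))) +
          norm (\<Sum>(x, K)\<in>q. measure lborel K *\<^sub>R g0 x - (f (Sup K) - f (Inf K)))"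
        by (rule norm_triangle_ineq)
      also have "norm (\<Sum>(x, K)\<in>q. measure lborel K *\<^sub>R g0 x - (f (Sup K) - f (Inf K))) \<le>
          (\<Sum>(x, K)\<in>q. norm (f (Sup K) - f (Inf K)))"
        by (rule sum_norm_le) (auto simp: q_def g0_def norm_minus_commute)
      also have "norm (\<Sum>(x, K)\<in>p - q. measure lborel K *\<^sub>R g0 x - (f (Sup K) - f (Inf K))) \<le>
          (\<Sum>(x, K)\<in>p - q. e' * (Sup K - Inf K))"
      proof (rule sum_norm_le, clarify)
        fix x K assume "(x, K) \<in> p" "(x, K) \<notin> q"
        then obtain u v where K: "K = {u..v}" "u \<le> x" "x \<le> v" "u \<in> {s..t'}" "v \<in> {s..t'}"
          "K \<subseteq> ball x (d x)" using int by blast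
        have "x \<notin> N" "x \<in> {s..t'}" using \<open>(x, K) \<in> p\<close> \<open>(x, K) \<notin> q\<close> K by (auto simp: q_def)
        moreover have "u \<in> ball x (d x)" "v \<in> ball x (d x)" using K(1,2,3,6) by (meson atLeastAtMost_iff order_refl order_trans subsetD)+
        ultimately have "norm ((v - u) *\<^sub>R g x - (f v - f u)) \<le> e' * (v - u)"
          using K by (intro d(3)) (auto simp: dist_real_def)
        then show "norm (measure lborel K *\<^sub>R g0 x - (f (Sup K) - f (Inf K))) \<le> e' * (Sup K - Inf K)"
          using K \<open>x \<notin> N\<close> by (simp add: g0_def)
      qed
      also have "(\<Sum>(x, K)\<in>p - q. e' * (Sup K - Inf K)) \<le> (\<Sum>(x, K)\<in>p. e' * (Sup K - Inf K))"
      proof (rule sum_mono2[OF \<open>finite p\<close>])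
        fix c assume "c \<in> p - (p - q)"
        then show "0 \<le> (case c of (x, K) \<Rightarrow> e' * (Sup K - Inf K))"
          using int \<open>e' > 0\<close> by (cases c) fastforce
      qed auto
      also have "\<dots> = e' * (t' - s)" by (simp add: fs(2) sum_distrib_left split_def)
      also have "\<dots> \<le> e / 2"
        using \<open>e > 0\<close> st by (simp add: e'_def field_simps)
      finally show "norm ((\<Sum>(x, k)\<in>p. measure lborel k *\<^sub>R g0 x) - (f t' - f s)) < e"
        using q_small by linarith
    qed
  qed
  then show ?thesis by (rule has_integral_spike[OF N, rotated]) (auto simp: g0_def)
qed

text \<open>An integral identity ignores null sets, so it is the bridge from an equation valid
  almost everywhere to one valid at every point where the integrand is continuous.\<close>

lemma has_vector_derivative_of_has_integral:
  fixes f :: "real \<Rightarrow> 'a::banach"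
  assumes int: "\<And>s t. s \<le> t \<Longrightarrow> {s..t} \<subseteq> J \<Longrightarrow> (g has_integral f t - f s) {s..t}"
    and J: "open J" "continuous_on J g" "t \<in> J"
  shows "(f has_vector_derivative g t) (at t)"
proof -
  obtain e where "e > 0" and e: "cball t e \<subseteq> J" using J open_contains_cball by blast
  then have sub: "{t - e..t + e} \<subseteq> J" by (auto simp: subset_iff dist_real_def)
  have "((\<lambda>y. integral {t - e..y} g) has_vector_derivative g t) (at t within {t - e..t + e})"
    using \<open>e > 0\<close> sub by (intro integral_has_vector_derivative continuous_on_subset[OF J(2)]) auto
  then have "((\<lambda>y. f (t - e) + integral {t - e..y} g) has_vector_derivative g t) (at t)"
    using \<open>e > 0\<close> by (auto intro!: derivative_eq_intros simp: at_within_Icc_at)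
  then show ?thesis
  proof (rule has_vector_derivative_transform_within_open)
    show "open {t - e<..<t + e}" "t \<in> {t - e<..<t + e}" using \<open>e > 0\<close> by auto
    fix y assume y: "y \<in> {t - e<..<t + e}"
    then have "{t - e..y} \<subseteq> J" using sub by auto
    then have "(g has_integral f y - f (t - e)) {t - e..y}" using int y by auto
    then show "f (t - e) + integral {t - e..y} g = f y" by (simp add: integral_unique)
  qed
qed

text \<open>Away from the junction the control is continuous, hence so are the right-hand sides of
  the state and adjoint equations; there the equations hold at every time.\<close>

lemma absolutely_continuous_has_vector_derivative:
  fixes f :: "real \<Rightarrow> 'a::banach"
  assumes ac: "absolutely_continuous_on_real {a..b} f"
    and ae: "AE t in lebesgue_on {a..b}. (f has_vector_derivative g t) (at t within {a..b})"
    and J: "open J" "J \<subseteq> {a..b}" "continuous_on J g" "t \<in> J"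
  shows "(f has_vector_derivative g t) (at t)"
proof (rule has_vector_derivative_of_has_integral[OF _ J(1,3,4)])
  fix s t assume st: "s \<le> t" "{s..t} \<subseteq> J"
  have N: "negligible {t\<in>{a..b}. \<not> (f has_vector_derivative g t) (at t within {a..b})}"
    using ae by (rule AE_lebesgue_on_imp_negligible) auto
  show "(g has_integral f t - f s) {s..t}"
  proof (rule absolutely_continuous_has_integral[OF ac N _ st(1)])
    show sub: "{s..t} \<subseteq> {a..b}" using st J by blast
    fix r assume "r \<in> {s..t} - {t\<in>{a..b}. \<not> (f has_vector_derivative g t) (at t within {a..b})}"
    then have "(f has_vector_derivative g r) (at r within {a..b})" using sub by blast
    then show "(f has_vector_derivative g r) (at r within {s..t})"
      using sub by (rule has_vector_derivative_within_subset)
  qed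
qed

text \<open>One exceptional point is invisible to the integral. This carries the differential
  equation across the junction, where only continuity of both sides is known.\<close>

lemma has_vector_derivative_fill_point:
  fixes f :: "real \<Rightarrow> 'a::banach"
  assumes "open J" "continuous_on J f" "continuous_on J g" "t \<in> J"
    and d: "\<And>s. s \<in> J - {c} \<Longrightarrow> (f has_vector_derivative g s) (at s)"
  shows "(f has_vector_derivative g t) (at t)"
proof (rule has_vector_derivative_of_has_integral[OF _ assms(1,3,4)])
  fix s t assume st: "s \<le> t" "{s..t} \<subseteq> J"
  show "(g has_integral f t - f s) {s..t}"
    using st d by (intro fundamental_theorem_of_calculus_strong[where S = "{c}"]
        continuous_on_subset[OF assms(2)]) auto
qed

section \<open>Mixed derivatives, gradients and Poisson brackets\<close>

text \<open>The mean value theorem is used first in direction a, on the increment in direction b,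
  and then in direction b on the derivative along a. The margin \<epsilon> puts the closed
  parallelogram inside an open ball.\<close>

lemma second_difference_mean_value:
  fixes f :: "'a::euclidean_space \<Rightarrow> real"
  assumes f: "Ck_on 2 f (ball x (h * (norm a + norm b) + \<epsilon>))" and "h > 0" "\<epsilon> > 0"
  obtains y where "dist x y \<le> h * (norm a + norm b)"
    "f (x + h *\<^sub>R a + h *\<^sub>R b) - f (x + h *\<^sub>R a) - f (x + h *\<^sub>R b) + f x =
      h\<^sup>2 * frechet_derivative (\<lambda>y. frechet_derivative f (at y) a) (at y) b"
proof -
  define U where "U = ball x (h * (norm a + norm b) + \<epsilon>)"
  define g where "g y = frechet_derivative f (at y) a" for y
  define p where "p s t = x + s *\<^sub>R a + t *\<^sub>R b" for s t
  have dist: "dist x (p s t) \<le> h * (norm a + norm b)" if "0 \<le> s" "s \<le> h" "0 \<le> t" "t \<le> h" for s t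
  proof -
    have "dist x (p s t) = norm (s *\<^sub>R a + t *\<^sub>R b)" by (simp add: p_def dist_norm norm_minus_commute add_ac)
    also have "\<dots> \<le> s * norm a + t * norm b" using that norm_triangle_ineq[of "s *\<^sub>R a" "t *\<^sub>R b"] by simp
    also have "\<dots> \<le> h * norm a + h * norm b" using that by (intro add_mono mult_right_mono) auto
    finally show ?thesis by (simp add: algebra_simps)
  qed
  have inU: "p s t \<in> U" if "0 \<le> s" "s \<le> h" "0 \<le> t" "t \<le> h" for s t
    using dist[OF that] \<open>\<epsilon> > 0\<close> by (simp add: U_def)
  have U: "open U" by (simp add: U_def)
  have f2: "Ck_on (Suc (Suc 0)) f U" using f by (simp add: U_def numeral_2_eq_2)
  then have g1: "Ck_on (Suc 0) g U" unfolding g_def by (intro Ck_on_frechet_derivative U Ck_on_const)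
  have df: "(f has_derivative frechet_derivative f (at y)) (at y)"
    and dg: "(g has_derivative frechet_derivative g (at y)) (at y)" if "y \<in> U" for y
    using f2 g1 that by (auto simp: frechet_derivative_works)
  have d1: "((\<lambda>s. f (p s t)) has_real_derivative g (p s t)) (at s)"
    if "0 \<le> s" "s \<le> h" "0 \<le> t" "t \<le> h" for s t
  proof -
    have "((\<lambda>s. p s t) has_derivative (\<lambda>r. r *\<^sub>R a)) (at s)"
      unfolding p_def by (auto intro!: derivative_eq_intros)
    from has_derivative_compose[OF this df[OF inU[OF that]]]
    have "((\<lambda>s. f (p s t)) has_derivative (\<lambda>r. r * g (p s t))) (at s)"
      using linear_cmul[OF has_derivative_linear[OF df[OF inU[OF that]]]] by (simp add: g_def)
    then show ?thesis by (simp add: has_field_derivative_def mult.commute[of _ "g (p s t)"] cong: if_cong)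
  qed
  have d2: "((\<lambda>t. g (p s t)) has_real_derivative frechet_derivative g (at (p s t)) b) (at t)"
    if "0 \<le> s" "s \<le> h" "0 \<le> t" "t \<le> h" for s t
  proof -
    have "((\<lambda>t. p s t) has_derivative (\<lambda>r. r *\<^sub>R b)) (at t)"
      unfolding p_def by (auto intro!: derivative_eq_intros)
    from has_derivative_compose[OF this dg[OF inU[OF that]]]
    have "((\<lambda>t. g (p s t)) has_derivative (\<lambda>r. r * frechet_derivative g (at (p s t)) b)) (at t)"
      using linear_cmul[OF has_derivative_linear[OF dg[OF inU[OF that]]]] by simp
    then show ?thesis
      by (simp add: has_field_derivative_def mult.commute[of _ "frechet_derivative g (at (p s t)) b"] cong: if_cong)
  qed
  have "((\<lambda>s. f (p s h) - f (p s 0)) has_real_derivative g (p s h) - g (p s 0)) (at s)"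
    if "0 \<le> s" "s \<le> h" for s
    using that \<open>h > 0\<close> by (intro DERIV_diff d1) auto
  from MVT2[OF \<open>h > 0\<close> this]
  obtain s where s: "0 < s" "s < h"
    "(f (p h h) - f (p h 0)) - (f (p 0 h) - f (p 0 0)) = (h - 0) * (g (p s h) - g (p s 0))"
    by blast
  have "((\<lambda>t. g (p s t)) has_real_derivative frechet_derivative g (at (p s t)) b) (at t)"
    if "0 \<le> t" "t \<le> h" for t
    using that s by (intro d2) auto
  from MVT2[OF \<open>h > 0\<close> this]
  obtain t where t: "0 < t" "t < h" "g (p s h) - g (p s 0) = (h - 0) * frechet_derivative g (at (p s t)) b"
    by blast
  show thesis
  proof (rule that[of "p s t"])
    show "dist x (p s t) \<le> h * (norm a + norm b)" using s t by (intro dist) auto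
    show "f (x + h *\<^sub>R a + h *\<^sub>R b) - f (x + h *\<^sub>R a) - f (x + h *\<^sub>R b) + f x =
      h\<^sup>2 * frechet_derivative (\<lambda>y. frechet_derivative f (at y) a) (at (p s t)) b"
      using s(3) t(3) by (simp add: p_def g_def[abs_def] power2_eq_square)
  qed
qed

text \<open>The second difference does not change when a and b are exchanged, so both mixed
  derivatives take a common value at points arbitrarily close to x; continuity finishes.\<close>

lemma mixed_frechet_derivatives_commute:
  fixes f :: "'a::euclidean_space \<Rightarrow> real"
  assumes U: "open U" and f: "Ck_on 2 f U" and x: "x \<in> U"
  shows "frechet_derivative (\<lambda>y. frechet_derivative f (at y) a) (at x) b =
    frechet_derivative (\<lambda>y. frechet_derivative f (at y) b) (at x) a"
proof -
  define D where "D a b y = frechet_derivative (\<lambda>y. frechet_derivative f (at y) a) (at y) b" for a b y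
  have cont: "isCont (D a b) x" for a b
  proof -
    have "Ck_on 0 (D a b) U"
      unfolding D_def using f by (intro Ck_on_frechet_derivative Ck_on_const U) (simp add: numeral_2_eq_2)
    then show ?thesis using U x by (simp add: continuous_on_eq_continuous_at)
  qed
  have "dist (D a b x) (D b a x) \<le> 0 + e" if "e > 0" for e
  proof -
    obtain d1 where d1: "d1 > 0" "\<And>y. dist y x < d1 \<Longrightarrow> dist (D a b y) (D a b x) < e / 2"
      using cont[of a b] \<open>e > 0\<close> unfolding continuous_at_eps_delta by (metis half_gt_zero)
    obtain d2 where d2: "d2 > 0" "\<And>y. dist y x < d2 \<Longrightarrow> dist (D b a y) (D b a x) < e / 2"
      using cont[of b a] \<open>e > 0\<close> unfolding continuous_at_eps_delta by (metis half_gt_zero)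
    obtain d3 where d3: "d3 > 0" "ball x d3 \<subseteq> U" using U x open_contains_ball by blast
    define d where "d = min d1 (min d2 d3)"
    have "d > 0" using d1 d2 d3 by (simp add: d_def)
    \<comment> \<open>The parallelogram stays within d/2 of x, and the other d/2 is the margin of
      the mean value lemma. The summand 1 covers a = b = 0.\<close>
    define h where "h = d / (2 * (norm a + norm b + 1))"
    have nn: "0 < norm a + norm b + 1" by (simp add: add_nonneg_pos)
    have "h > 0" using \<open>d > 0\<close> nn by (simp add: h_def)
    have "h * (norm a + norm b) \<le> h * (norm a + norm b + 1)" using \<open>h > 0\<close> by simp
    also have "\<dots> = d / 2" using nn by (simp add: h_def field_simps)
    finally have hd: "h * (norm a + norm b) \<le> d / 2" .
    have sub: "ball x (h * (norm a + norm b) + d / 2) \<subseteq> U"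
      using hd d3(2) unfolding d_def by (intro order_trans[OF subset_ball d3(2)]) linarith
    have Ck: "Ck_on 2 f (ball x (h * (norm a + norm b) + d / 2))"
      "Ck_on 2 f (ball x (h * (norm b + norm a) + d / 2))"
      using Ck_on_subset[OF f sub] by (simp_all add: add.commute)
    obtain y where y: "dist x y \<le> h * (norm a + norm b)"
      "f (x + h *\<^sub>R a + h *\<^sub>R b) - f (x + h *\<^sub>R a) - f (x + h *\<^sub>R b) + f x = h\<^sup>2 * D a b y"
      using second_difference_mean_value[OF Ck(1) \<open>h > 0\<close>] \<open>d > 0\<close> unfolding D_def by auto
    obtain z where z: "dist x z \<le> h * (norm b + norm a)"
      "f (x + h *\<^sub>R b + h *\<^sub>R a) - f (x + h *\<^sub>R b) - f (x + h *\<^sub>R a) + f x = h\<^sup>2 * D b a z"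
      using second_difference_mean_value[OF Ck(2) \<open>h > 0\<close>] \<open>d > 0\<close> unfolding D_def by auto
    have "x + h *\<^sub>R b + h *\<^sub>R a = x + h *\<^sub>R a + h *\<^sub>R b" by (simp add: add_ac)
    then have "f (x + h *\<^sub>R b + h *\<^sub>R a) = f (x + h *\<^sub>R a + h *\<^sub>R b)"
      by (rule arg_cong)
    then have "h\<^sup>2 * D a b y = h\<^sup>2 * D b a z" using y(2) z(2) by linarith
    then have "D a b y = D b a z" using \<open>h > 0\<close> by simp
    moreover have "dist y x < d1" "dist z x < d2"
      using y(1) z(1) hd \<open>d > 0\<close> unfolding d_def by (auto simp: dist_commute add.commute)
    ultimately show ?thesis
      using d1(2)[of y] d2(2)[of z] dist_triangle_half_r[of "D a b y" "D a b x" e "D b a x"] by simp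
  qed
  then have "dist (D a b x) (D b a x) \<le> 0" by (rule field_le_epsilon)
  then show ?thesis by (simp add: D_def)
qed

lemma gradient_eqI:
  assumes "GDERIV f x :> D" shows "gradient f x = D"
  unfolding gradient_def
proof (rule the_equality[where P = "\<lambda>D. GDERIV f x :> D", OF assms])
  fix D' assume "GDERIV f x :> D'"
  with assms have "(\<lambda>h. inner h D') = (\<lambda>h. inner h D)"
    unfolding gderiv_def by (blast intro: has_derivative_unique)
  then have "inner h (D' - D) = 0" for h by (metis inner_diff_right right_minus_eq)
  from this[of "D' - D"] show "D' = D" by simp
qed

lemma GDERIV_gradient:
  fixes f :: "'a::euclidean_space \<Rightarrow> real"
  assumes "f differentiable (at x)" shows "GDERIV f x :> gradient f x"
proof -
  have df: "(f has_derivative frechet_derivative f (at x)) (at x)"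
    using assms by (simp add: frechet_derivative_works)
  have lin: "linear (frechet_derivative f (at x))" using assms by (rule linear_frechet_derivative)
  have "GDERIV f x :> (\<Sum>b\<in>Basis. frechet_derivative f (at x) b *\<^sub>R b)"
    unfolding gderiv_def
  proof (rule has_derivative_eq_rhs[OF df], rule ext)
    fix h
    show "frechet_derivative f (at x) h = inner h (\<Sum>b\<in>Basis. frechet_derivative f (at x) b *\<^sub>R b)"
    proof -
      have "frechet_derivative f (at x) h = frechet_derivative f (at x) (\<Sum>b\<in>Basis. (h \<bullet> b) *\<^sub>R b)"
        by (simp add: euclidean_representation)
      also have "\<dots> = (\<Sum>b\<in>Basis. (h \<bullet> b) *\<^sub>R frechet_derivative f (at x) b)"
        by (simp only: linear_sum[OF lin] linear_cmul[OF lin])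
      finally show ?thesis by (simp add: inner_sum_right mult.commute)
    qed
  qed
  then show ?thesis using gradient_eqI by metis
qed

lemma frechet_derivative_eq_inner_gradient:
  fixes f :: "'a::euclidean_space \<Rightarrow> real"
  assumes "f differentiable (at x)" shows "frechet_derivative f (at x) v = v \<bullet> gradient f x"
  using GDERIV_gradient[OF assms] frechet_derivative_at unfolding gderiv_def by metis

lemma gradient_add_scaled_sum:
  fixes f :: "'a::euclidean_space \<Rightarrow> real"
  assumes "f differentiable (at x)" "\<And>i. i \<in> I \<Longrightarrow> g i differentiable (at x)"
  shows "gradient (\<lambda>x. f x + (\<Sum>i\<in>I. g i x * c i)) x = gradient f x + (\<Sum>i\<in>I. c i *\<^sub>R gradient (g i) x)"
proof (rule gradient_eqI)
  have "(f has_derivative (\<lambda>h. h \<bullet> gradient f x)) (at x)"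
    using GDERIV_gradient[OF assms(1)] by (simp add: gderiv_def)
  moreover have "(g i has_derivative (\<lambda>h. h \<bullet> gradient (g i) x)) (at x)" if "i \<in> I" for i
    using GDERIV_gradient[OF assms(2)[OF that]] by (simp add: gderiv_def)
  ultimately have "((\<lambda>x. f x + (\<Sum>i\<in>I. g i x * c i)) has_derivative
      (\<lambda>h. h \<bullet> gradient f x + (\<Sum>i\<in>I. (h \<bullet> gradient (g i) x) * c i))) (at x)"
    by (intro has_derivative_add has_derivative_sum has_derivative_mult_left)
  then show "GDERIV (\<lambda>x. f x + (\<Sum>i\<in>I. g i x * c i)) x :> gradient f x + (\<Sum>i\<in>I. c i *\<^sub>R gradient (g i) x)"
    unfolding gderiv_def by (simp add: inner_add_right inner_sum_right mult.commute)
qed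

lemma Ck_on_gradient:
  fixes f :: "'a::euclidean_space \<Rightarrow> real"
  assumes "open U" "Ck_on (Suc k) f U" shows "Ck_on k (gradient f) U"
proof (rule Ck_on_componentwise[OF assms(1)])
  fix b :: 'a assume "b \<in> Basis"
  have "gradient f y \<bullet> b = frechet_derivative f (at y) b" if "y \<in> U" for y
    using assms(2) that by (simp add: frechet_derivative_eq_inner_gradient inner_commute)
  then show "Ck_on k (\<lambda>y. gradient f y \<bullet> b) U"
    using Ck_on_cong[OF assms(1)] assms(2) \<open>b \<in> Basis\<close> by (metis (mono_tags, lifting) Ck_on.simps(2))
qed

definition symplectic :: "'a::real_vector \<times> 'a \<Rightarrow> 'a \<times> 'a" where
  "symplectic v = (snd v, - fst v)"

lemma bounded_linear_symplectic: "bounded_linear (symplectic :: 'a::real_normed_vector \<times> 'a \<Rightarrow> _)"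
  unfolding symplectic_def
  by (intro bounded_linear_Pair bounded_linear_minus bounded_linear_fst bounded_linear_snd)

lemma symplectic_inner: "symplectic v \<bullet> w = - (v \<bullet> symplectic w)"
  by (simp add: symplectic_def inner_prod_def)

text \<open>The sign convention makes \<open>poisson F G\<close> the derivative of \<open>F\<close>
  along the Hamiltonian flow of \<open>G\<close>, since \<open>symplectic (gradient G z)\<close> is
  the Hamiltonian vector field.\<close>

definition poisson :: "('a::euclidean_space \<times> 'a \<Rightarrow> real) \<Rightarrow> ('a \<times> 'a \<Rightarrow> real) \<Rightarrow> 'a \<times> 'a \<Rightarrow> real" where
  "poisson F G z = gradient F z \<bullet> symplectic (gradient G z)"

lemma poisson_antisym: "poisson F G z = - poisson G F z"
  using symplectic_inner[of "gradient F z" "gradient G z"] by (simp add: poisson_def inner_commute)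

lemma poisson_eq_frechet_derivative:
  "F differentiable (at z) \<Longrightarrow> poisson F G z = frechet_derivative F (at z) (symplectic (gradient G z))"
  by (simp add: poisson_def frechet_derivative_eq_inner_gradient inner_commute)

lemma Ck_on_poisson:
  fixes F G :: "'a::euclidean_space \<times> 'a \<Rightarrow> real"
  assumes "open U" "Ck_on (Suc k) F U" "Ck_on (Suc k) G U"
  shows "Ck_on k (poisson F G) U"
  unfolding poisson_def
  by (intro Ck_on_inner Ck_on_bounded_linear_compose[OF bounded_linear_symplectic] Ck_on_gradient assms)

text \<open>In this form the identity says that bracketing with \<open>H\<close> is a derivation of
  the bracket. All terms expand into Hessians (\<open>h\<close>), which are symmetric, and
  \<open>symplectic\<close>, which is antisymmetric; they then match in pairs.\<close>

lemma poisson_jacobi: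
  fixes F G H :: "'a::euclidean_space \<times> 'a \<Rightarrow> real"
  assumes C: "Ck_on 2 F UNIV" "Ck_on 2 G UNIV" "Ck_on 2 H UNIV"
  shows "poisson (poisson F G) H z = poisson (poisson F H) G z + poisson F (poisson G H) z"
proof -
  define h where "h F = frechet_derivative (gradient F) (at z)" for F :: "'a \<times> 'a \<Rightarrow> real"
  have diff: "F differentiable (at y)" if "Ck_on 2 F UNIV" for F :: "'a \<times> 'a \<Rightarrow> real" and y
    using that unfolding numeral_2_eq_2 Ck_on.simps(2) by blast
  have g1: "Ck_on (Suc 0) (gradient F) UNIV" if "Ck_on 2 F UNIV" for F :: "'a \<times> 'a \<Rightarrow> real"
    using that by (intro Ck_on_gradient) (simp_all add: numeral_2_eq_2)
  have dh: "(gradient F has_derivative h F) (at z)" if "Ck_on 2 F UNIV" for F :: "'a \<times> 'a \<Rightarrow> real"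
    using g1[OF that] unfolding h_def frechet_derivative_works[symmetric] by (metis Ck_on.simps(2) UNIV_I)
  have h_inner: "h F v \<bullet> w = frechet_derivative (\<lambda>y. frechet_derivative F (at y) w) (at z) v"
    if "Ck_on 2 F UNIV" for F :: "'a \<times> 'a \<Rightarrow> real" and v w
  proof -
    have "((\<lambda>y. gradient F y \<bullet> w) has_derivative (\<lambda>v. h F v \<bullet> w)) (at z)"
      using has_derivative_inner_left[OF dh[OF that]] .
    moreover have "(\<lambda>y. gradient F y \<bullet> w) = (\<lambda>y. frechet_derivative F (at y) w)"
      using diff[OF that] by (simp add: frechet_derivative_eq_inner_gradient inner_commute)
    ultimately show ?thesis using frechet_derivative_at by metis
  qed
  have sym: "h F v \<bullet> w = v \<bullet> h F w" if "Ck_on 2 F UNIV" for F :: "'a \<times> 'a \<Rightarrow> real" and v w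
    using h_inner[OF that, of v w] h_inner[OF that, of w v]
      mixed_frechet_derivatives_commute[OF open_UNIV that UNIV_I] by (simp add: inner_commute)
  have J: "bounded_linear (symplectic :: 'a \<times> 'a \<Rightarrow> 'a \<times> 'a)" by (rule bounded_linear_symplectic)
  have P: "poisson (poisson F G) K z =
      h F (symplectic (gradient K z)) \<bullet> symplectic (gradient G z) +
      gradient F z \<bullet> symplectic (h G (symplectic (gradient K z)))"
    if F: "Ck_on 2 F UNIV" and G: "Ck_on 2 G UNIV" for F G K :: "'a \<times> 'a \<Rightarrow> real"
  proof -
    have "((\<lambda>y. gradient F y \<bullet> symplectic (gradient G y)) has_derivative
      (\<lambda>v. gradient F z \<bullet> symplectic (h G v) + h F v \<bullet> symplectic (gradient G z))) (at z)"
      by (intro has_derivative_inner dh F G bounded_linear.has_derivative[OF J])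
    then have "(poisson F G has_derivative
      (\<lambda>v. gradient F z \<bullet> symplectic (h G v) + h F v \<bullet> symplectic (gradient G z))) (at z)"
      by (simp add: poisson_def[abs_def])
    then have "poisson F G differentiable (at z)" "frechet_derivative (poisson F G) (at z) =
      (\<lambda>v. gradient F z \<bullet> symplectic (h G v) + h F v \<bullet> symplectic (gradient G z))"
      by (auto simp: differentiable_def dest: frechet_derivative_at)
    then show ?thesis by (simp add: poisson_eq_frechet_derivative)
  qed
  have "poisson F (poisson G H) z = - poisson (poisson G H) F z" by (rule poisson_antisym)
  then show ?thesis
    using sym[OF C(1), of "symplectic (gradient G z)" "symplectic (gradient H z)"]
      sym[OF C(2), of "symplectic (gradient F z)" "symplectic (gradient H z)"]
      sym[OF C(3), of "symplectic (gradient G z)" "symplectic (gradient F z)"]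
      symplectic_inner[of "gradient F z" "h G (symplectic (gradient H z))"]
      symplectic_inner[of "gradient F z" "h H (symplectic (gradient G z))"]
      symplectic_inner[of "gradient G z" "h H (symplectic (gradient F z))"]
    by (simp add: P C inner_commute)
qed

text \<open>Moving the drift from one argument of the bracket to the other costs a sign, as long as the
  lower brackets vanish identically.\<close>

lemma poisson_iterate_symmetric:
  fixes psi :: "'m \<Rightarrow> nat \<Rightarrow> 'a::euclidean_space \<times> 'a \<Rightarrow> real"
  assumes C: "\<And>i j. Ck_on 2 (psi i j) UNIV" "Ck_on 2 H UNIV"
    and Suc: "\<And>i j. psi i (Suc j) = poisson (psi i j) H"
    and zero: "\<And>i l j z. Suc j < K \<Longrightarrow> poisson (psi i j) (psi l 0) z = 0"
    and K: "Suc j = K"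
  shows "poisson (psi i j) (psi l 0) z = (- 1) ^ K * poisson (psi l j) (psi i 0) z"
proof -
  \<comment> \<open>In the induction step the shorter bracket
    \<open>poisson (psi i a) (psi l b)\<close> vanishes identically, hence so does its bracket with
    \<open>H\<close>; the Jacobi identity then shifts one \<open>H\<close> across with a change of
    sign.\<close>
  have "a + b < K \<Longrightarrow> poisson (psi i a) (psi l b) z = (- 1) ^ b * poisson (psi i (a + b)) (psi l 0) z" for a b i l z
  proof (induction b arbitrary: a z)
    case (Suc b)
    have "poisson (psi i a) (psi l b) = (\<lambda>z. 0)"
      using Suc.IH[of a] Suc.prems zero[of "a + b"] by auto
    then have "gradient (poisson (psi i a) (psi l b)) z = 0"
      by (simp add: gradient_eqI GDERIV_const)
    then have "poisson (poisson (psi i a) (psi l b)) H z = 0" by (simp add: poisson_def)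
    then have "poisson (psi i a) (psi l (Suc b)) z = - poisson (psi i (Suc a)) (psi l b) z"
      using poisson_jacobi[OF C(1,1) C(2), of i a l b z] by (simp add: assms(3))
    also have "\<dots> = (- 1) ^ Suc b * poisson (psi i (a + Suc b)) (psi l 0) z"
      using Suc.IH[of "Suc a" z] Suc.prems by simp
    finally show ?case .
  qed simp
  \<comment> \<open>Moving all j drift brackets gives \<open>(- 1) ^ j\<close>; swapping the two
    arguments gives one more sign, hence the exponent \<open>K = Suc j\<close>.\<close>
  from this[of 0 j i l z] K poisson_antisym[of "psi i 0" "psi l j" z]
  have "(- 1) ^ j * poisson (psi i j) (psi l 0) z = - poisson (psi l j) (psi i 0) z" by simp
  then have "(- 1) ^ j * ((- 1) ^ j * poisson (psi i j) (psi l 0) z) = (- 1) ^ K * poisson (psi l j) (psi i 0) z"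
    using K by auto
  then show ?thesis by (simp add: mult.assoc[symmetric] power_mult_distrib[symmetric])
qed

section \<open>The switching functions and their iterated brackets\<close>

lemma analytic_problem_Ck_on:
  assumes "analytic_problem P"
  shows "Ck_on k (cost_drift P) UNIV" "Ck_on k (cost_field P i) UNIV"
    "Ck_on k (drift P) UNIV" "Ck_on k (control_field P i) UNIV" "Ck_on k (bound P) {0..}"
  using assms unfolding analytic_problem_def by (auto intro: real_analytic_on_imp_Ck_on)

lemma Ck_on_aug_pairing:
  fixes f0 :: "real^'n::finite \<Rightarrow> real" and f :: "real^'n \<Rightarrow> real^'n"
  assumes "Ck_on k f0 UNIV" "Ck_on k f UNIV"
  shows "Ck_on k (\<lambda>z :: 'n aug \<times> 'n aug. snd z \<bullet> (f0 (snd (fst z)), f (snd (fst z)))) UNIV"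
proof -
  have x: "Ck_on k (\<lambda>z :: 'n aug \<times> 'n aug. snd (fst z)) UNIV"
    by (rule Ck_on_bounded_linear[OF bounded_linear_compose[OF bounded_linear_snd bounded_linear_fst]])
       simp_all
  have Q: "Ck_on k (\<lambda>z :: 'n aug \<times> 'n aug. snd z) UNIV"
    by (rule Ck_on_bounded_linear[OF bounded_linear_snd]) simp_all
  show ?thesis
    by (rule Ck_on_inner[OF open_UNIV Q Ck_on_Pair[OF open_UNIV
          Ck_on_compose[OF open_UNIV open_UNIV _ assms(1) x]
          Ck_on_compose[OF open_UNIV open_UNIV _ assms(2) x]]]) simp_all
qed

definition drift_hamiltonian ::
    "('n::finite, 'm::finite) affine_problem \<Rightarrow> 'n aug \<times> 'n aug \<Rightarrow> real" where
  "drift_hamiltonian P z = snd z \<bullet> aug_drift P (fst z)"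

lemma Ck_on_drift_hamiltonian: "analytic_problem P \<Longrightarrow> Ck_on k (drift_hamiltonian P) UNIV"
  unfolding drift_hamiltonian_def[abs_def] aug_drift_def
  by (intro Ck_on_aug_pairing analytic_problem_Ck_on)

lemma Ck_on_switching_nth: "analytic_problem P \<Longrightarrow> Ck_on k (\<lambda>z. switching P z $ i) UNIV"
  by (simp add: switching_def aug_field_def Ck_on_aug_pairing analytic_problem_Ck_on)

lemma Ck_on_UNIV_differentiable: "Ck_on (Suc k) f UNIV \<Longrightarrow> f differentiable (at x)"
  unfolding Ck_on.simps(2) by blast

lemma gradient_partial:
  fixes F :: "'a::euclidean_space \<times> 'b::euclidean_space \<Rightarrow> real"
  assumes "F differentiable (at z)"
  shows "gradient (\<lambda>X. F (X, snd z)) (fst z) = fst (gradient F z)"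
    "gradient (\<lambda>Q. F (fst z, Q)) (snd z) = snd (gradient F z)"
proof -
  have F: "(F has_derivative (\<lambda>h. h \<bullet> gradient F z)) (at z)"
    using GDERIV_gradient[OF assms] by (simp add: gderiv_def)
  have "((\<lambda>X. (X, snd z)) has_derivative (\<lambda>h. (h, 0))) (at (fst z))"
    by (intro has_derivative_Pair has_derivative_ident has_derivative_const)
  from has_derivative_compose[OF this, of F "\<lambda>h. h \<bullet> gradient F z"] F
  show "gradient (\<lambda>X. F (X, snd z)) (fst z) = fst (gradient F z)"
    by (intro gradient_eqI) (simp add: gderiv_def inner_prod_def)
  have "((\<lambda>Q. (fst z, Q)) has_derivative (\<lambda>h. (0, h))) (at (snd z))"
    by (intro has_derivative_Pair has_derivative_ident has_derivative_const)
  from has_derivative_compose[OF this, of F "\<lambda>h. h \<bullet> gradient F z"] F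
  show "gradient (\<lambda>Q. F (fst z, Q)) (snd z) = snd (gradient F z)"
    by (intro gradient_eqI) (simp add: gderiv_def inner_prod_def)
qed

lemma aug_hamiltonian_eq_sum:
  "aug_hamiltonian P (fst z) (snd z) u = drift_hamiltonian P z + (\<Sum>i\<in>UNIV. switching P z $ i * u $ i)"
  by (simp add: aug_hamiltonian_def drift_hamiltonian_def switching_def)

text \<open>The control enters affinely and each coefficient is itself a Hamiltonian vector field,
  so derivatives along extremals turn into Poisson brackets.\<close>

lemma hamiltonian_field_eq:
  assumes "analytic_problem P"
  shows "hamiltonian_field P z u = symplectic (gradient (drift_hamiltonian P) z) +
    (\<Sum>i\<in>UNIV. u $ i *\<^sub>R symplectic (gradient (\<lambda>z. switching P z $ i) z))"
proof -
  note lin = bounded_linear.linear[OF bounded_linear_symplectic]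
  let ?F = "\<lambda>z. drift_hamiltonian P z + (\<Sum>i\<in>UNIV. switching P z $ i * u $ i)"
  have "Ck_on (Suc 0) ?F UNIV"
    by (intro Ck_on_add Ck_on_sum Ck_on_mult Ck_on_const Ck_on_drift_hamiltonian
        Ck_on_switching_nth open_UNIV assms)
  then have F: "?F differentiable (at z)" by (rule Ck_on_UNIV_differentiable)
  have "hamiltonian_field P z u = symplectic (gradient ?F z)"
    using gradient_partial[OF F] aug_hamiltonian_eq_sum[of P "(_, snd z)" u]
      aug_hamiltonian_eq_sum[of P "(fst z, _)" u]
    by (simp add: hamiltonian_field_def symplectic_def)
  also have "gradient ?F z =
      gradient (drift_hamiltonian P) z + (\<Sum>i\<in>UNIV. u $ i *\<^sub>R gradient (\<lambda>z. switching P z $ i) z)"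
    by (intro gradient_add_scaled_sum Ck_on_UNIV_differentiable[where k = 0]
        Ck_on_drift_hamiltonian Ck_on_switching_nth assms)
  finally show ?thesis
    by (simp only: linear_add[OF lin] linear_sum[OF lin] linear_cmul[OF lin])
qed

lemma Ck_on_hamiltonian_field:
  fixes z :: "'a::euclidean_space \<Rightarrow> 'n::finite aug \<times> 'n aug" and u :: "'a \<Rightarrow> real^'m::finite"
  assumes P: "analytic_problem P" and U: "open U" and z: "Ck_on k z U" and u: "Ck_on k u U"
  shows "Ck_on k (\<lambda>t. hamiltonian_field P (z t) (u t)) U"
  unfolding hamiltonian_field_eq[OF P]
  by (intro Ck_on_add Ck_on_sum Ck_on_scaleR Ck_on_vec_nth U u
      Ck_on_bounded_linear_compose[OF bounded_linear_symplectic]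
      Ck_on_compose[OF U open_UNIV subset_UNIV _ z] Ck_on_gradient open_UNIV
      Ck_on_drift_hamiltonian Ck_on_switching_nth P)

lemma Ck_on_switching_deriv:
  assumes "analytic_problem P" shows "Ck_on k (\<lambda>z. switching_deriv P j z 0) UNIV"
proof (induction j arbitrary: k)
  case 0
  show ?case by (simp add: Ck_on_vec Ck_on_switching_nth assms)
next
  case (Suc j)
  have "Ck_on k (\<lambda>z. hamiltonian_field P z 0) UNIV"
    by (intro Ck_on_hamiltonian_field assms Ck_on_id Ck_on_const open_UNIV)
  then show ?case by (simp add: Ck_on_frechet_derivative Suc)
qed

lemma frechet_derivative_vec_nth:
  fixes f :: "'a::real_normed_vector \<Rightarrow> real^'n::finite"
  assumes "f differentiable (at x)"
  shows "frechet_derivative f (at x) v $ i = frechet_derivative (\<lambda>y. f y $ i) (at x) v"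
proof -
  have "(f has_derivative frechet_derivative f (at x)) (at x)"
    using assms by (simp add: frechet_derivative_works)
  then have "((\<lambda>y. f y $ i) has_derivative (\<lambda>v. frechet_derivative f (at x) v $ i)) (at x)"
    by (rule bounded_linear.has_derivative[OF bounded_linear_vec_nth])
  then show ?thesis by (metis frechet_derivative_at)
qed

text \<open>The control-free part of the j-th derivative, taken as a scalar so that brackets apply:
  it is the j-fold bracket of the i-th switching function with the drift Hamiltonian.\<close>

definition switching_iterate ::
    "('n::finite, 'm::finite) affine_problem \<Rightarrow> 'm \<Rightarrow> nat \<Rightarrow> 'n aug \<times> 'n aug \<Rightarrow> real" where
  "switching_iterate P i j z = switching_deriv P j z 0 $ i"

lemma Ck_on_switching_iterate: "analytic_problem P \<Longrightarrow> Ck_on k (switching_iterate P i j) UNIV"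
  unfolding switching_iterate_def[abs_def] by (intro Ck_on_vec_nth Ck_on_switching_deriv) simp_all

lemma switching_deriv_Suc_nth:
  assumes P: "analytic_problem P"
  shows "switching_deriv P (Suc j) z u $ i = poisson (switching_iterate P i j) (drift_hamiltonian P) z +
    (\<Sum>l\<in>UNIV. poisson (switching_iterate P i j) (switching_iterate P l 0) z * u $ l)"
proof -
  have d: "(\<lambda>z. switching_deriv P j z 0) differentiable (at z)"
    by (rule Ck_on_UNIV_differentiable[OF Ck_on_switching_deriv[OF P, of "Suc 0"]])
  have di: "switching_iterate P i j differentiable (at z)"
    by (rule Ck_on_UNIV_differentiable[OF Ck_on_switching_iterate[OF P, of "Suc 0"]])
  have lin: "linear (frechet_derivative (switching_iterate P i j) (at z))"
    using di by (rule linear_frechet_derivative)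
  have "switching_deriv P (Suc j) z u $ i =
      frechet_derivative (switching_iterate P i j) (at z) (hamiltonian_field P z u)"
    by (simp add: frechet_derivative_vec_nth[OF d] switching_iterate_def[abs_def])
  moreover have "(\<lambda>z. switching P z $ l) = switching_iterate P l 0" for l
    by (simp add: switching_iterate_def[abs_def])
  ultimately show ?thesis
    by (simp only: hamiltonian_field_eq[OF P] poisson_eq_frechet_derivative[OF di]
        linear_add[OF lin] linear_sum[OF lin] linear_cmul[OF lin] real_scaleR_def mult.commute)
qed

lemma switching_iterate_Suc:
  "analytic_problem P \<Longrightarrow>
    switching_iterate P i (Suc j) = poisson (switching_iterate P i j) (drift_hamiltonian P)"
  by (rule ext) (simp add: switching_iterate_def[of P i "Suc j"] switching_deriv_Suc_nth del: switching_deriv.simps)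

text \<open>The switching function itself does not involve u. Hence the intrinsic order is positive
  and \<open>2 * q\<close> is a successor.\<close>

lemma control_matrix_0: "control_matrix P 0 z = 0"
proof -
  have "frechet_derivative (\<lambda>u::real^'b. switching P z) (at 0) = (\<lambda>h. 0)"
    by (rule frechet_derivative_at[symmetric]) simp
  then show ?thesis
    by (simp add: control_matrix_def jacobian_def matrix_def vec_eq_iff)
qed

text \<open>The derivative is affine in u, so its Jacobian is the matrix of coefficients, and these
  are brackets with the switching functions. Questions about the control matrix become algebra of
  brackets.\<close>

lemma control_matrix_Suc_nth:
  assumes P: "analytic_problem P"
  shows "control_matrix P (Suc j) z $ i $ l =
    poisson (switching_iterate P i j) (switching_iterate P l 0) z"
proof -
  define C where "C = (\<chi> i l. poisson (switching_iterate P i j) (switching_iterate P l 0) z)"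
  have eq: "switching_deriv P (Suc j) z =
      (\<lambda>u. (\<chi> i. poisson (switching_iterate P i j) (drift_hamiltonian P) z) + C *v u)"
    by (simp add: fun_eq_iff vec_eq_iff switching_deriv_Suc_nth[OF P] C_def matrix_vector_mult_def
        del: switching_deriv.simps)
  have "(switching_deriv P (Suc j) z has_derivative (\<lambda>h. 0 + C *v h)) (at 0)"
    unfolding eq
    by (intro has_derivative_add has_derivative_const bounded_linear_imp_has_derivative
        matrix_vector_mul_bounded_linear)
  then have "frechet_derivative (switching_deriv P (Suc j) z) (at 0) = (\<lambda>v. C *v v)"
    by (simp add: frechet_derivative_at[symmetric] del: switching_deriv.simps)
  then show ?thesis
    by (simp add: control_matrix_def jacobian_def C_def del: switching_deriv.simps)
qed

lemma switching_deriv_Suc_affine: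
  assumes "analytic_problem P"
  shows "switching_deriv P (Suc j) z u = switching_deriv P (Suc j) z 0 + control_matrix P (Suc j) z *v u"
  by (simp add: vec_eq_iff switching_deriv_Suc_nth[OF assms] control_matrix_Suc_nth[OF assms]
      matrix_vector_mult_def del: switching_deriv.simps)

lemma Ck_on_control_matrix_nth:
  assumes "analytic_problem P" shows "Ck_on k (\<lambda>z. control_matrix P j z $ i $ l) UNIV"
proof (cases j)
  case 0
  then show ?thesis by (simp add: control_matrix_0 Ck_on_const)
next
  case (Suc j')
  show ?thesis unfolding Suc control_matrix_Suc_nth[OF assms]
    by (intro Ck_on_poisson Ck_on_switching_iterate assms open_UNIV)
qed

lemma intrinsic_order_pos: "intrinsic_order P q \<Longrightarrow> q > 0"
  by (cases q) (auto simp: intrinsic_order_def control_matrix_0)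

lemma intrinsic_order_zero: "intrinsic_order P q \<Longrightarrow> j < 2 * q \<Longrightarrow> control_matrix P j z = 0"
  unfolding intrinsic_order_def by blast

text \<open>Below index \<open>2 * q\<close> the control matrices, hence the brackets, vanish
  identically. This permits moving the drift brackets across, and the total sign
  \<open>(- 1) ^ (2 * q)\<close> is 1.\<close>

lemma control_matrix_symmetric:
  assumes P: "analytic_problem P" and q: "intrinsic_order P q"
  shows "transpose (control_matrix P (2 * q) z) = control_matrix P (2 * q) z"
proof -
  obtain j where j: "Suc j = 2 * q" using intrinsic_order_pos[OF q] by (metis Suc_pred' mult_pos_pos pos2)
  have "poisson (switching_iterate P i j) (switching_iterate P l 0) z =
      (- 1) ^ (2 * q) * poisson (switching_iterate P l j) (switching_iterate P i 0) z" for i l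
  proof (rule poisson_iterate_symmetric[where H = "drift_hamiltonian P", OF _ _ _ _ j])
    fix i l k z assume "Suc k < 2 * q"
    then have "control_matrix P (Suc k) z = 0" by (rule intrinsic_order_zero[OF q])
    then show "poisson (switching_iterate P i k) (switching_iterate P l 0) z = 0"
      using control_matrix_Suc_nth[OF P, of k z i l] by simp
  qed (simp_all only: Ck_on_switching_iterate[OF P] Ck_on_drift_hamiltonian[OF P] switching_iterate_Suc[OF P])
  then have "control_matrix P (Suc j) z $ i $ l = control_matrix P (Suc j) z $ l $ i" for i l
    unfolding control_matrix_Suc_nth[OF P] by (simp add: power_mult)
  then show ?thesis unfolding j[symmetric] by (simp add: vec_eq_iff transpose_def)
qed

lemma switching_deriv_along:
  assumes P: "analytic_problem P"
    and z: "(z has_vector_derivative hamiltonian_field P (z t) v) (at t)"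
  shows "((\<lambda>t. switching_deriv P j (z t) 0) has_vector_derivative switching_deriv P (Suc j) (z t) v) (at t)"
proof -
  let ?f = "\<lambda>z. switching_deriv P j z 0"
  have "?f differentiable (at (z t))"
    by (rule Ck_on_UNIV_differentiable[OF Ck_on_switching_deriv[OF P, of "Suc 0"]])
  then have df: "(?f has_derivative frechet_derivative ?f (at (z t))) (at (z t))"
    by (simp add: frechet_derivative_works)
  show ?thesis
    using has_derivative_compose[OF z[unfolded has_vector_derivative_def] df]
      linear_cmul[OF has_derivative_linear[OF df]]
    by (simp add: has_vector_derivative_def)
qed

section \<open>Extremals\<close>

lemma dynamics_continuous_on:
  assumes "analytic_problem P" "continuous_on J x" "continuous_on J u"
  shows "continuous_on J (\<lambda>t. dynamics P (x t) (u t))"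
  unfolding dynamics_def
  using analytic_problem_Ck_on(3,4)[OF assms(1), of 0] assms(2,3)
  by (auto intro!: continuous_intros intro: continuous_on_compose2[OF _ assms(2) subset_UNIV])

lemma running_cost_continuous_on:
  assumes "analytic_problem P" "continuous_on J x" "continuous_on J u"
  shows "continuous_on J (\<lambda>t. running_cost P (x t) (u t))"
  unfolding running_cost_def
  using analytic_problem_Ck_on(1,2)[OF assms(1), of 0] assms(2,3)
  by (auto intro!: continuous_intros intro: continuous_on_compose2[OF _ assms(2) subset_UNIV])

lemma gradient_aug_hamiltonian_covector:
  "gradient (\<lambda>Q. aug_hamiltonian P X Q u) Q = (running_cost P (snd X) u, dynamics P (snd X) u)"
proof (rule gradient_eqI)
  have eq: "aug_hamiltonian P X Q u = Q \<bullet> (running_cost P (snd X) u, dynamics P (snd X) u)" for Q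
    by (cases Q) (simp add: aug_hamiltonian_def aug_drift_def aug_field_def running_cost_def dynamics_def
        inner_add_right inner_sum_right algebra_simps sum.distrib sum_distrib_left)
  have "((\<lambda>Q. Q \<bullet> (running_cost P (snd X) u, dynamics P (snd X) u)) has_derivative
      (\<lambda>h. h \<bullet> (running_cost P (snd X) u, dynamics P (snd X) u))) (at Q)"
    by (rule bounded_linear_imp_has_derivative[OF bounded_linear_inner_left])
  then show "GDERIV (\<lambda>Q. aug_hamiltonian P X Q u) Q :> (running_cost P (snd X) u, dynamics P (snd X) u)"
    by (simp add: eq gderiv_def)
qed

text \<open>Reconciles the augmented field with the separate cost, state and adjoint equations. The
  accumulated cost does not occur in the Hamiltonian, so its covector component is constant.\<close>

lemma hamiltonian_field_extremal:
  assumes P: "analytic_problem P"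
  shows "hamiltonian_field P ((x0, x), (- lam, p)) u =
    ((running_cost P x u, dynamics P x u), (0, - gradient (\<lambda>x'. hamiltonian P lam x' p u) x))"
proof -
  let ?h = "\<lambda>x'. hamiltonian P lam x' p u"
  have "Ck_on (Suc 0) ?h UNIV"
    unfolding hamiltonian_def dynamics_def running_cost_def
    by (intro Ck_on_diff Ck_on_add Ck_on_sum Ck_on_mult Ck_on_inner Ck_on_scaleR Ck_on_const open_UNIV
        analytic_problem_Ck_on P)
  then have "(?h has_derivative (\<lambda>v. v \<bullet> gradient ?h x)) (at x)"
    using GDERIV_gradient[OF Ck_on_UNIV_differentiable] unfolding gderiv_def by blast
  moreover have "(snd has_derivative snd) (at (x0, x))"
    by (rule bounded_linear_imp_has_derivative[OF bounded_linear_snd])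
  ultimately have "((\<lambda>X. ?h (snd X)) has_derivative (\<lambda>v. snd v \<bullet> gradient ?h x)) (at (x0, x))"
    using has_derivative_compose[of snd snd "(x0, x)" UNIV ?h "\<lambda>v. v \<bullet> gradient ?h x"] by simp
  then have "gradient (\<lambda>X. ?h (snd X)) (x0, x) = (0, gradient ?h x)"
    by (intro gradient_eqI) (simp add: gderiv_def inner_prod_def)
  moreover have "(\<lambda>X. aug_hamiltonian P X (- lam, p) u) = (\<lambda>X. ?h (snd X))"
    by (auto simp: aug_hamiltonian_eq)
  ultimately show ?thesis
    by (simp add: hamiltonian_field_def gradient_aug_hamiltonian_covector)
qed

text \<open>The constraint on the control dominates the running cost by a function continuous on
  \<open>{0..T}\<close>.\<close>

lemma running_cost_integrable:
  fixes x :: "real \<Rightarrow> real^'n::finite" and u :: "real \<Rightarrow> real^'m::finite"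
  assumes P: "analytic_problem P" and adm: "admissible P T x u"
  shows "integrable (lebesgue_on {0..T}) (\<lambda>t. running_cost P (x t) (u t))"
proof -
  have x: "continuous_on {0..T} x"
    using adm unfolding admissible_def by (blast intro: absolutely_continuous_imp_continuous_on)
  have c: "continuous_on {0..T} (\<lambda>t. cost_drift P (x t))" "continuous_on {0..T} (\<lambda>t. cost_field P i (x t))" for i
    using analytic_problem_Ck_on(1,2)[OF P, of 0]
    by (auto intro: continuous_on_compose2[OF _ x subset_UNIV])
  have K: "continuous_on {0..T} (bound P)"
    using analytic_problem_Ck_on(5)[OF P, of 0] by (auto intro: continuous_on_subset)
  have u: "u \<in> borel_measurable (lebesgue_on {0..T})" and uK: "\<And>t i. t \<in> {0..T} \<Longrightarrow> \<bar>u t $ i\<bar> \<le> bound P t"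
    using adm by (auto simp: admissible_def control_set_def)
  have ui: "(\<lambda>t. u t $ i) \<in> borel_measurable (lebesgue_on {0..T})" for i
    using u by (rule borel_measurable_continuous_on[rotated]) (intro continuous_intros)
  show ?thesis
  proof (rule measurable_bounded_by_integrable_imp_lebesgue_integrable)
    show "(\<lambda>t. running_cost P (x t) (u t)) \<in> borel_measurable (lebesgue_on {0..T})"
      unfolding running_cost_def
      by (intro borel_measurable_add borel_measurable_sum borel_measurable_times ui
          continuous_imp_measurable_on_sets_lebesgue c) auto
    let ?g = "\<lambda>t. \<bar>cost_drift P (x t)\<bar> + (\<Sum>i\<in>UNIV. \<bar>cost_field P i (x t)\<bar> * bound P t)"
    have "continuous_on {0..T} ?g" by (intro continuous_intros c K)
    then show "integrable (lebesgue_on {0..T}) ?g"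
      by (rule continuous_imp_integrable_real)
    show "norm (running_cost P (x t) (u t)) \<le> ?g t" if "t \<in> {0..T}" for t
      unfolding running_cost_def real_norm_def
      by (intro order_trans[OF abs_triangle_ineq] add_left_mono order_trans[OF sum_abs] sum_mono)
         (simp add: abs_mult mult_left_mono uK[OF that])
  qed auto
qed

lemma cost_has_integral:
  assumes P: "analytic_problem P" and adm: "admissible P T x u" and st: "0 \<le> s" "s \<le> t" "t \<le> T"
  shows "((\<lambda>t. running_cost P (x t) (u t)) has_integral cost P t x u - cost P s x u) {s..t}"
proof -
  let ?R = "\<lambda>t. running_cost P (x t) (u t)"
  have int: "integrable (lebesgue_on {0..r}) ?R" if "r \<le> T" for r
    by (rule Equivalence_Lebesgue_Henstock_Integration.integrable_subinterval[OF
          running_cost_integrable[OF P adm]]) (use that in auto)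
  have cost: "cost P r x u = integral {0..r} ?R" "?R integrable_on {0..r}" if "r \<le> T" for r
    using int[OF that] by (auto simp: cost_def lebesgue_integral_eq_integral integrable_on_lebesgue_on)
  have "?R integrable_on {s..t}"
    using cost(2)[OF st(3)] by (rule integrable_subinterval_real) (use st in auto)
  moreover have "integral {0..s} ?R + integral {s..t} ?R = integral {0..t} ?R"
    using st by (intro Henstock_Kurzweil_Integration.integral_combine cost) auto
  ultimately show ?thesis using cost(1) st by (auto simp: has_integral_iff)
qed

text \<open>State and covector are absolutely continuous, so their equations hold at every time in
  \<open>J\<close>; the cost coordinate is an integral by definition and needs only continuity of
  the integrand.\<close>

lemma extremal_curve_has_vector_derivative:
  assumes P: "analytic_problem P" and adm: "admissible P T x u" and lift: "pmp_lift P T x u lam p"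
    and J: "open J" "J \<subseteq> {0..T}" "continuous_on J u" "t \<in> J"
  shows "(extremal_curve P x u lam p has_vector_derivative
    hamiltonian_field P (extremal_curve P x u lam p t) (u t)) (at t)"
proof -
  have acx: "absolutely_continuous_on_real {0..T} x" and acp: "absolutely_continuous_on_real {0..T} p"
    using adm lift by (auto simp: admissible_def pmp_lift_def)
  then have cx: "continuous_on J x" and cp: "continuous_on J p"
    using J(2) by (auto intro: continuous_on_subset dest: absolutely_continuous_imp_continuous_on)
  have dx: "(x has_vector_derivative dynamics P (x t) (u t)) (at t)"
    using adm by (intro absolutely_continuous_has_vector_derivative[OF acx _ J(1,2) _ J(4)]
        dynamics_continuous_on P cx J(3)) (auto simp: admissible_def)
  \<comment> \<open>The adjoint right-hand side is recovered as a component of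
    \<open>hamiltonian_field\<close>, from which it inherits continuity. The cost coordinate does
    not affect it and is put to 0.\<close>
  define g where "g t = - gradient (\<lambda>x'. hamiltonian P lam x' (p t) (u t)) (x t)" for t
  have g: "g t = snd (snd (hamiltonian_field P ((0, x t), (- lam, p t)) (u t)))" for t
    by (simp add: g_def hamiltonian_field_extremal[OF P])
  have "Ck_on 0 (\<lambda>t. hamiltonian_field P ((0, x t), (- lam, p t)) (u t)) J"
    using J(1,3) cx cp by (intro Ck_on_hamiltonian_field P) (auto intro!: continuous_intros)
  then have "continuous_on J g" unfolding g by (auto intro!: continuous_intros)
  moreover have "AE t in lebesgue_on {0..T}. (p has_vector_derivative g t) (at t within {0..T})"
    using lift unfolding pmp_lift_def g_def by (auto elim: eventually_mono)
  ultimately have dp: "(p has_vector_derivative g t) (at t)"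
    by (intro absolutely_continuous_has_vector_derivative[OF acp _ J(1,2) _ J(4)])
  have dc: "((\<lambda>t. cost P t x u) has_vector_derivative running_cost P (x t) (u t)) (at t)"
  proof (rule has_vector_derivative_of_has_integral[OF _ J(1) running_cost_continuous_on[OF P cx J(3)] J(4)])
    fix s t :: real assume "s \<le> t" "{s..t} \<subseteq> J"
    then have "0 \<le> s" "t \<le> T" using J(2) by force+
    then show "((\<lambda>t. running_cost P (x t) (u t)) has_integral cost P t x u - cost P s x u) {s..t}"
      using cost_has_integral[OF P adm _ \<open>s \<le> t\<close>] by blast
  qed
  show ?thesis
    using has_vector_derivative_Pair[OF has_vector_derivative_Pair[OF dc dx]
        has_vector_derivative_Pair[OF has_vector_derivative_const[of "- lam"] dp]]
    by (simp add: extremal_curve_def[abs_def] hamiltonian_field_extremal[OF P] g_def)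
qed

lemma extremal_curve_continuous_on:
  assumes P: "analytic_problem P" and adm: "admissible P T x u" and lift: "pmp_lift P T x u lam p"
  shows "continuous_on {0..T} (extremal_curve P x u lam p)"
proof -
  have c: "continuous_on {0..T} x" "continuous_on {0..T} p"
    using adm lift unfolding admissible_def pmp_lift_def
    by (blast intro: absolutely_continuous_imp_continuous_on)+
  have "0 < T" using adm by (simp add: admissible_def)
  then have "((\<lambda>t. running_cost P (x t) (u t)) has_integral cost P T x u - cost P 0 x u) {0..T}"
    by (intro cost_has_integral[OF P adm]) auto
  then have "continuous_on {0..T} (\<lambda>t. integral {0..t} (\<lambda>t. running_cost P (x t) (u t)))"
    by (intro indefinite_integral_continuous_1) blast
  then have "continuous_on {0..T} (\<lambda>t. cost P 0 x u + integral {0..t} (\<lambda>t. running_cost P (x t) (u t)))"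
    by (intro continuous_intros)
  moreover have "cost P 0 x u + integral {0..t} (\<lambda>t. running_cost P (x t) (u t)) = cost P t x u"
    if "t \<in> {0..T}" for t
    using integral_unique[OF cost_has_integral[OF P adm order_refl]] that by simp
  ultimately have "continuous_on {0..T} (\<lambda>t. cost P t x u)"
    by (rule continuous_on_eq)
  then show ?thesis
    unfolding extremal_curve_def[abs_def] by (intro continuous_intros c)
qed

lemma hamiltonian_eq_switching:
  "hamiltonian P lam x p u =
    drift_hamiltonian P ((x0, x), (- lam, p)) + (\<Sum>i\<in>UNIV. switching P ((x0, x), (- lam, p)) $ i * u $ i)"
  using aug_hamiltonian_eq_sum[of P "((x0, x), (- lam, p))" u] by (simp add: aug_hamiltonian_eq)

text \<open>The competitor \<open>w\<close> changes only the i-th component, to the extremal value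
  with the sign of the switching function; the other summands cancel. Stating the result as an
  inequality avoids a case split on zeros.\<close>

lemma maximum_condition_componentwise:
  fixes u :: "real^'m::finite"
  assumes max: "\<forall>w\<in>control_set P t. hamiltonian P lam x p w \<le> hamiltonian P lam x p u"
    and u: "u \<in> control_set P t" and K: "0 < bound P t"
  shows "\<bar>switching P ((x0, x), (- lam, p)) $ i\<bar> * bound P t \<le> switching P ((x0, x), (- lam, p)) $ i * u $ i"
proof -
  let ?\<phi> = "\<lambda>i. switching P ((x0, x), (- lam, p)) $ i"
  define w where "w = (\<chi> j. if j = i then sgn (?\<phi> i) * bound P t else u $ j)"
  have "w \<in> control_set P t" using u K by (auto simp: control_set_def w_def abs_mult sgn_if)
  then have "(\<Sum>j\<in>UNIV. ?\<phi> j * w $ j) \<le> (\<Sum>j\<in>UNIV. ?\<phi> j * u $ j)"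
    using max by (simp add: hamiltonian_eq_switching[where ?x0.0 = x0])
  moreover have "(\<Sum>j\<in>UNIV. ?\<phi> j * w $ j) = ?\<phi> i * w $ i + (\<Sum>j\<in>UNIV - {i}. ?\<phi> j * w $ j)"
    "(\<Sum>j\<in>UNIV. ?\<phi> j * u $ j) = ?\<phi> i * u $ i + (\<Sum>j\<in>UNIV - {i}. ?\<phi> j * u $ j)"
    by (simp_all add: sum.remove[of UNIV i])
  moreover have "(\<Sum>j\<in>UNIV - {i}. ?\<phi> j * w $ j) = (\<Sum>j\<in>UNIV - {i}. ?\<phi> j * u $ j)"
    by (rule sum.cong) (auto simp: w_def)
  ultimately have "?\<phi> i * w $ i \<le> ?\<phi> i * u $ i" by linarith
  then show ?thesis by (simp add: w_def abs_sgn mult.assoc mult.commute[of "sgn _"])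
qed

lemma AE_lebesgue_on_subset:
  assumes "AE t in lebesgue_on S. Q t" "J \<subseteq> S" "J \<in> sets lebesgue" "S \<in> sets lebesgue"
  shows "AE t in lebesgue_on J. Q t"
proof -
  have "AE t in lebesgue. t \<in> S \<longrightarrow> Q t" using assms(1,4) by (subst (asm) AE_restrict_space_iff) auto
  then have "AE t in lebesgue. t \<in> J \<longrightarrow> Q t" using assms(2) by (auto elim: eventually_mono)
  then show ?thesis using assms(3) by (subst AE_restrict_space_iff) auto
qed

lemma connected_nonvanishing_sign:
  fixes f :: "'a::topological_space \<Rightarrow> real"
  assumes "open J" "connected J" "continuous_on J f" "\<And>t. t \<in> J \<Longrightarrow> \<bar>f t\<bar> = k t" "\<And>t. t \<in> J \<Longrightarrow> k t > 0"
  obtains \<sigma> :: real where "\<bar>\<sigma>\<bar> = 1" "\<And>t. t \<in> J \<Longrightarrow> f t = \<sigma> * k t"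
proof -
  let ?U = "J \<inter> f -` {0<..}" and ?V = "J \<inter> f -` {..<0}"
  have "open ?U" "open ?V" using assms(1,3) by (auto intro!: continuous_open_preimage)
  moreover have "J \<subseteq> ?U \<union> ?V" using assms(4,5) by fastforce
  ultimately have "?U \<inter> J = {} \<or> ?V \<inter> J = {}" by (intro connectedD[OF assms(2)]) auto
  then show thesis
  proof
    assume "?U \<inter> J = {}"
    then have "f t \<le> 0" if "t \<in> J" for t using that by force
    then have "f t = (- 1) * k t" if "t \<in> J" for t using assms(4)[OF that] that by force
    then show thesis using that[of "- 1"] by simp
  next
    assume "?V \<inter> J = {}"
    then have "f t \<ge> 0" if "t \<in> J" for t using that by force
    then have "f t = 1 * k t" if "t \<in> J" for t using assms(4)[OF that] that by force
    then show thesis using that[of 1] by simp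
  qed
qed

text \<open>The maximum condition gives modulus \<open>bound P t\<close> wherever the switching
  components are nonzero, hence almost everywhere, hence everywhere by continuity; a component that
  never vanishes keeps its sign on a connected set. The switching functions may still have zeros, so
  their sign is only weak.\<close>

lemma bang_bang:
  fixes u :: "real \<Rightarrow> real^'m::finite"
  assumes P: "analytic_problem P" and adm: "admissible P T x u" and lift: "pmp_lift P T x u lam p"
    and ns: "nonsingular_arc P T (extremal_curve P x u lam p) c d"
    and J: "open J" "connected J" "J \<subseteq> {c<..<d}" "continuous_on J u"
  obtains \<sigma> :: "'m \<Rightarrow> real" where "\<And>i. \<bar>\<sigma> i\<bar> = 1" "\<And>i t. t \<in> J \<Longrightarrow> u t $ i = \<sigma> i * bound P t"
    "\<And>i t. t \<in> J \<Longrightarrow> 0 \<le> \<sigma> i * switching P (extremal_curve P x u lam p t) $ i"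
proof -
  let ?z = "extremal_curve P x u lam p"
  have cd: "0 \<le> c" "d \<le> T" using ns by (auto simp: nonsingular_arc_def)
  then have JT: "J \<subseteq> {0..T}" using J(3) by force
  have K: "bound P t > 0" if "t \<in> J" for t using P that JT by (auto simp: analytic_problem_def)
  have cK: "continuous_on J (bound P)"
    using analytic_problem_Ck_on(5)[OF P, of 0] JT by (fastforce intro: continuous_on_subset)
  have cz: "continuous_on J ?z" using extremal_curve_continuous_on[OF P adm lift] JT by (rule continuous_on_subset)
  have "continuous_on UNIV (\<lambda>z. switching P z $ i)" for i
    using Ck_on_switching_nth[OF P, of 0] by simp
  then have c\<phi>: "continuous_on J (\<lambda>t. switching P (?z t) $ i)" for i
    using cz by (rule continuous_on_compose2) auto
  have Jm: "J \<in> sets lebesgue" using J(1) by auto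
  have ae: "AE t in lebesgue_on J. \<forall>i. \<bar>switching P (?z t) $ i\<bar> * bound P t \<le> switching P (?z t) $ i * u t $ i"
  proof -
    have max: "AE t in lebesgue_on J. \<forall>w\<in>control_set P t. hamiltonian P lam (x t) (p t) w \<le> hamiltonian P lam (x t) (p t) (u t)"
      using lift unfolding pmp_lift_def
      by (intro AE_lebesgue_on_subset[OF _ JT Jm]) (auto elim: eventually_mono)
    have "AE t in lebesgue_on J. t \<in> J" using Jm by (subst AE_restrict_space_iff) auto
    with max show ?thesis
    proof eventually_elim
      case (elim t)
      then have "u t \<in> control_set P t" using adm JT by (auto simp: admissible_def)
      then show ?case
        using maximum_condition_componentwise[OF elim(1) _ K[OF elim(2)]] by (simp add: extremal_curve_def)
    qed
  qed
  have ne: "AE t in lebesgue_on J. \<forall>i. switching P (?z t) $ i \<noteq> 0"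
    using ns unfolding nonsingular_arc_def by (intro AE_lebesgue_on_subset[OF _ J(3) Jm]) auto
  have uK: "\<bar>u t $ i\<bar> = bound P t" if t: "t \<in> J" for t i
  proof -
    have "AE t in lebesgue_on J. \<bar>switching P (?z t) $ i\<bar> * bound P t \<le> switching P (?z t) $ i * u t $ i \<and>
        switching P (?z t) $ i \<noteq> 0"
      using ae ne by eventually_elim blast
    then have "\<bar>u t $ i\<bar> - bound P t = 0"
    proof (rule AE_lebesgue_on_open_imp_all_zero[OF _ Jm J(1) subset_refl _ _ t])
      show "continuous_on J (\<lambda>t. \<bar>u t $ i\<bar> - bound P t)" by (intro continuous_intros J(4) cK)
      fix t assume "t \<in> J" and *: "\<bar>switching P (?z t) $ i\<bar> * bound P t \<le> switching P (?z t) $ i * u t $ i \<and>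
        switching P (?z t) $ i \<noteq> 0"
      then have "\<bar>switching P (?z t) $ i\<bar> * bound P t \<le> \<bar>switching P (?z t) $ i\<bar> * \<bar>u t $ i\<bar>"
        using abs_ge_self[of "switching P (?z t) $ i * u t $ i"] unfolding abs_mult[symmetric] by linarith
      with * have "bound P t \<le> \<bar>u t $ i\<bar>" by simp
      moreover have "\<bar>u t $ i\<bar> \<le> bound P t"
        using adm \<open>t \<in> J\<close> JT by (auto simp: admissible_def control_set_def)
      ultimately show "\<bar>u t $ i\<bar> - bound P t = 0" by simp
    qed
    then show ?thesis by simp
  qed
  have "\<exists>\<sigma>::real. \<bar>\<sigma>\<bar> = 1 \<and> (\<forall>t\<in>J. u t $ i = \<sigma> * bound P t)" for i
    by (rule connected_nonvanishing_sign[OF J(1,2), of "\<lambda>t. u t $ i" "bound P"])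
       (auto intro!: continuous_intros J(4) simp: uK K)
  then obtain \<sigma> where \<sigma>: "\<And>i. \<bar>\<sigma> i\<bar> = (1::real)" "\<And>i t. t \<in> J \<Longrightarrow> u t $ i = \<sigma> i * bound P t" by metis
  have "0 \<le> \<sigma> i * switching P (?z t) $ i" if t: "t \<in> J" for i t
  proof -
    have "\<bar>switching P (?z t) $ i\<bar> - \<sigma> i * switching P (?z t) $ i = 0"
    proof (rule AE_lebesgue_on_open_imp_all_zero[OF ae Jm J(1) subset_refl _ _ t])
      show "continuous_on J (\<lambda>t. \<bar>switching P (?z t) $ i\<bar> - \<sigma> i * switching P (?z t) $ i)"
        by (intro continuous_intros c\<phi>)
      fix t assume "t \<in> J" "\<forall>i. \<bar>switching P (?z t) $ i\<bar> * bound P t \<le> switching P (?z t) $ i * u t $ i"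
      then have "\<bar>switching P (?z t) $ i\<bar> * bound P t \<le> (\<sigma> i * switching P (?z t) $ i) * bound P t"
        using \<sigma>(2) by (simp add: mult_ac)
      then have "\<bar>switching P (?z t) $ i\<bar> \<le> \<sigma> i * switching P (?z t) $ i"
        using K[OF \<open>t \<in> J\<close>] by simp
      moreover have "\<sigma> i * switching P (?z t) $ i \<le> \<bar>\<sigma> i * switching P (?z t) $ i\<bar>" by simp
      ultimately show "\<bar>switching P (?z t) $ i\<bar> - \<sigma> i * switching P (?z t) $ i = 0"
        using \<sigma>(1)[of i] by (simp add: abs_mult)
    qed
    then show ?thesis by (metis abs_ge_zero right_minus_eq)
  qed
  then show thesis using that \<sigma> by blast
qed

section \<open>One-sided Taylor quotients\<close>

lemma nth_vector_derivative_0 [simp]: "nth_vector_derivative 0 f = f"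
  by (simp add: nth_vector_derivative_def)

lemma nth_vector_derivative_Suc:
  "nth_vector_derivative (Suc s) f = nth_vector_derivative s (\<lambda>t. vector_derivative f (at t))"
  by (simp add: nth_vector_derivative_def funpow_Suc_right del: funpow.simps)

lemma nth_vector_derivative_Suc':
  "nth_vector_derivative (Suc s) f t = vector_derivative (nth_vector_derivative s f) (at t)"
  by (simp add: nth_vector_derivative_def)

lemma Ck_on_real_SucD:
  fixes f :: "real \<Rightarrow> 'b::real_normed_vector"
  assumes "Ck_on (Suc k) f U"
  shows "t \<in> U \<Longrightarrow> (f has_vector_derivative vector_derivative f (at t)) (at t)"
    and "open U \<Longrightarrow> Ck_on k (\<lambda>t. vector_derivative f (at t)) U"
proof -
  have d: "f differentiable (at t)" if "t \<in> U" for t using assms that by simp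
  then show dv: "t \<in> U \<Longrightarrow> (f has_vector_derivative vector_derivative f (at t)) (at t)" for t
    by (simp add: vector_derivative_works[symmetric])
  assume U: "open U"
  have eq: "frechet_derivative f (at t) 1 = vector_derivative f (at t)" if "t \<in> U" for t
    using dv[OF that] frechet_derivative_at[of f] unfolding has_vector_derivative_def
    by (metis scaleR_one)
  have "Ck_on k (\<lambda>t. frechet_derivative f (at t) 1) U" using assms by simp
  then show "Ck_on k (\<lambda>t. vector_derivative f (at t)) U"
    using Ck_on_cong[OF U eq] by (rule iffD1[rotated])
qed

lemma Ck_on_real_SucI:
  fixes f :: "real \<Rightarrow> 'b::real_normed_vector"
  assumes "open U" "\<And>t. t \<in> U \<Longrightarrow> (f has_vector_derivative f' t) (at t)" "Ck_on k f' U"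
  shows "Ck_on (Suc k) f U"
  by (rule Ck_on_SucI[OF assms(1), where f' = "\<lambda>t h. h *\<^sub>R f' t"])
     (use assms(2,3) in \<open>auto simp: has_vector_derivative_def\<close>)

lemma vector_derivative_cong_open:
  assumes "open U" "t \<in> U" "\<And>t. t \<in> U \<Longrightarrow> f t = g t"
  shows "vector_derivative f (at t) = vector_derivative g (at t)"
  by (rule vector_derivative_cong_eq)
     (use assms in \<open>auto intro!: eventually_nhds_in_open elim!: eventually_mono[rotated]\<close>)

lemma nth_vector_derivative_cong_open:
  assumes "open U" "t \<in> U" "\<And>t. t \<in> U \<Longrightarrow> f t = g t"
  shows "nth_vector_derivative s f t = nth_vector_derivative s g t"
  using assms(2,3)
proof (induction s arbitrary: f g t)
  case (Suc s)
  show ?case unfolding nth_vector_derivative_Suc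
    by (rule Suc.IH[OF Suc.prems(1)]) (rule vector_derivative_cong_open[OF assms(1) _ Suc.prems(2)])
qed simp

lemma Ck_on_nth_vector_derivative:
  fixes f :: "real \<Rightarrow> 'b::real_normed_vector"
  assumes "open U" "Ck_on (s + k) f U"
  shows "Ck_on k (nth_vector_derivative s f) U"
  using assms(2)
proof (induction s arbitrary: f)
  case (Suc s)
  then show ?case unfolding nth_vector_derivative_Suc
    using Ck_on_real_SucD(2)[of "s + k" f U] assms(1) by simp
qed simp

lemma nth_vector_derivative_diff:
  fixes f g :: "real \<Rightarrow> 'b::real_normed_vector"
  assumes "open U" "Ck_on s f U" "Ck_on s g U" "t \<in> U"
  shows "nth_vector_derivative s (\<lambda>t. f t - g t) t = nth_vector_derivative s f t - nth_vector_derivative s g t"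
  using assms(2-4)
proof (induction s arbitrary: f g t)
  case (Suc s)
  have d: "vector_derivative (\<lambda>t. f t - g t) (at t) = vector_derivative f (at t) - vector_derivative g (at t)"
    if "t \<in> U" for t
    using that Suc.prems(1,2)
    by (intro vector_derivative_at has_vector_derivative_diff Ck_on_real_SucD(1)) auto
  have "nth_vector_derivative (Suc s) (\<lambda>t. f t - g t) t =
      nth_vector_derivative s (\<lambda>t. vector_derivative f (at t) - vector_derivative g (at t)) t"
    unfolding nth_vector_derivative_Suc by (rule nth_vector_derivative_cong_open[OF assms(1) Suc.prems(3) d])
  also have "\<dots> = nth_vector_derivative (Suc s) f t - nth_vector_derivative (Suc s) g t"
    unfolding nth_vector_derivative_Suc
    by (rule Suc.IH) (use Suc.prems assms(1) in \<open>auto intro: Ck_on_real_SucD(2) simp del: Ck_on.simps\<close>)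
  finally show ?case .
qed simp

lemma nth_vector_derivative_vec_nth:
  fixes f :: "real \<Rightarrow> real^'n::finite"
  assumes "open U" "Ck_on s f U" "t \<in> U"
  shows "nth_vector_derivative s (\<lambda>t. f t $ i) t = nth_vector_derivative s f t $ i"
  using assms(2,3)
proof (induction s arbitrary: f t)
  case (Suc s)
  have d: "vector_derivative (\<lambda>t. f t $ i) (at t) = vector_derivative f (at t) $ i"
    if "t \<in> U" for t
    using that Suc.prems(1)
    by (intro vector_derivative_at bounded_linear.has_vector_derivative[OF bounded_linear_vec_nth]
        Ck_on_real_SucD(1)) auto
  have "nth_vector_derivative (Suc s) (\<lambda>t. f t $ i) t =
      nth_vector_derivative s (\<lambda>t. vector_derivative f (at t) $ i) t"
    unfolding nth_vector_derivative_Suc by (rule nth_vector_derivative_cong_open[OF assms(1) Suc.prems(2) d])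
  also have "\<dots> = nth_vector_derivative (Suc s) f t $ i"
    unfolding nth_vector_derivative_Suc
    by (rule Suc.IH) (use Suc.prems assms(1) in \<open>auto intro: Ck_on_real_SucD(2) simp del: Ck_on.simps\<close>)
  finally show ?case .
qed simp

text \<open>Induction through derivatives: the glued derivative is of class C^k by hypothesis at
  lower order, and it is the derivative of the glued function off c, so the point c can be filled
  in.\<close>

lemma Ck_on_glue:
  fixes f g :: "real \<Rightarrow> 'b::banach"
  assumes J: "J = {l<..<h}" "c \<in> J" and "Ck_on k f J" "Ck_on k g J"
    and "\<And>s. s \<le> k \<Longrightarrow> nth_vector_derivative s f c = nth_vector_derivative s g c"
  shows "Ck_on k (\<lambda>t. if t < c then f t else g t) J"
  using assms(3-5)
proof (induction k arbitrary: f g)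
  case 0
  have d: "continuous_on J (\<lambda>t. g t - f t)" using 0 by (auto intro: continuous_intros)
  have m: "continuous_on J (\<lambda>t. max t c)" by (intro continuous_intros)
  \<comment> \<open>Since \<open>g - f\<close> vanishes at c, this function is 0 before c and
    \<open>g - f\<close> after it; adding it to \<open>f\<close> yields the glued function as a
    manifestly continuous expression.\<close>
  have "continuous_on J (\<lambda>t. g (max t c) - f (max t c))"
    by (rule continuous_on_compose2[OF d m]) (use J in \<open>auto simp: max_def\<close>)
  then have "continuous_on J (\<lambda>t. f t + (g (max t c) - f (max t c)))"
    using 0 by (auto intro: continuous_intros)
  moreover have "f t + (g (max t c) - f (max t c)) = (if t < c then f t else g t)" for t
    using 0(3)[of 0] by (auto simp: max_def)
  ultimately show ?case by simp
next
  case (Suc k)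
  have oJ: "open J" using J by simp
  let ?D = "\<lambda>f t. vector_derivative f (at t)"
  have D: "Ck_on k (\<lambda>t. if t < c then ?D f t else ?D g t) J"
    using Suc.prems oJ by (intro Suc.IH Ck_on_real_SucD(2)) (auto simp: nth_vector_derivative_Suc[symmetric] simp del: Ck_on.simps)
  have C0: "Ck_on k (\<lambda>t. if t < c then f t else g t) J"
    using Suc.prems by (intro Suc.IH) (auto intro: Ck_on_SucD simp del: Ck_on.simps)
  show ?case
  proof (rule Ck_on_real_SucI[OF oJ _ D])
    fix t assume "t \<in> J"
    then show "((\<lambda>t. if t < c then f t else g t) has_vector_derivative
        (if t < c then ?D f t else ?D g t)) (at t)"
    proof (rule has_vector_derivative_fill_point[OF oJ Ck_on_imp_continuous_on[OF C0] Ck_on_imp_continuous_on[OF D],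
          where c = c])
      fix s assume s: "s \<in> J - {c}"
      show "((\<lambda>t. if t < c then f t else g t) has_vector_derivative
          (if s < c then ?D f s else ?D g s)) (at s)"
      proof (cases "s < c")
        case True
        have "(f has_vector_derivative ?D f s) (at s)"
          using Ck_on_real_SucD(1)[OF Suc.prems(1)] s by auto
        then have "((\<lambda>t. if t < c then f t else g t) has_vector_derivative ?D f s) (at s)"
          by (rule has_vector_derivative_transform_within_open[of _ _ _ "{..<c}"]) (use True in auto)
        then show ?thesis using True by simp
      next
        case False
        then have "c < s" using s by auto
        have "(g has_vector_derivative ?D g s) (at s)"
          using Ck_on_real_SucD(1)[OF Suc.prems(2)] s by auto
        then have "((\<lambda>t. if t < c then f t else g t) has_vector_derivative ?D g s) (at s)"
          by (rule has_vector_derivative_transform_within_open[of _ _ _ "{c<..}"]) (use \<open>c < s\<close> in auto)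
        then show ?thesis using \<open>c < s\<close> by simp
      qed
    qed
  qed
qed

text \<open>L'Hopital's rule; differentiating the denominator yields the factor
  \<open>Suc m\<close>.\<close>

lemma one_sided_ratio_step:
  fixes f :: "real \<Rightarrow> real"
  assumes F: "F = at_right c \<or> F = at_left c" and "(f \<longlongrightarrow> 0) F"
    "\<forall>\<^sub>F t in F. (f has_real_derivative f' t) (at t)" "((\<lambda>t. f' t / (t - c) ^ m) \<longlongrightarrow> L) F"
  shows "((\<lambda>t. f t / (t - c) ^ Suc m) \<longlongrightarrow> L / of_nat (Suc m)) F"
proof -
  let ?g = "\<lambda>t. (t - c) ^ Suc m" and ?g' = "\<lambda>t. of_nat (Suc m) * (t - c) ^ m"
  have Fat: "F \<le> at c" using F by (auto intro: at_le)
  have ne: "\<forall>\<^sub>F t in F. t \<noteq> c" using Fat eventually_at_ball'[of 1 c UNIV]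
    by (auto simp: le_filter_def elim: eventually_mono)
  have g0: "(?g \<longlongrightarrow> 0) F"
    by (rule tendsto_mono[OF Fat]) (auto intro!: tendsto_eq_intros)
  have g': "\<forall>\<^sub>F t in F. (?g has_real_derivative ?g' t) (at t)"
  proof (intro always_eventually allI)
    fix t
    have "((\<lambda>t. t - c) has_real_derivative 1) (at t)" by (auto intro!: derivative_eq_intros)
    from DERIV_power_Suc[OF this, of m] show "(?g has_real_derivative ?g' t) (at t)" by simp
  qed
  have gn: "\<forall>\<^sub>F t in F. ?g t \<noteq> 0" by (rule eventually_mono[OF ne]) simp
  have gn': "\<forall>\<^sub>F t in F. ?g' t \<noteq> 0" by (rule eventually_mono[OF ne]) simp
  have "((\<lambda>t. (f' t / (t - c) ^ m) / of_nat (Suc m)) \<longlongrightarrow> L / of_nat (Suc m)) F"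
    by (intro tendsto_divide assms(4) tendsto_const) auto
  then have lim: "((\<lambda>t. f' t / ?g' t) \<longlongrightarrow> L / of_nat (Suc m)) F" by (simp add: mult.commute)
  from F show ?thesis
  proof
    assume "F = at_right c"
    then show ?thesis using lhopital_right[of f c ?g ?g' f'] assms(2,3) g0 g' gn gn' lim by simp
  next
    assume "F = at_left c"
    then show ?thesis using lhopital_left[of f c ?g ?g' f'] assms(2,3) g0 g' gn gn' lim by simp
  qed
qed

text \<open>Each of the n steps divides by one of m+1, ..., m+n, hence the factorials. The
  derivatives \<open>D j\<close> are required on one side only, as the switching function changes
  its law at the junction.\<close>

lemma one_sided_ratio:
  fixes D :: "nat \<Rightarrow> real \<Rightarrow> real"
  assumes F: "F = at_right c \<or> F = at_left c"
    and "\<And>j. j < n \<Longrightarrow> (D j \<longlongrightarrow> 0) F"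
    and "\<And>j. j < n \<Longrightarrow> \<forall>\<^sub>F t in F. (D j has_real_derivative D (Suc j) t) (at t)"
    and "((\<lambda>t. D n t / (t - c) ^ m) \<longlongrightarrow> L) F"
  shows "((\<lambda>t. D 0 t / (t - c) ^ (m + n)) \<longlongrightarrow> L * fact m / fact (m + n)) F"
  using assms(2-)
proof (induction n arbitrary: D)
  case (Suc n)
  have "((\<lambda>t. D (Suc 0) t / (t - c) ^ (m + n)) \<longlongrightarrow> L * fact m / fact (m + n)) F"
    using Suc.IH[of "\<lambda>j. D (Suc j)"] Suc.prems by simp
  from one_sided_ratio_step[OF F Suc.prems(1,2) this]
  show ?case by (simp add: mult.commute)
qed simp

text \<open>\<open>e\<close> is the sign of t - c along the filter, so
  \<open>e ^ k / (t - c) ^ k\<close> is a power of a positive number.\<close>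

lemma one_sided_ratio_sign:
  fixes f :: "real \<Rightarrow> real" and e :: real
  assumes F: "(F = at_right c \<and> e = 1) \<or> (F = at_left c \<and> e = - 1)"
    and "\<forall>\<^sub>F t in F. 0 \<le> f t" "((\<lambda>t. f t / (t - c) ^ k) \<longlongrightarrow> L) F"
  shows "0 \<le> e ^ k * L"
proof (rule tendsto_lowerbound)
  show "((\<lambda>t. e ^ k * (f t / (t - c) ^ k)) \<longlongrightarrow> e ^ k * L) F" by (intro tendsto_intros assms(3))
  have pos: "\<forall>\<^sub>F t in F. 0 < e * (t - c)"
    using F by (auto simp: eventually_at_filter)
  show "\<forall>\<^sub>F t in F. 0 \<le> e ^ k * (f t / (t - c) ^ k)"
    using pos assms(2)
  proof eventually_elim
    case (elim t)
    have "e / (t - c) = 1 / (e * (t - c))"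
      using F minus_divide_right[of 1 "t - c"] by auto
    moreover have "e ^ k * (f t / (t - c) ^ k) = f t * (e / (t - c)) ^ k"
      by (simp add: power_divide)
    ultimately have "e ^ k * (f t / (t - c) ^ k) = f t * (1 / (e * (t - c))) ^ k" by (simp only:)
    then show ?case using elim by simp
  qed
  show "F \<noteq> bot" using F by (metis trivial_limit_at_right_real trivial_limit_at_left_real)
qed

text \<open>With w = M v nonzero and M symmetric, the form at v + s w is at least 2 s (w . w) up to
  a term of order s squared, hence positive for small s > 0, against semidefiniteness.\<close>

lemma semidefinite_isotropic_imp_kernel:
  fixes M :: "real^'m^'m"
  assumes "negative_semidefinite M" "transpose M = M" "0 \<le> v \<bullet> (M *v v)"
  shows "M *v v = 0"
proof (rule ccontr)
  define w where "w = M *v v"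
  assume "M *v v \<noteq> 0"
  then have "w \<bullet> w > 0" by (simp add: w_def)
  \<comment> \<open>This choice bounds the quadratic term by half of the linear one; the summand 1
    keeps the denominator positive.\<close>
  define s where "s = (w \<bullet> w) / (\<bar>w \<bullet> (M *v w)\<bar> + 1)"
  have "s > 0" using \<open>w \<bullet> w > 0\<close> by (simp add: s_def)
  have nd: "x \<bullet> (M *v x) \<le> 0" for x using assms(1) by (simp add: negative_semidefinite_def)
  have "v \<bullet> (M *v w) = w \<bullet> w"
    using dot_lmul_matrix[of v M w] assms(2) by (metis transpose_matrix_vector w_def)
  then have "(v + s *\<^sub>R w) \<bullet> (M *v (v + s *\<^sub>R w)) = v \<bullet> w + s * (2 * (w \<bullet> w) + s * (w \<bullet> (M *v w)))"
    by (simp add: matrix_vector_right_distrib matrix_vector_mult_scaleR inner_add_left inner_add_right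
        w_def[symmetric] algebra_simps)
  moreover have "0 \<le> v \<bullet> w" using assms(3) by (simp add: w_def)
  ultimately have "s * (2 * (w \<bullet> w) + s * (w \<bullet> (M *v w))) \<le> 0" using nd[of "v + s *\<^sub>R w"] by linarith
  then have "2 * (w \<bullet> w) + s * (w \<bullet> (M *v w)) \<le> 0" using \<open>s > 0\<close> by (simp add: mult_le_0_iff)
  moreover have "- (w \<bullet> w) \<le> s * (w \<bullet> (M *v w))"
  proof -
    have "s * \<bar>w \<bullet> (M *v w)\<bar> \<le> w \<bullet> w"
      using \<open>w \<bullet> w > 0\<close> by (simp add: s_def field_simps)
    moreover have "- (s * \<bar>w \<bullet> (M *v w)\<bar>) \<le> s * (w \<bullet> (M *v w))"
      using \<open>s > 0\<close> by (metis abs_ge_minus_self abs_mult abs_of_pos minus_le_iff)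
    ultimately show ?thesis by linarith
  qed
  ultimately show False using \<open>w \<bullet> w > 0\<close> by linarith
qed

section \<open>Parity at the junction\<close>

lemma Ck_on_nth_tendsto:
  fixes f :: "real \<Rightarrow> 'b::real_normed_vector"
  assumes "open J" "c \<in> J" "Ck_on s f J" "F \<le> at c"
  shows "(nth_vector_derivative s f \<longlongrightarrow> nth_vector_derivative s f c) F"
proof -
  have "continuous_on J (nth_vector_derivative s f)"
    using Ck_on_nth_vector_derivative[OF assms(1), of s 0 f] assms(3) by simp
  then have "isCont (nth_vector_derivative s f) c"
    using assms(1,2) by (simp add: continuous_on_eq_continuous_at)
  then show ?thesis unfolding isCont_def by (rule tendsto_mono[OF assms(4)])
qed

lemma Ck_on_one_sided_ratio:
  fixes f :: "real \<Rightarrow> real"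
  assumes F: "F = at_right c \<or> F = at_left c" and J: "open J" "c \<in> J" and f: "Ck_on r f J"
    and z: "\<And>s. s < r \<Longrightarrow> nth_vector_derivative s f c = 0"
  shows "((\<lambda>t. f t / (t - c) ^ r) \<longlongrightarrow> nth_vector_derivative r f c / fact r) F"
proof -
  have Fc: "F \<le> at c" using F by (auto intro: at_le)
  have inJ: "\<forall>\<^sub>F t in F. t \<in> J"
    using eventually_at_in_open'[OF J] Fc by (auto simp: le_filter_def)
  have "((\<lambda>t. nth_vector_derivative 0 f t / (t - c) ^ (0 + r)) \<longlongrightarrow> nth_vector_derivative r f c * fact 0 / fact (0 + r)) F"
  proof (rule one_sided_ratio[OF F])
    fix j assume "j < r"
    then show "(nth_vector_derivative j f \<longlongrightarrow> 0) F"
      using Ck_on_nth_tendsto[OF J Ck_on_mono[OF f, of j] Fc] z by simp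
    obtain k where k: "r = j + Suc k" using \<open>j < r\<close> less_imp_Suc_add by fastforce
    have "Ck_on (Suc k) (nth_vector_derivative j f) J"
      using f unfolding k by (rule Ck_on_nth_vector_derivative[OF J(1)])
    from Ck_on_real_SucD(1)[OF this]
    show "\<forall>\<^sub>F t in F. (nth_vector_derivative j f has_real_derivative nth_vector_derivative (Suc j) f t) (at t)"
      by (intro eventually_mono[OF inJ])
         (simp add: nth_vector_derivative_Suc' has_real_derivative_iff_has_vector_derivative)
  next
    show "((\<lambda>t. nth_vector_derivative r f t / (t - c) ^ 0) \<longlongrightarrow> nth_vector_derivative r f c) F"
      using Ck_on_nth_tendsto[OF J f Fc] by simp
  qed
  then show ?thesis by simp
qed

text \<open>The local statement on a window \<open>J\<close> around the junction: which half is
  singular is left open by \<open>sides\<close>, and the curve is asked to obey the differential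
  equation only off c.\<close>

lemma junction_parity:
  fixes P :: "('n::finite, 'm::finite) affine_problem"
    and z :: "real \<Rightarrow> 'n aug \<times> 'n aug" and u :: "real \<Rightarrow> real^'m"
  assumes P: "analytic_problem P" and q: "intrinsic_order P q"
    and J: "J = {l<..<h}" "c \<in> J"
    and sides: "(S = {l<..<c} \<and> N = {c<..<h}) \<or> (S = {c<..<h} \<and> N = {l<..<c})"
    and zc: "continuous_on J z"
    and zd: "\<And>t. t \<in> J - {c} \<Longrightarrow> (z has_vector_derivative hamiltonian_field P (z t) (u t)) (at t)"
    and inv: "\<And>t. t \<in> J \<Longrightarrow> invertible (control_matrix P (2 * q) (z t))"
    and sing: "\<And>t. t \<in> S \<Longrightarrow> switching P (z t) = 0"
    and K: "\<And>k. Ck_on k K J" and \<sigma>: "\<And>i. \<bar>\<sigma> i\<bar> = 1"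
    and uN: "\<And>t i. t \<in> N \<Longrightarrow> u t $ i = \<sigma> i * K t"
    and signN: "\<And>t i. t \<in> N \<Longrightarrow> 0 \<le> \<sigma> i * switching P (z t) $ i"
    and uS: "\<And>t i. t \<in> S \<Longrightarrow> \<bar>u t $ i\<bar> \<le> K t"
    and glc: "\<And>t. t \<in> S \<Longrightarrow> negative_semidefinite ((- 1) ^ q *\<^sub>R control_matrix P (2 * q) (z t))"
    and r: "lowest_discontinuous_derivative u c r"
  shows "odd (q + r)"
proof -
  define B where "B = control_matrix P (2 * q)"
  define A where "A \<zeta> = switching_deriv P (2 * q) \<zeta> 0" for \<zeta>
  define \<Psi> where "\<Psi> j t = switching_deriv P j (z t) 0" for j t
  have oJ: "open J" and oS: "open S" and oN: "open N" using J sides by auto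
  have JSN: "J - {c} = S \<union> N" "S \<inter> N = {}" using sides J by auto
  \<comment> \<open>One-sided filters with their signs treat both orientations at once. The only
    trace of two opposite sides is \<open>es * en = - 1\<close>.\<close>
  obtain Fs Fn :: "real filter" and es en :: real where
    Fs: "(Fs = at_right c \<and> es = 1) \<or> (Fs = at_left c \<and> es = - 1)" and
    Fn: "(Fn = at_right c \<and> en = 1) \<or> (Fn = at_left c \<and> en = - 1)" and
    e: "es * en = - 1" and
    inS: "\<forall>\<^sub>F t in Fs. t \<in> S" and inN: "\<forall>\<^sub>F t in Fn. t \<in> N" and
    split: "\<And>(f :: real \<Rightarrow> real^'m) L. (f \<longlongrightarrow> L) Fs \<Longrightarrow> (f \<longlongrightarrow> L) Fn \<Longrightarrow> (f \<longlongrightarrow> L) (at c)"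
  proof (cases "S = {l<..<c}")
    case True
    then have "N = {c<..<h}" using sides J by auto
    then show thesis using True J eventually_at_left_real[of l c] eventually_at_right_real[of c h]
      by (intro that[of "at_left c" "- 1" "at_right c" 1])
         (auto intro: filterlim_split_at)
  next
    case False
    then have "S = {c<..<h}" "N = {l<..<c}" using sides by auto
    then show thesis using J eventually_at_left_real[of l c] eventually_at_right_real[of c h]
      by (intro that[of "at_right c" 1 "at_left c" "- 1"])
         (auto intro: filterlim_split_at)
  qed
  have Fs': "Fs = at_right c \<or> Fs = at_left c" and Fn': "Fn = at_right c \<or> Fn = at_left c"
    using Fs Fn by auto
  have Fsc: "Fs \<le> at c" and Fnc: "Fn \<le> at c" using Fs' Fn' by (auto intro: at_le)
  have nb: "Fs \<noteq> bot" "Fn \<noteq> bot"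
    using Fs' Fn' by (metis trivial_limit_at_right_real trivial_limit_at_left_real)+

  \<comment> \<open>Derivatives of the switching function on both sides\<close>
  have c\<Psi>: "continuous_on J (\<Psi> j)" for j
    unfolding \<Psi>_def using Ck_on_switching_deriv[OF P, of 0 j]
    by (auto intro: continuous_on_compose2[OF _ zc subset_UNIV])
  have d\<Psi>: "(\<Psi> j has_vector_derivative switching_deriv P (Suc j) (z t) (u t)) (at t)" if "t \<in> J - {c}" for j t
    unfolding \<Psi>_def by (rule switching_deriv_along[OF P zd[OF that]])
  have below: "switching_deriv P (Suc j) (z t) v = \<Psi> (Suc j) t" if "Suc j < 2 * q" for j t v
    using switching_deriv_Suc_affine[OF P, of j "z t" v] intrinsic_order_zero[OF q that]
    by (simp add: \<Psi>_def del: switching_deriv.simps)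
  \<comment> \<open>Differentiating \<open>\<Psi> q'\<close>, of index \<open>2 * q - 1\<close>, is
    the step at which the control first appears.\<close>
  obtain q' where q': "2 * q = Suc q'" using intrinsic_order_pos[OF q] by (cases "2 * q") auto
  have top: "switching_deriv P (Suc q') \<zeta> v = A \<zeta> + B \<zeta> *v v" for \<zeta> v
    using switching_deriv_Suc_affine[OF P, of q' \<zeta> v] by (simp add: A_def B_def q' del: switching_deriv.simps)
  have derS: "switching_deriv P (Suc j) (z t) (u t) = 0" if "\<And>t. t \<in> S \<Longrightarrow> \<Psi> j t = 0" "t \<in> S" for j t
  proof -
    have "((\<lambda>_. 0) has_vector_derivative 0) (at t)" by (rule has_vector_derivative_const)
    then have "(\<Psi> j has_vector_derivative 0) (at t)"
      by (rule has_vector_derivative_transform_within_open[OF _ oS that(2)]) (simp add: that(1))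
    moreover have "t \<in> J - {c}" using that(2) JSN by auto
    ultimately show ?thesis using d\<Psi> vector_derivative_unique_at by blast
  qed
  have \<Psi>S: "\<Psi> j t = 0" if "j < 2 * q" "t \<in> S" for j t
    using that
  proof (induction j arbitrary: t)
    case 0 then show ?case using sing by (simp add: \<Psi>_def)
  next
    case (Suc j)
    then show ?case using derS[of j t] below[of j t "u t"] by simp
  qed
  \<comment> \<open>Vanishing on the singular side passes to c by continuity and from there to the
    nonsingular side; these are the zero limits that l'Hopital's rule needs.\<close>
  have \<Psi>c: "(\<Psi> j \<longlongrightarrow> 0) Fn" if "j < 2 * q" for j
  proof -
    have lim: "(\<Psi> j \<longlongrightarrow> \<Psi> j c) (at c)"
      using c\<Psi> oJ J(2) by (metis continuous_on_eq_continuous_at isCont_def)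
    have "(\<Psi> j \<longlongrightarrow> 0) Fs"
      by (rule tendsto_eventually[OF eventually_mono[OF inS]]) (simp add: \<Psi>S[OF that])
    then have "\<Psi> j c = 0" using tendsto_mono[OF Fsc lim] nb tendsto_unique by blast
    then show ?thesis using tendsto_mono[OF Fnc lim] by simp
  qed

  \<comment> \<open>Singular control as a smooth feedback, and the bootstrap\<close>
  define U where "U = {\<zeta>. invertible (B \<zeta>)}"
  have "continuous_on UNIV (\<lambda>\<zeta>. det (B \<zeta>))"
    using Ck_on_det[OF open_UNIV Ck_on_control_matrix_nth[OF P], of 0] by (simp add: B_def)
  then have "open U"
    using open_Collect_neq[of "\<lambda>\<zeta>. det (B \<zeta>)" "\<lambda>_. 0"] by (simp add: U_def invertible_det_nz)
  have zU: "z ` J \<subseteq> U" using inv by (auto simp: U_def B_def)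
  \<comment> \<open>Solving in phase space instead of along the curve makes the feedback as smooth
    in time as \<open>z\<close>, up to order r, and defines it on both sides of the
    junction.\<close>
  obtain uhat where uhat: "Ck_on r uhat U" "\<And>\<zeta> v. \<zeta> \<in> U \<Longrightarrow> B \<zeta> *v v = - A \<zeta> \<longleftrightarrow> v = uhat \<zeta>"
  proof (rule Ck_on_linear_solve[OF \<open>open U\<close>, of r B "\<lambda>\<zeta>. - A \<zeta>"])
    show "Ck_on r (\<lambda>\<zeta>. B \<zeta> $ i $ j) U" for i j
      unfolding B_def by (rule Ck_on_subset[OF Ck_on_control_matrix_nth[OF P]]) simp
    show "Ck_on r (\<lambda>\<zeta>. (- A \<zeta>) $ i) U" for i
      unfolding A_def
      by (rule Ck_on_subset[OF Ck_on_vec_nth[OF open_UNIV Ck_on_minus[OF open_UNIV Ck_on_switching_deriv[OF P]]]]) simp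
  qed (auto simp: U_def)
  define V W where "V t = (\<chi> i. \<sigma> i * K t)" and "W t = uhat (z t)" for t
  have CV: "Ck_on k V J" for k
    unfolding V_def by (intro Ck_on_vec oJ) (simp add: Ck_on_mult Ck_on_const K oJ)
  have CW: "Ck_on s W J" if "Ck_on s z J" "s \<le> r" for s
    unfolding W_def
    by (rule Ck_on_compose[OF oJ \<open>open U\<close> zU Ck_on_mono[OF uhat(1) that(2)] that(1)])
  have BW: "B (z t) *v W t = - A (z t)" if "t \<in> J" for t
    using uhat(2)[of "z t" "W t"] that zU by (auto simp: W_def)
  have u_N: "u t = V t" if "t \<in> N" for t using uN[OF that] by (simp add: V_def vec_eq_iff)
  have u_S: "u t = W t" if "t \<in> S" for t
  proof -
    have "A (z t) + B (z t) *v u t = 0"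
      using derS[of q' t] \<Psi>S that unfolding top by (simp add: q')
    then have "B (z t) *v u t = - A (z t)" by (simp add: eq_neg_iff_add_eq_0 add.commute)
    then show ?thesis using uhat(2)[of "z t" "u t"] that JSN zU by (auto simp: W_def)
  qed
  have limN: "(nth_vector_derivative s u \<longlongrightarrow> nth_vector_derivative s V c) Fn" for s
  proof (rule Lim_transform_eventually[OF Ck_on_nth_tendsto[OF oJ J(2) CV Fnc]])
    show "\<forall>\<^sub>F t in Fn. nth_vector_derivative s V t = nth_vector_derivative s u t"
      by (rule eventually_mono[OF inN], rule nth_vector_derivative_cong_open[OF oN]) (auto simp: u_N)
  qed
  have limS: "(nth_vector_derivative s u \<longlongrightarrow> nth_vector_derivative s W c) Fs" if "Ck_on s W J" for s
  proof (rule Lim_transform_eventually[OF Ck_on_nth_tendsto[OF oJ J(2) that Fsc]])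
    show "\<forall>\<^sub>F t in Fs. nth_vector_derivative s W t = nth_vector_derivative s u t"
      by (rule eventually_mono[OF inS], rule nth_vector_derivative_cong_open[OF oS]) (auto simp: u_S)
  qed
  \<comment> \<open>Below order r the derivative of u has a two-sided limit, which is computed once
    from each side.\<close>
  have agree: "nth_vector_derivative s V c = nth_vector_derivative s W c" if "s < r" "Ck_on s W J" for s
  proof -
    obtain L where L: "(nth_vector_derivative s u \<longlongrightarrow> L) (at c)"
      using r \<open>s < r\<close> unfolding lowest_discontinuous_derivative_def continuous_across_def by blast
    have "L = nth_vector_derivative s V c"
      by (rule tendsto_unique[OF nb(2) tendsto_mono[OF Fnc L] limN])
    moreover have "L = nth_vector_derivative s W c"
      by (rule tendsto_unique[OF nb(1) tendsto_mono[OF Fsc L] limS[OF that(2)]])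
    ultimately show ?thesis by simp
  qed
  \<comment> \<open>If \<open>z\<close> is of class C^s with s < r, so is \<open>W\<close>; its
    derivatives at c agree with those of \<open>V\<close> up to order s, so the control is C^s
    across c and the differential equation makes \<open>z\<close> of class C^(s+1).\<close>
  have Cz: "s \<le> r \<Longrightarrow> Ck_on s z J" for s
  proof (induction s)
    case (Suc s)
    then have Ws: "Ck_on s W J" by (intro CW) auto
    have eq: "nth_vector_derivative i V c = nth_vector_derivative i W c" if "i \<le> s" for i
      using that Suc.prems by (intro agree Ck_on_mono[OF Ws]) auto
    \<comment> \<open>The control has an arbitrary value at c, so a glued \<open>v\<close> replaces
      it in the differential equation.\<close>
    have "\<exists>v. Ck_on s v J \<and> (\<forall>t\<in>J - {c}. v t = u t)"
    proof (cases "S = {l<..<c}")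
      case True
      then have "N = {c<..<h}" using sides J by auto
      then show ?thesis
        using Ck_on_glue[OF J Ws CV] eq True u_S u_N J
        by (intro exI[of _ "\<lambda>t. if t < c then W t else V t"]) auto
    next
      case False
      then have "S = {c<..<h}" "N = {l<..<c}" using sides by auto
      then show ?thesis
        using Ck_on_glue[OF J CV Ws] eq u_S u_N J
        by (intro exI[of _ "\<lambda>t. if t < c then V t else W t"]) auto
    qed
    then obtain v where v: "Ck_on s v J" "\<And>t. t \<in> J - {c} \<Longrightarrow> v t = u t" by blast
    have C: "Ck_on s (\<lambda>t. hamiltonian_field P (z t) (v t)) J"
      using Suc by (intro Ck_on_hamiltonian_field P oJ v) auto
    show ?case
    proof (rule Ck_on_real_SucI[OF oJ _ C])
      fix t assume "t \<in> J"
      then show "(z has_vector_derivative hamiltonian_field P (z t) (v t)) (at t)"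
        by (rule has_vector_derivative_fill_point[OF oJ zc Ck_on_imp_continuous_on[OF C], where c = c])
           (use zd v(2) in auto)
    qed
  qed (use zc in simp)
  have Wr: "Ck_on r W J" by (intro CW Cz) auto

  \<comment> \<open>Leading coefficients and their signs\<close>
  define G where "G t = V t - W t" for t
  have Gr: "Ck_on r G J" unfolding G_def by (intro Ck_on_diff oJ CV Wr)
  have nthG: "nth_vector_derivative s G c = nth_vector_derivative s V c - nth_vector_derivative s W c"
    if "s \<le> r" for s
    unfolding G_def by (rule nth_vector_derivative_diff[OF oJ CV Ck_on_mono[OF Wr that] J(2)])
  define \<Delta> where "\<Delta> = nth_vector_derivative r G c"
  \<comment> \<open>Otherwise both one-sided limits of the r-th derivative of u would
    coincide.\<close>
  have "\<Delta> \<noteq> 0"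
  proof
    assume "\<Delta> = 0"
    then have "nth_vector_derivative r V c = nth_vector_derivative r W c" by (simp add: \<Delta>_def nthG)
    then have "(nth_vector_derivative r u \<longlongrightarrow> nth_vector_derivative r V c) (at c)"
      using limS[OF Wr] by (intro split limN) simp
    then show False using r unfolding lowest_discontinuous_derivative_def continuous_across_def by blast
  qed
  have ratioG: "((\<lambda>t. G t $ i / (t - c) ^ r) \<longlongrightarrow> \<Delta> $ i / fact r) F"
    if "F = at_right c \<or> F = at_left c" for F i
  proof -
    have "nth_vector_derivative s (\<lambda>t. G t $ i) c = nth_vector_derivative s G c $ i" if "s \<le> r" for s
      by (rule nth_vector_derivative_vec_nth[OF oJ Ck_on_mono[OF Gr that] J(2)])
    moreover have "nth_vector_derivative s G c = 0" if "s < r" for s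
      using that nthG[of s] agree[OF that Ck_on_mono[OF Wr]] by simp
    ultimately show ?thesis
      using Ck_on_one_sided_ratio[OF that oJ J(2) Ck_on_vec_nth[OF oJ Gr], of i] by (simp add: \<Delta>_def)
  qed
  have signS: "0 \<le> es ^ r * (\<sigma> i * (\<Delta> $ i / fact r))" for i
  proof (rule one_sided_ratio_sign[OF Fs])
    show "\<forall>\<^sub>F t in Fs. 0 \<le> \<sigma> i * G t $ i"
    proof (rule eventually_mono[OF inS])
      fix t assume t: "t \<in> S"
      have "\<sigma> i * \<sigma> i = 1" using \<sigma>[of i] by (metis abs_mult_self_eq mult_1)
      then have "\<sigma> i * G t $ i = K t - \<sigma> i * u t $ i"
        using u_S[OF t] by (simp add: G_def V_def algebra_simps mult.assoc[symmetric])
      moreover have "\<bar>\<sigma> i * u t $ i\<bar> \<le> K t" using uS[OF t, of i] \<sigma>[of i] by (simp add: abs_mult)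
      ultimately show "0 \<le> \<sigma> i * G t $ i" by linarith
    qed
    show "((\<lambda>t. \<sigma> i * G t $ i / (t - c) ^ r) \<longlongrightarrow> \<sigma> i * (\<Delta> $ i / fact r)) Fs"
      using tendsto_mult[OF tendsto_const ratioG[OF Fs'], of "\<sigma> i" i] by simp
  qed
  have cB: "((\<lambda>t. B (z t) $ i $ j) \<longlongrightarrow> B (z c) $ i $ j) (at c)" for i j
  proof -
    have "continuous_on J (\<lambda>t. B (z t) $ i $ j)"
      unfolding B_def using Ck_on_control_matrix_nth[OF P, of 0]
      by (auto intro: continuous_on_compose2[OF _ zc subset_UNIV])
    then show ?thesis using oJ J(2) by (metis (no_types, lifting) continuous_on_eq_continuous_at isCont_def)
  qed
  have ratio\<phi>: "((\<lambda>t. switching P (z t) $ i / (t - c) ^ (r + 2 * q)) \<longlongrightarrow>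
      ((B (z c) *v \<Delta>) $ i / fact r) * fact r / fact (r + 2 * q)) Fn" for i
  proof -
    \<comment> \<open>The tower for l'Hopital's rule on the nonsingular side. Its top replaces
      \<open>A + B u\<close> by \<open>B G\<close>, equal there because u = V and
      \<open>B W = - A\<close>, and its quotient by \<open>(t - c) ^ r\<close> has a limit.\<close>
    define D where "D j t = (if j < 2 * q then \<Psi> j t $ i else (B (z t) *v G t) $ i)" for j t
    have "((\<lambda>t. D 0 t / (t - c) ^ (r + 2 * q)) \<longlongrightarrow>
      ((B (z c) *v \<Delta>) $ i / fact r) * fact r / fact (r + 2 * q)) Fn"
    proof (rule one_sided_ratio[OF Fn'])
      fix j assume j: "j < 2 * q"
      have Dj: "D j = (\<lambda>t. \<Psi> j t $ i)" using j by (simp add: D_def fun_eq_iff)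
      show "(D j \<longlongrightarrow> 0) Fn" using tendsto_vec_nth[OF \<Psi>c[OF j], of i] by (simp add: Dj)
      show "\<forall>\<^sub>F t in Fn. (D j has_real_derivative D (Suc j) t) (at t)"
      proof (rule eventually_mono[OF inN])
        fix t assume t: "t \<in> N"
        then have tJ: "t \<in> J - {c}" using JSN by auto
        have "switching_deriv P (Suc j) (z t) (u t) $ i = D (Suc j) t"
        proof (cases "Suc j < 2 * q")
          case True then show ?thesis by (simp add: D_def below del: switching_deriv.simps)
        next
          case False
          then have "j = q'" using j q' by simp
          have "A (z t) + B (z t) *v u t = B (z t) *v G t"
            using BW[of t] tJ by (simp add: G_def u_N[OF t] matrix_vector_mult_diff_distrib)
          then show ?thesis using False by (simp add: D_def \<open>j = q'\<close> top del: switching_deriv.simps)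
        qed
        then show "(D j has_real_derivative D (Suc j) t) (at t)"
          using bounded_linear.has_vector_derivative[OF bounded_linear_vec_nth d\<Psi>[OF tJ, of j], of i] j
          by (simp add: Dj has_real_derivative_iff_has_vector_derivative del: switching_deriv.simps)
      qed
    next
      have "((\<lambda>t. \<Sum>l\<in>UNIV. B (z t) $ i $ l * (G t $ l / (t - c) ^ r)) \<longlongrightarrow>
          (\<Sum>l\<in>UNIV. B (z c) $ i $ l * (\<Delta> $ l / fact r))) Fn"
        by (intro tendsto_sum tendsto_mult ratioG[OF Fn'] tendsto_mono[OF Fnc cB])
      then show "((\<lambda>t. D (2 * q) t / (t - c) ^ r) \<longlongrightarrow> (B (z c) *v \<Delta>) $ i / fact r) Fn"
        by (simp add: D_def matrix_vector_mult_def sum_divide_distrib)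
    qed
    moreover have "D 0 t = switching P (z t) $ i" for t
      using intrinsic_order_pos[OF q] by (simp add: D_def \<Psi>_def)
    ultimately show ?thesis by simp
  qed
  have signN': "0 \<le> en ^ r * (\<sigma> i * (B (z c) *v \<Delta>) $ i)" for i
  proof -
    have "0 \<le> en ^ (r + 2 * q) * (\<sigma> i * (((B (z c) *v \<Delta>) $ i / fact r) * fact r / fact (r + 2 * q)))"
    proof (rule one_sided_ratio_sign[OF Fn])
      show "\<forall>\<^sub>F t in Fn. 0 \<le> \<sigma> i * switching P (z t) $ i" by (rule eventually_mono[OF inN]) (rule signN)
      show "((\<lambda>t. \<sigma> i * switching P (z t) $ i / (t - c) ^ (r + 2 * q)) \<longlongrightarrow>
          \<sigma> i * (((B (z c) *v \<Delta>) $ i / fact r) * fact r / fact (r + 2 * q))) Fn"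
        using tendsto_mult[OF tendsto_const ratio\<phi>, of "\<sigma> i" i] by simp
    qed
    moreover have "en ^ (2 * q) = 1" using Fn by (auto simp: power_mult)
    ultimately have "0 \<le> (en ^ r * (\<sigma> i * (B (z c) *v \<Delta>) $ i)) / fact (r + 2 * q)"
      by (simp add: power_add)
    moreover have "0 < (fact (r + 2 * q) :: real)" by (rule fact_gt_zero)
    ultimately show ?thesis unfolding zero_le_divide_iff by linarith
  qed
  \<comment> \<open>Multiplying the two sign relations removes the unknown \<sigma>, since its
    square is 1, and turns the orientations into \<open>(es * en) ^ r\<close>.\<close>
  have main: "0 \<le> (- 1) ^ r * (\<Delta> $ i * (B (z c) *v \<Delta>) $ i)" for i
  proof -
    have "\<sigma> i * \<sigma> i = 1" using \<sigma>[of i] by (metis abs_mult_self_eq mult_1)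
    have "0 \<le> es ^ r * (\<sigma> i * \<Delta> $ i)"
    proof -
      have "0 \<le> (es ^ r * (\<sigma> i * \<Delta> $ i)) / fact r" using signS[of i] by simp
      moreover have "0 < (fact r :: real)" by (rule fact_gt_zero)
      ultimately show ?thesis unfolding zero_le_divide_iff by linarith
    qed
    then have "0 \<le> (es ^ r * (\<sigma> i * \<Delta> $ i)) * (en ^ r * (\<sigma> i * (B (z c) *v \<Delta>) $ i))"
      using signN' by (rule mult_nonneg_nonneg)
    also have "\<dots> = (es * en) ^ r * (\<sigma> i * \<sigma> i) * (\<Delta> $ i * (B (z c) *v \<Delta>) $ i)"
      by (simp add: power_mult_distrib)
    finally show ?thesis using e \<open>\<sigma> i * \<sigma> i = 1\<close> by simp
  qed

  \<comment> \<open>Definiteness at the junction and the parity conclusion\<close>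
  define M where "M t = (- 1) ^ q *\<^sub>R B (z t)" for t
  have "v \<bullet> (M c *v v) \<le> 0" for v
  \<comment> \<open>The Legendre-Clebsch condition is available only inside the singular arc;
    semidefiniteness reaches c because it is closed under limits.\<close>
  proof (rule tendsto_upperbound[OF _ _ nb(1)])
    have M: "v \<bullet> (M t *v v) = (\<Sum>i\<in>UNIV. v $ i * (\<Sum>j\<in>UNIV. (- 1) ^ q * B (z t) $ i $ j * v $ j))" for t
      by (simp add: inner_vec_def matrix_vector_mult_def M_def)
    show "((\<lambda>t. v \<bullet> (M t *v v)) \<longlongrightarrow> v \<bullet> (M c *v v)) Fs"
      unfolding M by (intro tendsto_sum tendsto_mult tendsto_const tendsto_mono[OF Fsc cB])
    show "\<forall>\<^sub>F t in Fs. v \<bullet> (M t *v v) \<le> 0"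
      using glc by (intro eventually_mono[OF inS]) (simp add: negative_semidefinite_def M_def B_def)
  qed
  then have nsd: "negative_semidefinite (M c)" by (simp add: negative_semidefinite_def)
  have sym: "transpose (M c) = M c"
    using control_matrix_symmetric[OF P q, of "z c"] by (simp add: M_def B_def transpose_scalar)
  show ?thesis
  proof (rule ccontr)
    \<comment> \<open>Equal parities identify the two signs, so the form of \<open>M c\<close> is
      both nonpositive and nonnegative at \<open>\<Delta>\<close>; invertibility then forces
      \<open>\<Delta> = 0\<close>.\<close>
    assume "\<not> odd (q + r)"
    then have "(- 1 :: real) ^ q = (- 1) ^ r" by (auto simp: minus_one_power_iff)
    then have "\<Delta> \<bullet> (M c *v \<Delta>) = (\<Sum>i\<in>UNIV. (- 1) ^ r * (\<Delta> $ i * (B (z c) *v \<Delta>) $ i))"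
      by (simp add: inner_vec_def M_def scaleR_matrix_vector_assoc[symmetric] mult.left_commute)
    then have "0 \<le> \<Delta> \<bullet> (M c *v \<Delta>)" using main by (simp add: sum_nonneg)
    then have "M c *v \<Delta> = 0" by (rule semidefinite_isotropic_imp_kernel[OF nsd sym])
    then have "B (z c) *v \<Delta> = 0" by (simp add: M_def scaleR_matrix_vector_assoc[symmetric])
    moreover have "invertible (B (z c))" using inv J(2) by (simp add: B_def)
    ultimately have "\<Delta> = 0" by (metis invertible_def matrix_vector_mul_assoc matrix_vector_mul_lid matrix_vector_mult_0_right)
    then show False using \<open>\<Delta> \<noteq> 0\<close> by simp
  qed
qed

text \<open>An overlap would be a nonempty open set on which the switching functions are zero and
  almost everywhere nonzero. This forces the arcs to lie on opposite sides of a common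
  endpoint.\<close>

lemma singular_nonsingular_disjoint:
  fixes P :: "('n::finite, 'm::finite) affine_problem"
  assumes "singular_arc P T z a b" "nonsingular_arc P T z c d"
  shows "{a<..<b} \<inter> {c<..<d} = {}"
proof (rule ccontr)
  assume "{a<..<b} \<inter> {c<..<d} \<noteq> {}"
  then obtain y where y: "y \<in> {a<..<b} \<inter> {c<..<d}" by blast
  have "AE t in lebesgue_on {c<..<d}. \<forall>i. switching P (z t) $ i \<noteq> 0"
    using assms(2) by (simp add: nonsingular_arc_def)
  then obtain t where "t \<in> {a<..<b} \<inter> {c<..<d}" "\<forall>i. switching P (z t) $ i \<noteq> 0"
    by (rule AE_lebesgue_on_open_dense[OF _ _ _ _ y]) auto
  then show False using assms(1) by (auto simp: singular_arc_def)
qed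

theorem theorem3p1:
  fixes P :: "('n::finite, 'm::finite) affine_problem"
    and T lam tc a b c d :: real
    and x p :: "real \<Rightarrow> real^'n" and u :: "real \<Rightarrow> real^'m"
    and q r :: nat
  assumes "analytic_problem P"
    and "optimal P T x u"
    and "pmp_lift P T x u lam p"
    and "intrinsic_order P q"
    and "legendre_clebsch P q T (extremal_curve P x u lam p)"
    and "junction P T (extremal_curve P x u lam p) a b c d tc"
    and "analytic_junction_of_order P q T (extremal_curve P x u lam p) u tc"
    and "\<forall>t\<in>{a<..<b}. \<forall>i. \<bar>u t $ i\<bar> < bound P t"
    and "lowest_discontinuous_derivative u tc r"
  shows "odd (q + r)"
proof -
  note P = assms(1) and lift = assms(3)
  have adm: "admissible P T x u" using assms(2) by (simp add: optimal_def)
  define z where "z = extremal_curve P x u lam p"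
  have sa: "singular_arc P T z a b" and na: "nonsingular_arc P T z c d"
    and tc: "tc \<in> {a, b}" "tc \<in> {c, d}"
    using assms(6) by (auto simp: junction_def z_def)
  have ab: "0 \<le> a" "a < b" "b \<le> T" and cd: "0 \<le> c" "c < d" "d \<le> T"
    using sa na by (auto simp: singular_arc_def nonsingular_arc_def)
  obtain a' b' where ab': "0 \<le> a'" "a' < tc" "tc < b'" "b' \<le> T" "piecewise_real_analytic_on u a' b'"
    using assms(7) by (auto simp: analytic_junction_of_order_def analytic_junction_def)
  then obtain t1 t2 where t12: "a' < t1" "t1 < tc" "tc < t2" "t2 < b'"
      "real_analytic_on u {t1<..<tc}" "real_analytic_on u {tc<..<t2}"
    unfolding piecewise_real_analytic_on_def by force
  have cu: "continuous_on {t1<..<tc} u" "continuous_on {tc<..<t2} u"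
    using real_analytic_on_imp_Ck_on[OF t12(5), of 0] real_analytic_on_imp_Ck_on[OF t12(6), of 0] by auto
  have "\<forall>\<^sub>F t in nhds tc. invertible (control_matrix P (2 * q) (z t))"
    using assms(7) by (simp add: analytic_junction_of_order_def z_def)
  then obtain \<delta> where \<delta>: "\<delta> > 0" "\<And>t. dist t tc < \<delta> \<Longrightarrow> invertible (control_matrix P (2 * q) (z t))"
    unfolding eventually_nhds_metric by blast
  \<comment> \<open>A window small enough for continuity of the control off the junction, for
    invertibility of \<open>B\<close>, and for each half to lie in its own arc.\<close>
  have key: "odd (q + r)"
    if lh: "l < tc" "tc < h" "t1 \<le> l" "h \<le> t2" "tc - \<delta> \<le> l" "h \<le> tc + \<delta>"
      and sides: "(S = {l<..<tc} \<and> N = {tc<..<h}) \<or> (S = {tc<..<h} \<and> N = {l<..<tc})"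
      and SN: "S \<subseteq> {a<..<b}" "N \<subseteq> {c<..<d}" for l h S N
  proof -
    define J where "J = {l<..<h}"
    have JT: "J \<subseteq> {0..T}" using lh t12 ab' by (auto simp: J_def)
    have oSN: "open S" "open N" "connected N" "S \<subseteq> J" "N \<subseteq> J" "J - {tc} = S \<union> N"
      using sides lh by (auto simp: J_def)
    have cSN: "continuous_on S u" "continuous_on N u"
      using sides lh cu by (auto intro: continuous_on_subset)
    obtain \<sigma> where \<sigma>: "\<And>i. \<bar>\<sigma> i\<bar> = (1::real)" "\<And>i t. t \<in> N \<Longrightarrow> u t $ i = \<sigma> i * bound P t"
      "\<And>i t. t \<in> N \<Longrightarrow> 0 \<le> \<sigma> i * switching P (z t) $ i"
      using bang_bang[OF P adm lift na[unfolded z_def] oSN(2,3) SN(2) cSN(2)] unfolding z_def by blast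
    show ?thesis
    proof (rule junction_parity[OF P assms(4) J_def _ sides, of z u "bound P" \<sigma>])
      show "tc \<in> J" using lh by (simp add: J_def)
      show "continuous_on J z"
        unfolding z_def by (rule continuous_on_subset[OF extremal_curve_continuous_on[OF P adm lift] JT])
      show "(z has_vector_derivative hamiltonian_field P (z t) (u t)) (at t)" if t: "t \<in> J - {tc}" for t
      proof -
        have "t \<in> S \<or> t \<in> N" using t unfolding oSN(6) by simp
        then show ?thesis unfolding z_def
        proof
          assume "t \<in> S"
          then show "(extremal_curve P x u lam p has_vector_derivative
              hamiltonian_field P (extremal_curve P x u lam p t) (u t)) (at t)"
            by (rule extremal_curve_has_vector_derivative[OF P adm lift oSN(1)
                  order_trans[OF oSN(4) JT] cSN(1)])
        next
          assume "t \<in> N"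
          then show "(extremal_curve P x u lam p has_vector_derivative
              hamiltonian_field P (extremal_curve P x u lam p t) (u t)) (at t)"
            by (rule extremal_curve_has_vector_derivative[OF P adm lift oSN(2)
                  order_trans[OF oSN(5) JT] cSN(2)])
        qed
      qed
      show "invertible (control_matrix P (2 * q) (z t))" if "t \<in> J" for t
        using that lh by (intro \<delta>(2)) (auto simp: J_def dist_real_def)
      show "switching P (z t) = 0" if "t \<in> S" for t
        using that sa SN(1) by (auto simp: singular_arc_def vec_eq_iff)
      show "Ck_on k (bound P) J" for k
        using JT by (intro Ck_on_subset[OF analytic_problem_Ck_on(5)[OF P]]) auto
      show "\<bar>u t $ i\<bar> \<le> bound P t" if "t \<in> S" for t i
        using adm that oSN(4) JT by (auto simp: admissible_def control_set_def)
      show "negative_semidefinite ((- 1) ^ q *\<^sub>R control_matrix P (2 * q) (z t))" if "t \<in> S" for t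
        using assms(5) sa SN(1) that unfolding legendre_clebsch_def z_def by blast
    qed (use \<sigma> assms(9) in auto)
  qed
  have disj: "{a<..<b} \<inter> {c<..<d} = {}" by (rule singular_nonsingular_disjoint[OF sa na])
  \<comment> \<open>In the last two configurations both arcs start, or both end, at the junction, so
    they would overlap.\<close>
  consider "tc = b" "tc = c" | "tc = a" "tc = d" | "tc = a" "tc = c" | "tc = b" "tc = d"
    using tc by blast
  then show ?thesis
  proof cases
    case 1
    then show ?thesis
      using ab cd t12 \<delta>(1)
      by (intro key[of "max (max t1 a) (tc - \<delta>)" "min (min t2 d) (tc + \<delta>)"
            "{max (max t1 a) (tc - \<delta>)<..<tc}" "{tc<..<min (min t2 d) (tc + \<delta>)}"]) auto
  next
    case 2
    then show ?thesis
      using ab cd t12 \<delta>(1)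
      by (intro key[of "max (max t1 c) (tc - \<delta>)" "min (min t2 b) (tc + \<delta>)"
            "{tc<..<min (min t2 b) (tc + \<delta>)}" "{max (max t1 c) (tc - \<delta>)<..<tc}"]) auto
  next
    case 3
    then obtain s where "tc < s" "s < min b d" using ab cd dense[of tc "min b d"] by auto
    then show ?thesis using disj 3 by auto
  next
    case 4
    then obtain s where "max a c < s" "s < tc" using ab cd dense[of "max a c" tc] by auto
    then show ?thesis using disj 4 by auto
  qed
qed

end
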